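(* There is a $2$-approximation algorithm for Undirected Multicut whose running time is $\mathrm{poly}(n, k^{O(t)})$ on instances with supply graph $G$ and $tK_2$-free demand graph $H$, where $n = |V(G)|$ and $k = |V(H)|$.
   Context: Undirected Multicut: the input is an undirected supply graph $G=(V,E)$ with nonnegative edge weights $w_e$ and an undirected simple demand graph $H$ whose vertices are vertices of $G$. A feasible solution is a set $E' \subseteq E$ such that for every edge $st$ of $H$ there is no path from $s$ to $t$ in $G - E'$; the goal is to minimize $\sum_{e\in E'} w_e$. An $\alpha$-approximation algorithm returns a feasible solution of weight at most $\alpha$ times the optimum. For an integer $t>1$, a graph is $tK_2$-free if it does not contain a matching with $t$ edges as an induced subgraph (i.e. there are no $t$ edges of the graph whose $2t$ endpoints are distinct and such that the subgraph induced on these $2t$ vertices consists of exactly these $t$ edges). *)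

theory Defs
  imports Complex_Main
begin

section \<open>Undirected Multicut\<close>

text \<open>
  The vertices of the supply graph are numbered, \<open>V(G) = {..<nverts I}\<close>. Both graphs are finite
  simple graphs; an undirected edge is the two-element set of its endpoints.
\<close>

definition all_pairs :: "nat set \<Rightarrow> nat set set" where
  "all_pairs V = {{u, v} | u v. u \<in> V \<and> v \<in> V \<and> u \<noteq> v}"

record multicut =
  nverts :: nat
  edges :: "nat set set"
  weight :: "nat set \<Rightarrow> real"
  dverts :: "nat set"
  dedges :: "nat set set"

definition valid_instance :: "multicut \<Rightarrow> bool" where
  "valid_instance I \<longleftrightarrow>
     edges I \<subseteq> all_pairs {..<nverts I} \<and>
     (\<forall>e\<in>edges I. 0 \<le> weight I e) \<and>
     dverts I \<subseteq> {..<nverts I} \<and>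
     dedges I \<subseteq> all_pairs (dverts I)"

definition is_path :: "nat set set \<Rightarrow> nat \<Rightarrow> nat list \<Rightarrow> nat \<Rightarrow> bool" where
  "is_path E s p t \<longleftrightarrow>
     p \<noteq> [] \<and> hd p = s \<and> last p = t \<and> distinct p \<and> successively (\<lambda>u v. {u, v} \<in> E) p"

definition feasible :: "multicut \<Rightarrow> nat set set \<Rightarrow> bool" where
  "feasible I F \<longleftrightarrow>
     F \<subseteq> edges I \<and>
     (\<forall>s t. {s, t} \<in> dedges I \<longrightarrow> \<not> (\<exists>p. is_path (edges I - F) s p t))"

definition cost :: "multicut \<Rightarrow> nat set set \<Rightarrow> real" where
  "cost I F = (\<Sum>e\<in>F. weight I e)"

definition opt :: "multicut \<Rightarrow> real" where
  "opt I = Min (cost I ` {F. feasible I F})"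

definition tK2_free :: "nat \<Rightarrow> nat set set \<Rightarrow> bool" where
  "tK2_free t E \<longleftrightarrow>
     \<not> (\<exists>M\<subseteq>E. finite M \<and> card M = t \<and> card (\<Union>M) = 2 * t \<and> {e \<in> E. e \<subseteq> \<Union>M} = M)"

text \<open>The minimum in \<^const>\<open>opt\<close> is over a finite nonempty set.\<close>

lemma finite_all_pairs: "finite V \<Longrightarrow> finite (all_pairs V)"
  by (rule finite_subset[of _ "Pow V"]) (auto simp: all_pairs_def)

lemma finite_feasible:
  assumes "valid_instance I"
  shows "finite {F. feasible I F}"
proof (rule finite_subset)
  show "{F. feasible I F} \<subseteq> Pow (edges I)"
    by (auto simp: feasible_def)
  show "finite (Pow (edges I))"
    using assms finite_all_pairs[of "{..<nverts I}"]
    by (auto simp: valid_instance_def intro: finite_subset)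
qed

lemma feasible_all_edges:
  assumes "valid_instance I"
  shows "feasible I (edges I)"
proof -
  have "\<not> is_path {} s p t" if "{s, t} \<in> dedges I" for s p t
  proof
    assume p: "is_path {} s p t"
    have "{s, t} \<in> all_pairs (dverts I)"
      using that assms by (auto simp: valid_instance_def)
    hence "s \<noteq> t"
      by (auto simp: all_pairs_def doubleton_eq_iff)
    with p show False
      by (cases p rule: remdups_adj.cases) (auto simp: is_path_def)
  qed
  thus ?thesis
    by (auto simp: feasible_def)
qed

section \<open>Model of computation\<close>

text \<open>
  Algorithms are programs for a real RAM, given as While programs over finitely many named arrays of
  natural numbers and finitely many named arrays of reals (a scalar is cell 0 of an array). Real
  numbers are subject to field operations and comparison at unit cost, without rounding or any other
  conversion to natural numbers, and the only numeric literals are natural numbers, so that no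
  information can be hidden in a real constant. On natural numbers, which also serve as array
  indices, only addition and truncated subtraction have unit cost: after \<open>T\<close> steps a natural number
  has \<open>O(T)\<close> more bits than the initial ones, hence there is no speed-up by arithmetic on long
  numbers.

  Expressions occur literally in the program, so their size is a constant of the program; evaluating
  one is charged as part of the step in which it occurs.
\<close>

datatype nexp =
    NConst nat
  | NCell nat nexp
  | NAdd nexp nexp
  | NSub nexp nexp

datatype rexp =
    ROfNat nexp
  | RCell nat nexp
  | RAdd rexp rexp
  | RSub rexp rexp
  | RMul rexp rexp
  | RDiv rexp rexp

datatype bexp =
    NLess nexp nexp
  | RLess rexp rexp
  | BNot bexp
  | BAnd bexp bexp

datatype com =
    Skip
  | NStore nat nexp nexp
  | RStore nat nexp rexp
  | Seq com com
  | Cond bexp com com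
  | While bexp com

record state =
  nmem :: "nat \<Rightarrow> nat \<Rightarrow> nat"
  rmem :: "nat \<Rightarrow> nat \<Rightarrow> real"

fun nval :: "nexp \<Rightarrow> state \<Rightarrow> nat" where
  "nval (NConst c) s = c"
| "nval (NCell a i) s = nmem s a (nval i s)"
| "nval (NAdd x y) s = nval x s + nval y s"
| "nval (NSub x y) s = nval x s - nval y s"

fun rval :: "rexp \<Rightarrow> state \<Rightarrow> real" where
  "rval (ROfNat x) s = real (nval x s)"
| "rval (RCell a i) s = rmem s a (nval i s)"
| "rval (RAdd x y) s = rval x s + rval y s"
| "rval (RSub x y) s = rval x s - rval y s"
| "rval (RMul x y) s = rval x s * rval y s"
| "rval (RDiv x y) s = rval x s / rval y s"

fun bval :: "bexp \<Rightarrow> state \<Rightarrow> bool" where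
  "bval (NLess x y) s \<longleftrightarrow> nval x s < nval y s"
| "bval (RLess x y) s \<longleftrightarrow> rval x s < rval y s"
| "bval (BNot b) s \<longleftrightarrow> \<not> bval b s"
| "bval (BAnd b c) s \<longleftrightarrow> bval b s \<and> bval c s"

definition nupdate :: "nat \<Rightarrow> nat \<Rightarrow> nat \<Rightarrow> state \<Rightarrow> state" where
  "nupdate a i x s = s\<lparr>nmem := (nmem s)(a := (nmem s a)(i := x))\<rparr>"

definition rupdate :: "nat \<Rightarrow> nat \<Rightarrow> real \<Rightarrow> state \<Rightarrow> state" where
  "rupdate a i x s = s\<lparr>rmem := (rmem s)(a := (rmem s a)(i := x))\<rparr>"

text \<open>
  \<open>exec c s T s'\<close>: started in \<open>s\<close>, the program \<open>c\<close> halts in \<open>s'\<close> after exactly \<open>T\<close> steps, counting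
  every assignment, every \<open>Skip\<close> and every evaluation of a test.
\<close>

inductive exec :: "com \<Rightarrow> state \<Rightarrow> nat \<Rightarrow> state \<Rightarrow> bool" where
  Skip: "exec Skip s 1 s"
| NStore: "exec (NStore a i x) s 1 (nupdate a (nval i s) (nval x s) s)"
| RStore: "exec (RStore a i x) s 1 (rupdate a (nval i s) (rval x s) s)"
| Seq: "exec c\<^sub>1 s T\<^sub>1 s' \<Longrightarrow> exec c\<^sub>2 s' T\<^sub>2 s'' \<Longrightarrow> exec (Seq c\<^sub>1 c\<^sub>2) s (T\<^sub>1 + T\<^sub>2) s''"
| CondTrue: "bval b s \<Longrightarrow> exec c\<^sub>1 s T s' \<Longrightarrow> exec (Cond b c\<^sub>1 c\<^sub>2) s (T + 1) s'"
| CondFalse: "\<not> bval b s \<Longrightarrow> exec c\<^sub>2 s T s' \<Longrightarrow> exec (Cond b c\<^sub>1 c\<^sub>2) s (T + 1) s'"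
| WhileFalse: "\<not> bval b s \<Longrightarrow> exec (While b c) s 1 s"
| WhileTrue: "bval b s \<Longrightarrow> exec c s T\<^sub>1 s' \<Longrightarrow> exec (While b c) s' T\<^sub>2 s'' \<Longrightarrow>
    exec (While b c) s (T\<^sub>1 + T\<^sub>2 + 1) s''"

inductive_cases SkipE: "exec Skip s T s'"
inductive_cases NStoreE: "exec (NStore a i x) s T s'"
inductive_cases RStoreE: "exec (RStore a i x) s T s'"
inductive_cases SeqE: "exec (Seq c\<^sub>1 c\<^sub>2) s T s'"
inductive_cases CondE: "exec (Cond b c\<^sub>1 c\<^sub>2) s T s'"
inductive_cases WhileE: "exec (While b c) s T s'"

theorem exec_deterministic:
  "exec c s T s' \<Longrightarrow> exec c s U u \<Longrightarrow> U = T \<and> u = s'"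
proof (induction arbitrary: U u rule: exec.induct)
  case (Seq c\<^sub>1 s T\<^sub>1 s' c\<^sub>2 T\<^sub>2 s'')
  obtain U\<^sub>1 u' U\<^sub>2 where "exec c\<^sub>1 s U\<^sub>1 u'" "exec c\<^sub>2 u' U\<^sub>2 u" "U = U\<^sub>1 + U\<^sub>2"
    using Seq.prems by (rule SeqE)
  thus ?case
    using Seq.IH by metis
next
  case (CondTrue b s c\<^sub>1 T s' c\<^sub>2)
  from CondTrue.prems show ?case
    by (rule CondE) (use CondTrue.hyps in \<open>auto dest: CondTrue.IH\<close>)
next
  case (CondFalse b s c\<^sub>2 T s' c\<^sub>1)
  from CondFalse.prems show ?case
    by (rule CondE) (use CondFalse.hyps in \<open>auto dest: CondFalse.IH\<close>)
next
  case (WhileFalse b s c)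
  from WhileFalse.prems show ?case
    by (rule WhileE) (use WhileFalse.hyps in auto)
next
  case (WhileTrue b s c T\<^sub>1 s' T\<^sub>2 s'')
  from WhileTrue.prems obtain U\<^sub>1 u' U\<^sub>2
    where "exec c s U\<^sub>1 u'" "exec (While b c) u' U\<^sub>2 u" "U = U\<^sub>1 + U\<^sub>2 + 1"
    by (rule WhileE) (use WhileTrue.hyps in auto)
  thus ?case
    using WhileTrue.IH by metis
qed (auto elim: SkipE NStoreE RStoreE)

section \<open>Algorithms for Undirected Multicut\<close>

text \<open>
  Input: the number \<open>n\<close> of vertices in cell 0 of array 0; the adjacency matrix of \<open>G\<close> in array 1;
  the characteristic vector of \<open>V(H)\<close> in array 2; the adjacency matrix of \<open>H\<close> in array 3; the weight
  matrix in real array 0. Matrices are stored row by row, with entry \<open>(u, v)\<close> at index \<open>u * n + v\<close>.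
  All other cells contain 0.
\<close>

definition row_major :: "nat \<Rightarrow> (nat \<Rightarrow> nat \<Rightarrow> 'a::zero) \<Rightarrow> nat \<Rightarrow> 'a" where
  "row_major n A i = (if i < n * n then A (i div n) (i mod n) else 0)"

definition input_state :: "multicut \<Rightarrow> state" where
  "input_state I =
     (let n = nverts I in
      \<lparr>nmem = (\<lambda>_ _. 0)
         (0 := (\<lambda>_. 0)(0 := n),
          1 := row_major n (\<lambda>u v. of_bool ({u, v} \<in> edges I)),
          2 := (\<lambda>v. of_bool (v \<in> dverts I)),
          3 := row_major n (\<lambda>u v. of_bool ({u, v} \<in> dedges I))),
       rmem = (\<lambda>_ _. 0)
         (0 := row_major n (\<lambda>u v. if {u, v} \<in> edges I then weight I {u, v} else 0))\<rparr>)"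

text \<open>
  Output: a matrix in array 4 whose nonzero entries \<open>(u, v)\<close> mark the edges \<open>{u, v}\<close> of the
  solution.
\<close>

definition output_edges :: "multicut \<Rightarrow> state \<Rightarrow> nat set set" where
  "output_edges I s =
     {{u, v} | u v. u < nverts I \<and> v < nverts I \<and> nmem s 4 (u * nverts I + v) \<noteq> 0}"

definition approx_algorithm :: "real \<Rightarrow> com \<Rightarrow> bool" where
  "approx_algorithm \<alpha> P \<longleftrightarrow>
     (\<forall>I. valid_instance I \<longrightarrow>
        (\<exists>T s. exec P (input_state I) T s \<and>
           feasible I (output_edges I s) \<and>
           cost I (output_edges I s) \<le> \<alpha> * opt I))"

text \<open>Meaningful for halting programs only; well defined by \<open>exec_deterministic\<close>.\<close>

definition running_time :: "com \<Rightarrow> multicut \<Rightarrow> nat" where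
  "running_time P I = (THE T. \<exists>s. exec P (input_state I) T s)"

lemma running_time_eq: "exec P (input_state I) T s \<Longrightarrow> running_time P I = T"
  unfolding running_time_def by (rule the_equality) (auto dest: exec_deterministic)

end

theory Submission
  imports Defs "HOL-Library.FuncSet"
begin

text \<open>
  Cutting the edges between differently labelled vertices reduces the problem to labelling every
  vertex of \<open>G\<close> with a maximal independent set of \<open>H\<close> that contains it (non-terminals being isolated
  in \<open>H\<close>), where an edge costs its weight if its ends have different labels. A \<open>tK\<^sub>2\<close>-free graph has
  only \<open>k\<^bsup>O(t)\<^esup>\<close> maximal independent sets, and they are enumerated by adding the vertices one by
      one.

  The labelling problem is solved by local search. A move gives the vertices of some set a common
  new label; the best move for a given label is a minimum cut. With \<open>L\<close> labels, comparison with the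
  classes of an optimal labelling shows that the best move shrinks \<open>g = cost - 2 * optimum\<close> by the
  factor \<open>1 - 1 / L\<close> as long as \<open>g > 0\<close>. Since \<open>g\<close> is a combination of the weights with
  coefficients in \<open>{-2, .., 1}\<close>, it can be halved only polynomially often before it becomes
  nonpositive, however large or small the weights are. Hence the ratio is exactly 2 after a
  strongly polynomial number of moves.
\<close>

section \<open>Maximal independent sets\<close>

text \<open>Independent sets arise because each component of \<open>G - E'\<close>, for a feasible
  \<open>E'\<close>, is independent in \<open>H\<close>. There may be exponentially many independent
  sets, but only inequality of labels is paid for, so enlarging each component to a maximal
  independent set cannot raise the cost.

  The obstacle is exactness of the ratio. Analyses of such moves usually end at
  \<open>2 + eps\<close>, or need a number of rounds that depends on the magnitudes of the weights,
  and the machine cannot round reals. Moreover \<open>g\<close> contains the unknown optimum, so the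
  program cannot detect when \<open>g\<close> stops being positive. It makes a number of moves fixed
  in advance, \<open>(n + 2) ^ 8\<close> times the number of labels, and only the analysis sees
  \<open>g\<close>. The preflow computation is bounded in the same way: a fixed number of steps,
  idle once no vertex is active.

  The parameter \<open>t\<close> never enters the program, which is correct for every
  \<open>H\<close>; it only bounds the number of labels. The bound holds at every stage of the
  enumeration, since induced subgraphs inherit \<open>tK_2\<close>-freeness.\<close>

definition mis :: "nat set set \<Rightarrow> nat set \<Rightarrow> nat set set" where
  "mis E V = {M. M \<subseteq> V \<and> (\<forall>v\<in>V. v \<in> M \<longleftrightarrow> \<not> (\<exists>u\<in>M. {u, v} \<in> E))}"

lemma finite_mis: "finite V \<Longrightarrow> finite (mis E V)"
  by (rule finite_subset[of _ "Pow V"]) (auto simp: mis_def)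

lemma mis_empty: "mis E {} = {{}}"
  by (auto simp: mis_def)

lemma mis_no_edges:
  assumes "\<And>u v. u \<in> V \<Longrightarrow> v \<in> V \<Longrightarrow> {u, v} \<notin> E"
  shows "mis E V = {V}"
proof -
  have "M = V" if "M \<in> mis E V" for M
    using that assms by (fastforce simp: mis_def)
  moreover have "V \<in> mis E V"
    using assms by (auto simp: mis_def)
  ultimately show ?thesis
    by auto
qed

text \<open>Independence is the left-to-right half of the equivalence in \<open>mis\<close>; the
  other half is maximality.\<close>

lemma mis_independent: "M \<in> mis E V \<Longrightarrow> u \<in> M \<Longrightarrow> v \<in> M \<Longrightarrow> {u, v} \<notin> E"
  by (auto simp: mis_def)

text \<open>By finiteness there is an inclusion-maximal independent superset of \<open>S\<close>. A
  vertex without neighbours in it could be added, \<open>loops\<close> ensuring that it is not its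
  own neighbour.\<close>

lemma mis_extends:
  assumes "finite V" "S \<subseteq> V" "\<And>u v. u \<in> S \<Longrightarrow> v \<in> S \<Longrightarrow> {u, v} \<notin> E"
    and loops: "\<And>v. {v} \<notin> E"
  shows "\<exists>M\<in>mis E V. S \<subseteq> M"
proof -
  define A where "A = {M. S \<subseteq> M \<and> M \<subseteq> V \<and> (\<forall>u\<in>M. \<forall>v\<in>M. {u, v} \<notin> E)}"
  have "finite A"
    using assms(1) by (auto simp: A_def intro: finite_subset[of _ "Pow V"])
  moreover have "S \<in> A"
    using assms by (auto simp: A_def)
  ultimately obtain M where M: "M \<in> A" "S \<subseteq> M" "\<And>B. B \<in> A \<Longrightarrow> M \<subseteq> B \<Longrightarrow> M = B"
    by (metis finite_has_maximal2)
  have "v \<in> M" if v: "v \<in> V" "\<not> (\<exists>u\<in>M. {u, v} \<in> E)" for v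
  proof -
    have "insert v M \<in> A"
      using M(1) v loops by (auto simp: A_def insert_commute)
    thus ?thesis
      using M(3)[of "insert v M"] by auto
  qed
  hence "M \<in> mis E V"
    using M(1) by (auto simp: mis_def A_def)
  thus ?thesis
    using M(2) by auto
qed

text \<open>If \<open>v\<close> is outside \<open>M\<close>, the condition at the other vertices is
  unchanged. If \<open>v\<close> is in \<open>M\<close>, any maximal \<open>I\<close> containing
  \<open>M - {v}\<close> works: a vertex \<open>x\<close> of \<open>I\<close> that is not adjacent
  to \<open>v\<close> and not in \<open>M\<close> would have a neighbour in \<open>M\<close> other
  than \<open>v\<close>, hence in \<open>I\<close>.\<close>

lemma mis_insert_cases:
  assumes "finite V" "v \<notin> V" "M \<in> mis E (insert v V)" "\<And>x. {x} \<notin> E"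
  shows "M \<in> mis E V \<or> (\<exists>I\<in>mis E V. M = insert v {x \<in> I. {x, v} \<notin> E})"
proof (cases "v \<in> M")
  case False
  thus ?thesis
    using assms by (auto simp: mis_def)
next
  case True
  have "\<exists>I\<in>mis E V. M - {v} \<subseteq> I"
    using assms mis_independent[OF assms(3)] by (intro mis_extends) (auto simp: mis_def)
  then obtain I where I: "I \<in> mis E V" "M - {v} \<subseteq> I"
    by auto
  have "x \<in> M" if x: "x \<in> I" "{x, v} \<notin> E" for x
  proof (rule ccontr)
    assume "x \<notin> M"
    then obtain u where u: "u \<in> M" "{u, x} \<in> E"
      using assms(3) I(1) x unfolding mis_def by blast
    hence "u \<in> I"
      using I(2) x by (auto simp: insert_commute)
    thus False
      using mis_independent[OF I(1)] u x by auto
  qed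
  moreover have "x \<in> I \<and> {x, v} \<notin> E" if "x \<in> M" "x \<noteq> v" for x
    using that I(2) mis_independent[OF assms(3) _ True] by auto
  ultimately show ?thesis
    using I(1) True by blast
qed

text \<open>The recursion behind the enumeration. Each old set yields two candidates; membership
  must still be tested because a candidate need not be maximal.\<close>

lemma mis_Suc:
  assumes "\<And>x. {x} \<notin> E"
  shows "mis E {..<Suc j} =
    {M \<in> mis E {..<j} \<union> (\<lambda>I. insert j {x \<in> I. {x, j} \<notin> E}) ` mis E {..<j}. M \<in> mis E {..<Suc j}}"
  using mis_insert_cases[of "{..<j}" j _ E] assms by (auto simp: lessThan_Suc)

text \<open>Vertices outside \<open>D\<close> are isolated and hence in every maximal independent
  set, which is thus determined by its trace on \<open>D\<close>. This replaces \<open>n\<close> by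
  \<open>k\<close> in the count.\<close>

lemma card_mis_isolated:
  assumes "finite V" "\<And>e. e \<in> E \<Longrightarrow> e \<subseteq> D"
  shows "card (mis E V) \<le> card (mis E (V \<inter> D))"
proof (rule card_inj_on_le)
  have *: "M - D = V - D" if "M \<in> mis E V" for M
    using that assms(2) by (fastforce simp: mis_def)
  show "inj_on (\<lambda>M. M \<inter> D) (mis E V)"
  proof (rule inj_onI)
    fix M N assume "M \<in> mis E V" "N \<in> mis E V" "M \<inter> D = N \<inter> D"
    thus "M = N"
      using *[of M] *[of N] by blast
  qed
  show "(\<lambda>M. M \<inter> D) ` mis E V \<subseteq> mis E (V \<inter> D)"
    using assms(2) by (fastforce simp: mis_def)
  show "finite (mis E (V \<inter> D))"
    using assms(1) by (simp add: finite_mis)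
qed

section \<open>Counting maximal independent sets of graphs without large induced matchings\<close>

lemma tK2_free_restrict:
  assumes "tK2_free t E"
  shows "tK2_free t {e \<in> E. e \<subseteq> V}"
  unfolding tK2_free_def
proof (rule notI, elim exE conjE)
  fix M assume M: "M \<subseteq> {e \<in> E. e \<subseteq> V}" "finite M" "card M = t" "card (\<Union>M) = 2 * t"
    "{e \<in> {e \<in> E. e \<subseteq> V}. e \<subseteq> \<Union> M} = M"
  have "{e \<in> E. e \<subseteq> \<Union>M} = M"
    using M(1,5) by blast
  thus False
    using assms M unfolding tK2_free_def by blast
qed

text \<open>An induced matching with \<open>t\<close> edges that avoids the neighbours of
  \<open>v\<close> and of \<open>w\<close> could be enlarged by \<open>{v, w}\<close>, as no edge
  joins it to the new one. The vertex \<open>w\<close> itself is excluded as a neighbour of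
  \<open>v\<close>.\<close>

lemma tK2_free_extend:
  assumes free: "tK2_free (Suc t) {e \<in> E. e \<subseteq> insert v V}"
    and v: "v \<notin> V" and w: "w \<in> V" "{v, w} \<in> E" and fin: "finite V"
    and E: "\<And>e. e \<in> E \<Longrightarrow> card e = 2"
  shows "tK2_free t {e \<in> E. e \<subseteq> {x \<in> V. {x, v} \<notin> E \<and> {x, w} \<notin> E}}"
  unfolding tK2_free_def
proof (rule notI, elim exE conjE)
  let ?V = "{x \<in> V. {x, v} \<notin> E \<and> {x, w} \<notin> E}"
  fix M assume M: "M \<subseteq> {e \<in> E. e \<subseteq> ?V}" "finite M" "card M = t" "card (\<Union>M) = 2 * t"
    "{e \<in> {e \<in> E. e \<subseteq> ?V}. e \<subseteq> \<Union> M} = M"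
  let ?M = "insert {v, w} M"
  have sub: "\<Union>M \<subseteq> ?V"
    using M(1) by blast
  have "v \<notin> \<Union>M" "w \<notin> \<Union>M"
    using sub v w by (auto simp: insert_commute)
  moreover have "v \<noteq> w"
    using v w by auto
  moreover have "finite (\<Union>M)"
    using sub fin finite_subset[of "\<Union>M" V] by blast
  ultimately have card: "card ?M = Suc t" "card (\<Union>?M) = 2 * Suc t"
    using M(2-4) by (auto simp: card_insert_if)
  have ind: "e \<in> ?M" if e: "e \<in> E" "e \<subseteq> \<Union>?M" for e
  proof -
    obtain x y where xy: "e = {x, y}" "x \<noteq> y"
      using E[OF e(1)] by (auto simp: card_2_iff)
    have "x \<in> \<Union>M \<or> x = v \<or> x = w" "y \<in> \<Union>M \<or> y = v \<or> y = w"
      using e(2) xy by auto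
    moreover have "{x, y} \<in> M" if "x \<in> \<Union>M" "y \<in> \<Union>M"
      using M(5) sub e(1) xy that by blast
    moreover have "z \<notin> \<Union>M" if "{z, v} \<in> E \<or> {z, w} \<in> E" for z
      using sub that by blast
    moreover have "{y, x} \<in> E" "{x, y} \<in> E"
      using e(1) xy by (auto simp: insert_commute)
    ultimately have "{x, y} \<in> M \<or> x \<in> {v, w} \<and> y \<in> {v, w}"
      by blast
    thus ?thesis
      using xy by auto
  qed
  have "?M \<subseteq> {e \<in> E. e \<subseteq> insert v V}"
    using M(1) w by auto
  moreover from this have "{e \<in> {e \<in> E. e \<subseteq> insert v V}. e \<subseteq> \<Union>?M} = ?M"
    using ind by blast
  ultimately have "\<exists>M\<subseteq>{e \<in> E. e \<subseteq> insert v V}. finite M \<and> card M = Suc t \<and> card (\<Union>M) = 2 * Suc t \<and>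
      {e \<in> {e \<in> E. e \<subseteq> insert v V}. e \<subseteq> \<Union>M} = M"
    using card M(2) by (intro exI[of _ ?M] conjI) simp_all
  thus False
    using free unfolding tK2_free_def by (rule notE[rotated])
qed

text \<open>
  Deleting \<open>v\<close> from the maximal independent sets of \<open>insert v V\<close> is injective on those that stay
  maximal. Any other one misses all neighbours of \<open>v\<close> and of some neighbour \<open>w\<close> of \<open>v\<close>, and is
  maximal among the vertices not adjacent to the edge \<open>{v, w}\<close>.
\<close>

lemma card_mis_insert:
  assumes fin: "finite V" and v: "v \<notin> V" and E: "\<And>e. e \<in> E \<Longrightarrow> card e = 2"
  shows "card (mis E (insert v V)) \<le> card (mis E V) +
    (\<Sum>w | w \<in> V \<and> {v, w} \<in> E. card (mis E {x \<in> V. {x, v} \<notin> E \<and> {x, w} \<notin> E}))"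
proof -
  let ?N = "{w. w \<in> V \<and> {v, w} \<in> E}"
  let ?V = "\<lambda>w. {x \<in> V. {x, v} \<notin> E \<and> {x, w} \<notin> E}"
  let ?A = "{M \<in> mis E (insert v V). M - {v} \<in> mis E V}"
  have loops: "{x} \<notin> E" for x
    using E[of "{x}"] by auto
  have "card ?A \<le> card (mis E V)"
  proof (rule card_inj_on_le)
    \<comment> \<open>Maximality recovers whether \<open>v\<close> belongs to a set from the other
      members alone.\<close>
    show "inj_on (\<lambda>M. M - {v}) ?A"
    proof (rule inj_onI)
      fix M N assume MN: "M \<in> ?A" "N \<in> ?A" "M - {v} = N - {v}"
      have "v \<in> M \<longleftrightarrow> \<not> (\<exists>u\<in>M - {v}. {u, v} \<in> E)" "v \<in> N \<longleftrightarrow> \<not> (\<exists>u\<in>N - {v}. {u, v} \<in> E)"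
        using MN(1,2) loops by (auto simp: mis_def)
      hence "v \<in> M \<longleftrightarrow> v \<in> N"
        by (simp only: MN(3))
      thus "M = N"
        using MN(3) by blast
    qed
  qed (auto simp: finite_mis fin)
  moreover have "mis E (insert v V) - ?A \<subseteq> (\<Union>w\<in>?N. insert v ` mis E (?V w))"
  proof
    fix M assume M: "M \<in> mis E (insert v V) - ?A"
    have vM: "v \<in> M"
    proof (rule ccontr)
      assume "v \<notin> M"
      hence "M - {v} \<in> mis E V"
        using M by (auto simp: mis_def)
      thus False
        using M by auto
    qed
    have ind: "{x, y} \<notin> E" if "x \<in> M" "y \<in> M" for x y
      using M mis_independent that by blast
    have "M - {v} \<subseteq> V"
      using M unfolding mis_def by blast
    moreover have "M - {v} \<notin> mis E V"
      using M by blast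
    \<comment> \<open>\<open>M - {v}\<close> is independent, so the equivalence can fail at
      \<open>w\<close> only because \<open>w\<close> is outside and has no neighbour in it. What
      keeps \<open>w\<close> out of \<open>M\<close> is then \<open>v\<close>.\<close>
    ultimately obtain w where w: "w \<in> V" "\<not> (w \<in> M - {v} \<longleftrightarrow> \<not> (\<exists>u\<in>M - {v}. {u, w} \<in> E))"
      unfolding mis_def by blast
    have wM: "w \<notin> M" "\<not> (\<exists>u\<in>M - {v}. {u, w} \<in> E)"
      using w v ind by blast+
    have maximal: "x \<in> M \<longleftrightarrow> \<not> (\<exists>u\<in>M. {u, x} \<in> E)" if "x \<in> V" for x
      using M that unfolding mis_def by blast
    have vw: "{v, w} \<in> E"
      using maximal[OF w(1)] wM by blast
    have "M - {v} \<in> mis E (?V w)"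
      unfolding mis_def
    proof (intro CollectI conjI ballI)
      show "M - {v} \<subseteq> ?V w"
        using wM(2) ind vM \<open>M - {v} \<subseteq> V\<close> by blast
      fix x assume x: "x \<in> ?V w"
      hence "x \<noteq> v" "{v, x} \<notin> E"
        using v by (auto simp: insert_commute)
      thus "x \<in> M - {v} \<longleftrightarrow> \<not> (\<exists>u\<in>M - {v}. {u, x} \<in> E)"
        using maximal[of x] x by blast
    qed
    moreover have "M = insert v (M - {v})"
      using vM by auto
    ultimately show "M \<in> (\<Union>w\<in>?N. insert v ` mis E (?V w))"
      using w(1) vw by blast
  qed
  hence "card (mis E (insert v V) - ?A) \<le> card (\<Union>w\<in>?N. insert v ` mis E (?V w))"
    by (rule card_mono[rotated]) (simp add: finite_mis fin)
  hence "card (mis E (insert v V) - ?A) \<le> (\<Sum>w\<in>?N. card (mis E (?V w)))"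
    by (rule order.trans[OF _ order.trans[OF card_UN_le sum_mono]])
      (simp_all add: finite_mis fin card_image_le)
  moreover have "card (mis E (insert v V)) = card ?A + card (mis E (insert v V) - ?A)"
    by (subst card_Un_disjoint[symmetric]) (auto simp: finite_mis fin intro: arg_cong[of _ _ card])
  ultimately show ?thesis
    by linarith
qed

text \<open>Inserting a vertex adds at most \<open>k\<close> families, each of size at most
  \<open>(k^2 + 1) ^ t\<close> by the induction on \<open>t\<close>. At most \<open>k\<close>
  insertions, starting from the single set \<open>{}\<close>, account for one more factor
  \<open>k^2 + 1\<close>. For \<open>t = 0\<close> there are no edges at all.\<close>

theorem card_mis_tK2_free:
  assumes "finite V" "\<And>e. e \<in> E \<Longrightarrow> card e = 2" "tK2_free (Suc t) {e \<in> E. e \<subseteq> V}"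
  shows "card (mis E V) \<le> ((card V)\<^sup>2 + 1) ^ t"
  using assms(1,3)
proof (induction t arbitrary: V)
  case 0
  have "{u, v} \<notin> E" if "u \<in> V" "v \<in> V" for u v
  proof
    assume e: "{u, v} \<in> E"
    have "{e \<in> {e \<in> E. e \<subseteq> V}. e \<subseteq> \<Union>{{u, v}}} = {{u, v}}"
    proof -
      have "e = {u, v}" if "e \<in> E" "e \<subseteq> {u, v}" for e
        using that e assms(2) by (metis card_subset_eq finite.emptyI finite_insert)
      thus ?thesis
        using e that by auto
    qed
    moreover have "{{u, v}} \<subseteq> {e \<in> E. e \<subseteq> V}" "card (\<Union>{{u, v}}) = 2 * Suc 0"
      using e assms(2)[OF e] that by auto
    ultimately have "\<exists>M\<subseteq>{e \<in> E. e \<subseteq> V}. finite M \<and> card M = Suc 0 \<and> card (\<Union>M) = 2 * Suc 0 \<and>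
        {e \<in> {e \<in> E. e \<subseteq> V}. e \<subseteq> \<Union>M} = M"
      by (intro exI[of _ "{{u, v}}"] conjI) simp_all
    thus False
      using 0(2) unfolding tK2_free_def by (rule notE[rotated])
  qed
  thus ?case
    by (simp add: mis_no_edges)
next
  case (Suc t)
  from Suc.prems show ?case
  proof (induction V rule: finite_induct)
    case empty
    thus ?case
      by (simp add: mis_empty)
  next
    case (insert v V)
    let ?k = "card V"
    let ?V = "\<lambda>w. {x \<in> V. {x, v} \<notin> E \<and> {x, w} \<notin> E}"
    have "tK2_free (Suc (Suc t)) {e \<in> E. e \<subseteq> V}"
    proof -
      have "{e \<in> {e \<in> E. e \<subseteq> insert v V}. e \<subseteq> V} = {e \<in> E. e \<subseteq> V}"
        by auto
      thus ?thesis
        using tK2_free_restrict[OF insert.prems, of V] by simp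
    qed
    hence 1: "card (mis E V) \<le> (?k\<^sup>2 + 1) ^ Suc t"
      by (rule insert.IH)
    have 2: "card (mis E (?V w)) \<le> (?k\<^sup>2 + 1) ^ t" if "w \<in> V" "{v, w} \<in> E" for w
    proof -
      have "card (mis E (?V w)) \<le> ((card (?V w))\<^sup>2 + 1) ^ t"
        using insert that assms(2) by (intro Suc.IH tK2_free_extend) auto
      also have "\<dots> \<le> (?k\<^sup>2 + 1) ^ t"
        using insert.hyps by (intro power_mono add_mono card_mono) auto
      finally show ?thesis .
    qed
    have "(\<Sum>w | w \<in> V \<and> {v, w} \<in> E. card (mis E (?V w))) \<le>
        card {w. w \<in> V \<and> {v, w} \<in> E} * (?k\<^sup>2 + 1) ^ t"
      using sum_bounded_above[of "{w. w \<in> V \<and> {v, w} \<in> E}" "\<lambda>w. card (mis E (?V w))"] 2 by simp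
    also have "\<dots> \<le> ?k * (?k\<^sup>2 + 1) ^ t"
      using insert.hyps by (intro mult_right_mono card_mono) auto
    finally have "card (mis E (insert v V)) \<le> (?k\<^sup>2 + 1) ^ Suc t + ?k * (?k\<^sup>2 + 1) ^ t"
      using card_mis_insert[OF insert.hyps, of E] assms(2) 1 by fastforce
    also have "\<dots> = (?k\<^sup>2 + 1) ^ t * (?k\<^sup>2 + 1 + ?k)"
      by (simp add: algebra_simps)
    also have "\<dots> \<le> ((Suc ?k)\<^sup>2 + 1) ^ t * ((Suc ?k)\<^sup>2 + 1)"
      by (intro mult_mono power_mono) (auto simp: power2_eq_square)
    finally show ?case
      using insert.hyps by (simp add: mult.commute)
  qed
qed

section \<open>Minimum cuts by preflow pushing\<close>

text \<open>Value of a cut in the network in which a source is joined to each \<open>v\<close> by an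
  arc of capacity \<open>e0 v\<close>. The source side is \<open>X\<close>, so a vertex outside
  \<open>X\<close> pays its supply.\<close>

definition cut_cost :: "nat \<Rightarrow> (nat \<Rightarrow> real) \<Rightarrow> (nat \<Rightarrow> nat \<Rightarrow> real) \<Rightarrow> nat set \<Rightarrow> real" where
  "cut_cost n e0 c X = (\<Sum>v\<in>{..<n} - X. e0 v) + (\<Sum>u\<in>X. \<Sum>v\<in>{..<n} - X. c u v)"

text \<open>
  Preflows without a source: \<open>e0\<close> is the supply, \<open>r\<close> the residual capacity, \<open>e\<close> the excess,
  \<open>d\<close> the distance label, and \<open>S\<close> the set of vertices that are not sinks.
\<close>

definition preflow ::
  "nat \<Rightarrow> nat set \<Rightarrow> (nat \<Rightarrow> real) \<Rightarrow> (nat \<Rightarrow> nat \<Rightarrow> real) \<Rightarrow>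
   (nat \<Rightarrow> nat \<Rightarrow> real) \<Rightarrow> (nat \<Rightarrow> real) \<Rightarrow> (nat \<Rightarrow> nat) \<Rightarrow> bool" where
  "preflow n S e0 c r e d \<longleftrightarrow>
     (\<forall>u<n. \<forall>v<n. 0 \<le> r u v) \<and>
     (\<forall>u<n. \<forall>v<n. r u v + r v u = c u v + c v u) \<and>
     (\<forall>v<n. 0 \<le> e v) \<and>
     (\<forall>v<n. e v = e0 v + (\<Sum>u<n. c u v - r u v)) \<and>
     (\<forall>v<n. d v \<le> n) \<and>
     (\<forall>v<n. v \<notin> S \<longrightarrow> d v = 0) \<and>
     (\<forall>u<n. \<forall>v<n. 0 < r u v \<longrightarrow> d u \<le> d v + 1)"

lemma preflowD:
  assumes "preflow n S e0 c r e d"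
  shows "u < n \<Longrightarrow> v < n \<Longrightarrow> 0 \<le> r u v"
    and "u < n \<Longrightarrow> v < n \<Longrightarrow> r u v + r v u = c u v + c v u"
    and "v < n \<Longrightarrow> 0 \<le> e v"
    and "v < n \<Longrightarrow> e v = e0 v + (\<Sum>u<n. c u v - r u v)"
    and "v < n \<Longrightarrow> d v \<le> n"
    and "v < n \<Longrightarrow> v \<notin> S \<Longrightarrow> d v = 0"
    and "u < n \<Longrightarrow> v < n \<Longrightarrow> 0 < r u v \<Longrightarrow> d u \<le> d v + 1"
  using assms unfolding preflow_def by meson+

text \<open>A vertex at level \<open>n\<close> is abandoned together with its excess: only a minimum
  cut is wanted, so no flow has to be returned to the source. This is the first phase of the
  push-relabel method.\<close>

definition active :: "nat \<Rightarrow> nat set \<Rightarrow> (nat \<Rightarrow> real) \<Rightarrow> (nat \<Rightarrow> nat) \<Rightarrow> nat \<Rightarrow> bool" where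
  "active n S e d u \<longleftrightarrow> u < n \<and> u \<in> S \<and> 0 < e u \<and> d u < n"

definition admissible :: "nat \<Rightarrow> (nat \<Rightarrow> nat \<Rightarrow> real) \<Rightarrow> (nat \<Rightarrow> nat) \<Rightarrow> nat \<Rightarrow> nat \<Rightarrow> bool" where
  "admissible n r d u v \<longleftrightarrow> u < n \<and> v < n \<and> 0 < r u v \<and> d u = d v + 1"

definition push_r :: "nat \<Rightarrow> nat \<Rightarrow> real \<Rightarrow> (nat \<Rightarrow> nat \<Rightarrow> real) \<Rightarrow> nat \<Rightarrow> nat \<Rightarrow> real" where
  "push_r u v x r a b =
     (if a = u \<and> b = v then r u v - x else if a = v \<and> b = u then r v u + x else r a b)"

definition push_e :: "nat \<Rightarrow> nat \<Rightarrow> real \<Rightarrow> (nat \<Rightarrow> real) \<Rightarrow> nat \<Rightarrow> real" where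
  "push_e u v x e = e(u := e u - x, v := e v + x)"

text \<open>When the balance equations are summed over the complement of \<open>X\<close>, the flow
  inside it cancels by antisymmetry; the supply there and the net flow across the cut
  remain.\<close>

lemma preflow_sum:
  assumes "preflow n S e0 c r e d" "X \<subseteq> {..<n}"
  shows "(\<Sum>v\<in>{..<n} - X. e v) = cut_cost n e0 c X - (\<Sum>u\<in>X. \<Sum>v\<in>{..<n} - X. r u v)"
proof -
  let ?T = "{..<n} - X"
  have anti: "c u v - r u v = - (c v u - r v u)" if "u < n" "v < n" for u v
    using preflowD(2)[OF assms(1) that] by linarith
  have "(\<Sum>v\<in>?T. \<Sum>u\<in>?T. c u v - r u v) = (\<Sum>v\<in>?T. \<Sum>u\<in>?T. - (c v u - r v u))"
    by (intro sum.cong refl anti) auto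
  also have "\<dots> = - (\<Sum>v\<in>?T. \<Sum>u\<in>?T. c v u - r v u)"
    by (simp only: sum_negf)
  also have "\<dots> = - (\<Sum>v\<in>?T. \<Sum>u\<in>?T. c u v - r u v)"
    by (subst sum.swap) simp
  finally have 0: "(\<Sum>v\<in>?T. \<Sum>u\<in>?T. c u v - r u v) = 0"
    by simp
  have "(\<Sum>v\<in>?T. e v) = (\<Sum>v\<in>?T. e0 v + (\<Sum>u<n. c u v - r u v))"
    using preflowD(4)[OF assms(1)] by (intro sum.cong) auto
  also have "\<dots> = (\<Sum>v\<in>?T. e0 v) + (\<Sum>v\<in>?T. \<Sum>u<n. c u v - r u v)"
    by (simp add: sum.distrib)
  also have "(\<Sum>v\<in>?T. \<Sum>u<n. c u v - r u v) =
      (\<Sum>v\<in>?T. (\<Sum>u\<in>?T. c u v - r u v) + (\<Sum>u\<in>X. c u v - r u v))"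
    using assms(2) by (intro sum.cong refl sum.subset_diff) auto
  also have "\<dots> = (\<Sum>v\<in>?T. \<Sum>u\<in>X. c u v - r u v)"
    using 0 by (simp only: sum.distrib add_0)
  also have "\<dots> = (\<Sum>u\<in>X. \<Sum>v\<in>?T. c u v - r u v)"
    by (rule sum.swap)
  also have "\<dots> = (\<Sum>u\<in>X. \<Sum>v\<in>?T. c u v) - (\<Sum>u\<in>X. \<Sum>v\<in>?T. r u v)"
    by (simp add: sum_subtractf)
  finally show ?thesis
    by (simp add: cut_cost_def)
qed

text \<open>
  No residual edge crosses a gap in the distance labels, and below it the excess has reached the
  sinks; hence the cut at the gap is saturated.
\<close>

theorem gap_cut_minimal:
  assumes pf: "preflow n S e0 c r e d" and inactive: "\<And>u. \<not> active n S e d u"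
    and h: "h \<le> n" "\<And>v. v < n \<Longrightarrow> d v \<noteq> h"
    and Y: "Y \<subseteq> {..<n}" "Y \<subseteq> S"
  shows "cut_cost n e0 c {v. v < n \<and> h < d v} \<le> cut_cost n e0 c Y"
proof -
  let ?X = "{v. v < n \<and> h < d v}"
  have "(\<Sum>u\<in>?X. \<Sum>v\<in>{..<n} - ?X. r u v) = 0"
  proof (intro sum.neutral ballI)
    fix u v assume uv: "u \<in> ?X" "v \<in> {..<n} - ?X"
    hence "d v < h"
      using h(2)[of v] by auto
    hence "\<not> 0 < r u v"
      using preflowD(7)[OF pf, of u v] uv by auto
    thus "r u v = 0"
      using preflowD(1)[OF pf, of u v] uv by auto
  qed
  moreover have "?X \<subseteq> {..<n}"
    by auto
  ultimately have "cut_cost n e0 c ?X = (\<Sum>v\<in>{..<n} - ?X. e v)"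
    using preflow_sum[OF pf, of ?X] by simp
  also have "\<dots> = (\<Sum>v\<in>({..<n} - ?X) - S. e v)"
  proof (intro sum.mono_neutral_right ballI)
    fix v assume v: "v \<in> ({..<n} - ?X) - ({..<n} - ?X - S)"
    \<comment> \<open>Here \<open>d v <= h\<close> and \<open>d v\<close> differs from
      \<open>h\<close>, so even for \<open>h = n\<close> the vertex lies below level
      \<open>n\<close>.\<close>
    hence "d v < n" "v \<in> S" "v < n"
      using h(1) h(2)[of v] by auto
    hence "\<not> 0 < e v"
      using inactive[of v] by (auto simp: active_def)
    thus "e v = 0"
      using preflowD(3)[OF pf \<open>v < n\<close>] by auto
  qed auto
  also have "\<dots> \<le> (\<Sum>v\<in>{..<n} - Y. e v)"
    using preflowD(3)[OF pf] preflowD(6)[OF pf] Y by (intro sum_mono2) auto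
  also have "\<dots> = cut_cost n e0 c Y - (\<Sum>u\<in>Y. \<Sum>v\<in>{..<n} - Y. r u v)"
    using preflow_sum[OF pf Y(1)] .
  also have "\<dots> \<le> cut_cost n e0 c Y"
  proof -
    have "0 \<le> (\<Sum>u\<in>Y. \<Sum>v\<in>{..<n} - Y. r u v)"
      using preflowD(1)[OF pf] Y(1) by (intro sum_nonneg) auto
    thus ?thesis
      by simp
  qed
  finally show ?thesis .
qed

text \<open>Pigeonhole: \<open>n + 1\<close> levels, but only \<open>n\<close> vertices.\<close>

lemma gap_exists: "\<exists>h\<le>n. \<forall>v<n. d v \<noteq> (h :: nat)"
proof (rule ccontr)
  assume "\<not> ?thesis"
  hence "{..n} \<subseteq> d ` {..<n}"
    by (force simp: image_iff)
  hence "card {..n} \<le> card {..<n}"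
    by (rule surj_card_le[rotated]) auto
  thus False
    by simp
qed

section \<open>Push and relabel operations and their termination\<close>

lemma preflow_init:
  assumes "\<And>v. v < n \<Longrightarrow> 0 \<le> e0 v" "\<And>u v. u < n \<Longrightarrow> v < n \<Longrightarrow> 0 \<le> c u v"
  shows "preflow n S e0 c c e0 (\<lambda>_. 0)"
  using assms by (auto simp: preflow_def)

lemma preflow_cong:
  assumes "preflow n S e0 c r e d"
    "\<And>u v. u < n \<Longrightarrow> v < n \<Longrightarrow> r' u v = r u v" "\<And>v. v < n \<Longrightarrow> e' v = e v" "\<And>v. v < n \<Longrightarrow> d' v = d v"
  shows "preflow n S e0 c r' e' d'"
proof -
  have "e' v = e0 v + (\<Sum>u<n. c u v - r' u v)" if "v < n" for v
    using preflowD(4)[OF assms(1) that] assms(2,3) that by simp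
  moreover have "0 \<le> e' v" if "v < n" for v
    using preflowD(3)[OF assms(1) that] assms(3) that by simp
  ultimately show ?thesis
    unfolding preflow_def using preflowD(1,2,5-7)[OF assms(1)] assms(2,4) by simp
qed

lemma preflow_push:
  assumes pf: "preflow n S e0 c r e d" and u: "active n S e d u" and uv: "admissible n r d u v"
    and x: "0 \<le> x" "x \<le> e u" "x \<le> r u v"
  shows "preflow n S e0 c (push_r u v x r) (push_e u v x e) d"
proof -
  have lt: "u < n" "v < n" "u \<noteq> v"
    using uv by (auto simp: admissible_def)
  have "push_e u v x e w = e0 w + (\<Sum>a<n. c a w - push_r u v x r a w)" if w: "w < n" for w
  proof -
    have ew: "e w = e0 w + (\<Sum>a<n. c a w - r a w)"
      using preflowD(4)[OF pf w] .
    have "(\<Sum>a<n. c a w - push_r u v x r a w) =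
        (\<Sum>a<n. (c a w - r a w) + (if a = u then (if w = v then x else 0) else 0)
          + (if a = v then (if w = u then - x else 0) else 0))"
      using lt by (intro sum.cong) (auto simp: push_r_def)
    also have "\<dots> = (\<Sum>a<n. c a w - r a w) + (if w = v then x else 0) + (if w = u then - x else 0)"
      using lt by (simp add: sum.distrib)
    finally show ?thesis
      using ew lt by (auto simp: push_e_def)
  qed
  moreover have "0 \<le> push_r u v x r a b" if "a < n" "b < n" for a b
    using preflowD(1)[OF pf that] preflowD(1)[OF pf lt(2,1)] x by (auto simp: push_r_def)
  moreover have "push_r u v x r a b + push_r u v x r b a = c a b + c b a" if "a < n" "b < n" for a b
    using preflowD(2)[OF pf that] lt by (auto simp: push_r_def)
  moreover have "0 \<le> push_e u v x e a" if "a < n" for a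
    using preflowD(3)[OF pf that] x lt by (auto simp: push_e_def)
  moreover have "d a \<le> d b + 1" if "a < n" "b < n" "0 < push_r u v x r a b" for a b
  proof (cases "0 < r a b")
    case True
    thus ?thesis
      using preflowD(7)[OF pf] that by auto
  next
    case False
    \<comment> \<open>The only arc that can become residual is the reverse of the pushed one, and it
      leads upwards.\<close>
    hence "a = v \<and> b = u"
      using that x uv by (auto simp: push_r_def admissible_def split: if_splits)
    thus ?thesis
      using uv by (auto simp: admissible_def)
  qed
  ultimately show ?thesis
    unfolding preflow_def using preflowD(5,6)[OF pf] by simp
qed

text \<open>Without admissible arcs, every residual arc out of \<open>u\<close> ends at least as
  high as \<open>u\<close>, so raising \<open>u\<close> by one keeps the labels valid.\<close>

lemma preflow_relabel:
  assumes pf: "preflow n S e0 c r e d" and u: "active n S e d u"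
    and no: "\<And>v. \<not> admissible n r d u v"
  shows "preflow n S e0 c r e (d(u := d u + 1))"
proof -
  have "d u \<noteq> d v + 1" if "v < n" "0 < r u v" for v
    using no[of v] u that by (auto simp: admissible_def active_def)
  hence "d u \<le> d v" if "v < n" "0 < r u v" for v
    using preflowD(7)[OF pf, of u v] u that by (fastforce simp: active_def)
  moreover have "d a \<le> Suc (d b)" if "a < n" "b < n" "0 < r a b" for a b
    using preflowD(7)[OF pf that] by simp
  ultimately have "(d(u := d u + 1)) a \<le> (d(u := d u + 1)) b + 1" if "a < n" "b < n" "0 < r a b"
      for a b
    using that by (auto simp: le_SucI)
  moreover have "u < n" "d u < n" "u \<in> S"
    using u by (auto simp: active_def)
  ultimately show ?thesis
    unfolding preflow_def using preflowD(1-6)[OF pf] by auto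
qed

text \<open>Relabelling lowers the first sum by one, creates at most \<open>n\<close> admissible
  arcs and raises the last sum by at most one, whence \<open>n * (n + 1) + 2\<close>. A saturating
  push removes an admissible arc, worth \<open>n + 1\<close>, while the last sum grows by at most
  \<open>n\<close>. A push that empties \<open>u\<close> trades \<open>d u\<close> for at most
  \<open>d u - 1\<close> in the last sum.\<close>

definition pr_potential ::
  "nat \<Rightarrow> (nat \<Rightarrow> nat \<Rightarrow> real) \<Rightarrow> (nat \<Rightarrow> real) \<Rightarrow> (nat \<Rightarrow> nat) \<Rightarrow> nat" where
  "pr_potential n r e d =
     (n * (n + 1) + 2) * (\<Sum>v<n. n - d v) +
     (n + 1) * card {(u, v). admissible n r d u v} +
     (\<Sum>v<n. if 0 < e v then d v else 0)"

lemma finite_admissible: "finite {(u, v). admissible n r d u v}"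
  by (rule finite_subset[of _ "{..<n} \<times> {..<n}"]) (auto simp: admissible_def)

lemma pr_potential_init: "pr_potential n r e (\<lambda>_. 0) < (n + 2) ^ 4"
proof -
  have "{(u, v). admissible n r (\<lambda>_. 0) u v} = {}"
    by (auto simp: admissible_def)
  hence "pr_potential n r e (\<lambda>_. 0) = (n * (n + 1) + 2) * (n * n)"
    unfolding pr_potential_def by (simp only: card.empty) simp
  also have "\<dots> < ((n + 2) * (n + 2)) * ((n + 2) * (n + 2))"
    by (intro mult_strict_mono) auto
  also have "\<dots> = (n + 2) ^ 4"
    by (simp only: power4_eq_xxxx mult.assoc)
  finally show ?thesis .
qed

lemma pr_potential_relabel:
  assumes pf: "preflow n S e0 c r e d" and u: "active n S e d u"
  shows "pr_potential n r e (d(u := d u + 1)) < pr_potential n r e d"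
proof -
  let ?d = "d(u := d u + 1)"
  let ?A = "\<lambda>d. {(a, b). admissible n r d a b}"
  have un: "u < n" "d u < n"
    using u by (auto simp: active_def)
  \<comment> \<open>An arc into the raised \<open>u\<close> that has become admissible would have
    dropped two levels before, which a preflow forbids. Hence all new admissible arcs leave
    \<open>u\<close>.\<close>
  have "admissible n r d a b" if "admissible n r ?d a b" "a \<noteq> u" for a b
    using that preflowD(7)[OF pf, of a b] by (auto simp: admissible_def split: if_splits)
  moreover have "(u, b) \<in> (\<lambda>v. (u, v)) ` {..<n}" if "admissible n r ?d u b" for b
    using that by (auto simp: admissible_def)
  ultimately have "?A ?d \<subseteq> ?A d \<union> (\<lambda>v. (u, v)) ` {..<n}"
    by blast
  hence "card (?A ?d) \<le> card (?A d \<union> (\<lambda>v. (u, v)) ` {..<n})"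
    by (intro card_mono) (auto simp: finite_admissible)
  also have "\<dots> \<le> card (?A d) + n"
    using card_Un_le[of "?A d" "(\<lambda>v. (u, v)) ` {..<n}"] card_image_le[of "{..<n}" "\<lambda>v. (u, v)"] by
        simp
  finally have 1: "(n + 1) * card (?A ?d) \<le> (n + 1) * card (?A d) + (n + 1) * n"
    by (metis add_mult_distrib2 mult_le_mono2)
  have "(\<Sum>v<n. n - d v) = (n - d u) + (\<Sum>v\<in>{..<n} - {u}. n - d v)"
    using un by (intro sum.remove) auto
  moreover have "(\<Sum>v<n. n - ?d v) = (n - ?d u) + (\<Sum>v\<in>{..<n} - {u}. n - ?d v)"
    using un by (intro sum.remove) auto
  moreover have "(\<Sum>v\<in>{..<n} - {u}. n - ?d v) = (\<Sum>v\<in>{..<n} - {u}. n - d v)"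
    by (intro sum.cong) auto
  ultimately have 2: "(\<Sum>v<n. n - d v) = (\<Sum>v<n. n - ?d v) + 1"
    using un by simp
  have "(\<Sum>v<n. if 0 < e v then d v else 0) =
      (if 0 < e u then d u else 0) + (\<Sum>v\<in>{..<n} - {u}. if 0 < e v then d v else 0)"
    using un by (intro sum.remove) auto
  moreover have "(\<Sum>v<n. if 0 < e v then ?d v else 0) =
      (if 0 < e u then ?d u else 0) + (\<Sum>v\<in>{..<n} - {u}. if 0 < e v then ?d v else 0)"
    using un by (intro sum.remove) auto
  moreover have "(\<Sum>v\<in>{..<n} - {u}. if 0 < e v then ?d v else 0) =
      (\<Sum>v\<in>{..<n} - {u}. if 0 < e v then d v else 0)"
    by (intro sum.cong) auto
  ultimately have 3: "(\<Sum>v<n. if 0 < e v then ?d v else 0) \<le> (\<Sum>v<n. if 0 < e v then d v else 0) + 1"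
    by simp
  have 4: "(n * (n + 1) + 2) * (\<Sum>v<n. n - d v) =
      (n * (n + 1) + 2) * (\<Sum>v<n. n - ?d v) + (n + 1) * n + 2"
    unfolding 2 by (simp add: algebra_simps)
  show ?thesis
    unfolding pr_potential_def using 1 3 4 by linarith
qed

lemma pr_potential_push:
  assumes pf: "preflow n S e0 c r e d" and u: "active n S e d u" and uv: "admissible n r d u v"
    and x: "x = min (e u) (r u v)"
  shows "pr_potential n (push_r u v x r) (push_e u v x e) d < pr_potential n r e d"
proof -
  let ?r = "push_r u v x r" and ?e = "push_e u v x e"
  let ?A = "\<lambda>r. {(a, b). admissible n r d a b}"
  let ?f = "\<lambda>e v. if 0 < e v then d v else 0 :: nat"
  have lt: "u < n" "v < n" "u \<noteq> v" "d u = d v + 1" "d u \<le> n" "0 < x"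
    using uv u x by (auto simp: admissible_def active_def)
  \<comment> \<open>The reverse arc may become residual, but it leads upwards, so no admissible arc
    is created.\<close>
  have sub: "?A ?r \<subseteq> ?A r"
    using lt by (auto simp: admissible_def push_r_def split: if_splits)
  have split: "(\<Sum>w<n. ?f g w) = ?f g u + ?f g v + (\<Sum>w\<in>{..<n} - {u} - {v}. ?f g w)" for g :: "nat \<Rightarrow>
      real"
  proof -
    have "(\<Sum>w<n. ?f g w) = ?f g u + (\<Sum>w\<in>{..<n} - {u}. ?f g w)"
      using lt by (intro sum.remove) auto
    also have "(\<Sum>w\<in>{..<n} - {u}. ?f g w) = ?f g v + (\<Sum>w\<in>{..<n} - {u} - {v}. ?f g w)"
      using lt by (intro sum.remove) auto
    finally show ?thesis
      by simp
  qed
  have rest: "(\<Sum>w\<in>{..<n} - {u} - {v}. ?f ?e w) = (\<Sum>w\<in>{..<n} - {u} - {v}. ?f e w)"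
    by (intro sum.cong) (auto simp: push_e_def)
  have e: "0 < e u" "?e u = e u - x"
    using u lt by (auto simp: active_def push_e_def)
  show ?thesis
  proof (cases "x = e u")
    case True
    hence "(\<Sum>w<n. ?f ?e w) < (\<Sum>w<n. ?f e w)"
      unfolding split[of e] split[of ?e] rest using e lt(4) by auto
    moreover have "(n + 1) * card (?A ?r) \<le> (n + 1) * card (?A r)"
      using card_mono[OF finite_admissible sub] by (rule mult_le_mono2)
    ultimately show ?thesis
      by (simp add: pr_potential_def)
  next
    case False
    hence "x = r u v"
      using x by (auto simp: min_def split: if_splits)
    hence "(u, v) \<in> ?A r - ?A ?r"
      using uv by (auto simp: admissible_def push_r_def)
    hence "card (?A ?r) < card (?A r)"
      using sub by (intro psubset_card_mono finite_admissible) auto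
    hence "(n + 1) * (card (?A ?r) + 1) \<le> (n + 1) * card (?A r)"
      by (intro mult_le_mono2) simp
    moreover have "(\<Sum>w<n. ?f ?e w) \<le> (\<Sum>w<n. ?f e w) + d v"
      unfolding split[of e] split[of ?e] rest using e by auto
    ultimately show ?thesis
      using lt by (simp add: pr_potential_def)
  qed
qed

section \<open>Local search for uniform labelings\<close>

text \<open>Ordered pairs make every edge count twice; \<open>move_supply\<close> and
  \<open>move_cap\<close> are scaled to match.\<close>

definition label_cost :: "nat \<Rightarrow> (nat \<Rightarrow> nat \<Rightarrow> real) \<Rightarrow> (nat \<Rightarrow> nat) \<Rightarrow> real" where
  "label_cost n W f = (\<Sum>u<n. \<Sum>v<n. if f u = f v then 0 else W u v)"

definition move_supply :: "nat \<Rightarrow> (nat \<Rightarrow> nat \<Rightarrow> real) \<Rightarrow> (nat \<Rightarrow> nat) \<Rightarrow> nat \<Rightarrow> real" where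
  "move_supply n W f u = (\<Sum>v<n. if f u = f v then 0 else W u v)"

text \<open>An edge inside a class of \<open>f\<close> is charged only if the move separates it, and
  then for both orders, hence twice \<open>W u v\<close>. An edge between classes that leaves the
  moved set already pays once through the supply of its outer end, so a single \<open>W u v\<close>
  completes the charge.\<close>

definition move_cap :: "(nat \<Rightarrow> nat \<Rightarrow> real) \<Rightarrow> (nat \<Rightarrow> nat) \<Rightarrow> nat \<Rightarrow> nat \<Rightarrow> real" where
  "move_cap W f u v = (if f u = f v then W u v + W u v else W u v)"

definition move_cost :: "nat \<Rightarrow> (nat \<Rightarrow> nat \<Rightarrow> real) \<Rightarrow> (nat \<Rightarrow> nat) \<Rightarrow> nat set \<Rightarrow> real" where
  "move_cost n W f X = cut_cost n (move_supply n W f) (move_cap W f) X"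

text \<open>
  Upper bound for the contribution of \<open>{u, v}\<close> after the vertices of \<open>X\<close> have received a common new
  label. It is exact if \<open>X\<close> contains all vertices that had this label before.
\<close>

definition move_weight :: "(nat \<Rightarrow> nat) \<Rightarrow> nat set \<Rightarrow> nat \<Rightarrow> nat \<Rightarrow> real" where
  "move_weight f X u v =
     (if f u = f v then of_bool ((u \<in> X) \<noteq> (v \<in> X)) else 1 - of_bool (u \<in> X \<and> v \<in> X))"

lemma sum_symmetrize:
  fixes g :: "nat \<Rightarrow> nat \<Rightarrow> real"
  shows "(\<Sum>u\<in>A. \<Sum>v\<in>A. g u v) = (\<Sum>u\<in>A. \<Sum>v\<in>A. (g u v + g v u) / 2)"
proof -
  have "(\<Sum>u\<in>A. \<Sum>v\<in>A. (g u v + g v u) / 2) =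
      ((\<Sum>u\<in>A. \<Sum>v\<in>A. g u v) + (\<Sum>u\<in>A. \<Sum>v\<in>A. g v u)) / 2"
    by (simp add: sum.distrib flip: sum_divide_distrib)
  also have "(\<Sum>u\<in>A. \<Sum>v\<in>A. g v u) = (\<Sum>u\<in>A. \<Sum>v\<in>A. g u v)"
    by (rule sum.swap)
  finally show ?thesis
    by simp
qed

lemma move_cost_eq:
  assumes sym: "\<And>u v. W u v = W v u" and X: "X \<subseteq> {..<n}"
  shows "move_cost n W f X = (\<Sum>u<n. \<Sum>v<n. W u v * move_weight f X u v)"
proof -
  have 1: "(\<Sum>v\<in>{..<n} - X. move_supply n W f v) =
      (\<Sum>u<n. \<Sum>v<n. of_bool (u \<notin> X) * (if f u = f v then 0 else W u v))"
    unfolding move_supply_def sum_distrib_left[symmetric]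
    by (intro sum.mono_neutral_cong_left) auto
  have 2: "(\<Sum>u\<in>X. \<Sum>v\<in>{..<n} - X. move_cap W f u v) =
      (\<Sum>u<n. \<Sum>v<n. of_bool (u \<in> X) * (of_bool (v \<notin> X) * move_cap W f u v))"
    unfolding sum_distrib_left[symmetric] using X
    by (intro sum.mono_neutral_cong_left) (auto intro!: sum.mono_neutral_cong_left)
  have "move_cost n W f X = (\<Sum>u<n. \<Sum>v<n. of_bool (u \<notin> X) * (if f u = f v then 0 else W u v)
      + of_bool (u \<in> X) * (of_bool (v \<notin> X) * move_cap W f u v))"
    unfolding move_cost_def cut_cost_def 1 2 by (simp only: sum.distrib)
  \<comment> \<open>The summands of the two sides agree only after averaging over both orders of a
    pair.\<close>
  also have "\<dots> = (\<Sum>u<n. \<Sum>v<n. W u v * move_weight f X u v)"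
    by (subst sum_symmetrize, intro sum.cong refl)
      (auto simp: move_weight_def move_cap_def sym)
  finally show ?thesis .
qed

text \<open>Only an inequality: a vertex outside \<open>X\<close> may have label \<open>a\<close>
  already, while \<open>move_weight\<close> charges its edges into \<open>X\<close>.\<close>

lemma label_cost_move_le:
  assumes sym: "\<And>u v. W u v = W v u" and nonneg: "\<And>u v. 0 \<le> W u v" and X: "X \<subseteq> {..<n}"
  shows "label_cost n W (\<lambda>v. if v \<in> X then a else f v) \<le> move_cost n W f X"
  unfolding move_cost_eq[OF sym X] label_cost_def
  by (intro sum_mono) (simp add: move_weight_def nonneg)

text \<open>Each pair is charged separately. If \<open>f\<close> does not separate it, only the
  classes of \<open>h\<close> at its two ends cut it, so it is charged twice if \<open>h\<close>
  separates it and never otherwise; this is the source of the ratio 2. If \<open>f\<close> separates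
  it, every class charges it once, except a class containing both ends.\<close>

lemma sum_move_cost_le:
  assumes sym: "\<And>u v. W u v = W v u" and nonneg: "\<And>u v. 0 \<le> W u v"
    and h: "\<And>v. v < n \<Longrightarrow> h v < L" and L: "0 < L"
  shows "(\<Sum>a<L. move_cost n W f {v. v < n \<and> h v = a}) \<le>
    real (L - 1) * label_cost n W f + 2 * label_cost n W h"
proof -
  let ?Y = "\<lambda>a. {v. v < n \<and> h v = a}"
  have weight: "(\<Sum>a<L. move_weight f (?Y a) u v) \<le>
      real (L - 1) * of_bool (f u \<noteq> f v) + 2 * of_bool (h u \<noteq> h v)" if uv: "u < n" "v < n" for u v
  proof (cases "f u = f v")
    case True
    have "(\<Sum>a<L. move_weight f (?Y a) u v) \<le> (\<Sum>a<L. of_bool (h u \<noteq> h v) * ((if a = h u then 1 else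
        0) + (if a = h v then 1 else 0)))"
      using True uv by (intro sum_mono) (auto simp: move_weight_def)
    also have "\<dots> = of_bool (h u \<noteq> h v) * ((\<Sum>a<L. if a = h u then 1 else 0) + (\<Sum>a<L. if a = h v
        then 1 else 0))"
      by (simp only: sum_distrib_left[symmetric] sum.distrib)
    finally show ?thesis
      using h[OF uv(1)] h[OF uv(2)] True by simp
  next
    case False
    have "(\<Sum>a<L. move_weight f (?Y a) u v) = (\<Sum>a<L. 1 - of_bool (h u = h v) * (if a = h u then 1
        else 0))"
      using False uv by (intro sum.cong) (auto simp: move_weight_def)
    also have "\<dots> = real L - of_bool (h u = h v) * (\<Sum>a<L. if a = h u then 1 else 0)"
      by (simp only: sum_subtractf sum_distrib_left) simp
    also have "\<dots> = real L - of_bool (h u = h v)"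
      using h[OF uv(1)] by simp
    finally show ?thesis
      using False L by (auto simp: of_nat_diff)
  qed
  have "(\<Sum>a<L. move_cost n W f (?Y a)) = (\<Sum>a<L. \<Sum>u<n. \<Sum>v<n. W u v * move_weight f (?Y a) u v)"
    by (intro sum.cong refl move_cost_eq sym) auto
  also have "\<dots> = (\<Sum>u<n. \<Sum>a<L. \<Sum>v<n. W u v * move_weight f (?Y a) u v)"
    by (rule sum.swap)
  also have "\<dots> = (\<Sum>u<n. \<Sum>v<n. \<Sum>a<L. W u v * move_weight f (?Y a) u v)"
    by (intro sum.cong refl sum.swap)
  also have "\<dots> = (\<Sum>u<n. \<Sum>v<n. W u v * (\<Sum>a<L. move_weight f (?Y a) u v))"
    by (simp only: sum_distrib_left)
  also have "\<dots> \<le> (\<Sum>u<n. \<Sum>v<n. W u v * (real (L - 1) * of_bool (f u \<noteq> f v) + 2 * of_bool (h u \<noteq> h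
      v)))"
    by (intro sum_mono mult_left_mono weight nonneg) auto
  also have "\<dots> = (\<Sum>u<n. \<Sum>v<n. real (L - 1) * (if f u = f v then 0 else W u v) + 2 * (if h u = h v
      then 0 else W u v))"
    by (intro sum.cong refl) (auto simp: algebra_simps)
  also have "\<dots> = real (L - 1) * label_cost n W f + 2 * label_cost n W h"
    by (simp only: label_cost_def sum.distrib sum_distrib_left)
  finally show ?thesis .
qed

definition labeling :: "nat \<Rightarrow> nat \<Rightarrow> (nat \<Rightarrow> nat set) \<Rightarrow> (nat \<Rightarrow> nat) \<Rightarrow> bool" where
  "labeling n L lab f \<longleftrightarrow> (\<forall>v<n. f v < L \<and> v \<in> lab (f v))"

text \<open>\<open>f'\<close> need not arise from \<open>f\<close> by a move. Only its cost matters,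
  so the program may keep the cheapest labelling that it has met.\<close>

definition improves ::
  "nat \<Rightarrow> nat \<Rightarrow> (nat \<Rightarrow> nat \<Rightarrow> real) \<Rightarrow> (nat \<Rightarrow> nat set) \<Rightarrow> (nat \<Rightarrow> nat) \<Rightarrow> (nat \<Rightarrow> nat) \<Rightarrow> bool" where
  "improves n L W lab f f' \<longleftrightarrow>
     (\<forall>a<L. \<forall>Y. Y \<subseteq> {..<n} \<longrightarrow> Y \<subseteq> lab a \<longrightarrow> label_cost n W f' \<le> move_cost n W f Y)"

text \<open>The best move is at most the average over the classes of \<open>h\<close>, and twice the
  cost of \<open>h\<close> is the fixed point of the resulting recurrence.\<close>

lemma improves_progress:
  assumes sym: "\<And>u v. W u v = W v u" and nonneg: "\<And>u v. 0 \<le> W u v"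
    and h: "labeling n L lab h" and L: "0 < L" and f: "improves n L W lab f f'"
  shows "L * (label_cost n W f' - 2 * label_cost n W h) \<le>
    (L - 1) * (label_cost n W f - 2 * label_cost n W h)"
proof -
  have "(\<Sum>a<L. label_cost n W f') \<le> (\<Sum>a<L. move_cost n W f {v. v < n \<and> h v = a})"
    using h by (intro sum_mono f[unfolded improves_def, rule_format]) (auto simp: labeling_def)
  also have "\<dots> \<le> real (L - 1) * label_cost n W f + 2 * label_cost n W h"
    using h by (intro sum_move_cost_le sym nonneg L) (auto simp: labeling_def)
  finally show ?thesis
    using L by (simp add: of_nat_diff algebra_simps)
qed

section \<open>Length of halving sequences with small integer coefficients\<close>

lemma sum_less_of_doubling:
  fixes a :: "nat \<Rightarrow> real"
  assumes "\<And>i. i < q \<Longrightarrow> 0 < a i" "\<And>i. Suc i < q \<Longrightarrow> 2 * a i \<le> a (Suc i)" "m < q"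
  shows "(\<Sum>i<m. a i) < a m"
  using assms(3)
proof (induction m)
  case (Suc m)
  thus ?case
    using assms(2)[of m] by simp
qed (use assms(1) in simp)

text \<open>The sequence is superincreasing, so two subset sums are compared by the largest index at
  which the sets differ. The induction strips off the top index.\<close>

lemma inj_on_subset_sums:
  fixes a :: "nat \<Rightarrow> real"
  assumes pos: "\<And>i. i < q \<Longrightarrow> 0 < a i" and dbl: "\<And>i. Suc i < q \<Longrightarrow> 2 * a i \<le> a (Suc i)"
  shows "inj_on (\<lambda>S. \<Sum>i\<in>S. a i) (Pow {..<q})"
proof -
  have "S = T" if "m \<le> q" "S \<subseteq> {..<m}" "T \<subseteq> {..<m}" "(\<Sum>i\<in>S. a i) = (\<Sum>i\<in>T. a i)" for m S T
    using that
  proof (induction m arbitrary: S T)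
    case (Suc m)
    have less: "(\<Sum>i\<in>B. a i) < (\<Sum>i\<in>A. a i)" if "A \<subseteq> {..<Suc m}" "B \<subseteq> {..<Suc m}" "m \<in> A" "m \<notin> B"
        for A B
    proof -
      have "B \<subseteq> {..<m}"
        using that by (auto simp: less_Suc_eq)
      hence "(\<Sum>i\<in>B. a i) \<le> (\<Sum>i<m. a i)"
        using pos Suc.prems by (intro sum_mono2) (auto intro!: less_imp_le)
      also have "\<dots> < a m"
        using Suc.prems by (intro sum_less_of_doubling[of q] pos dbl) auto
      also have "\<dots> \<le> (\<Sum>i\<in>A. a i)"
        using that pos Suc.prems finite_subset[OF that(1)]
        by (intro member_le_sum) (auto intro!: less_imp_le)
      finally show ?thesis .
    qed
    have iff: "m \<in> S \<longleftrightarrow> m \<in> T"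
      using less[of S T] less[of T S] Suc.prems by auto
    have "S - {m} = T - {m}"
    proof (rule Suc.IH)
      show "S - {m} \<subseteq> {..<m}" "T - {m} \<subseteq> {..<m}"
        using Suc.prems by (auto simp: less_Suc_eq)
      show "(\<Sum>i\<in>S - {m}. a i) = (\<Sum>i\<in>T - {m}. a i)"
        using Suc.prems iff finite_subset[OF Suc.prems(2)] finite_subset[OF Suc.prems(3)]
        by (simp add: sum_diff1)
    qed (use Suc.prems in simp)
    thus ?case
      using iff by blast
  qed auto
  thus ?thesis
    by (intro inj_onI) auto
qed

text \<open>
  A positive sequence that is at least halved in each step has distinct subset sums. If its members
  are combinations of the same reals with small integer coefficients, then the coefficient vectors
  of the subset sums are distinct as well, and there are few of them.
\<close>

lemma halving_length:
  fixes W :: "'a \<Rightarrow> real" and y :: "nat \<Rightarrow> 'a \<Rightarrow> int" and g :: "nat \<Rightarrow> real"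
  assumes P: "finite P" and y: "\<And>t p. - 2 \<le> y t p \<and> y t p \<le> 1"
    and g: "\<And>t. t < q \<Longrightarrow> g t = (\<Sum>p\<in>P. W p * y t p)"
    and pos: "\<And>t. t < q \<Longrightarrow> 0 < g t" and half: "\<And>t. Suc t < q \<Longrightarrow> 2 * g (Suc t) \<le> g t"
  shows "2 ^ q \<le> (3 * q + 1) ^ card P"
proof -
  \<comment> \<open>The index \<open>q - Suc i\<close> reverses the sequence, so that it doubles
    instead of halving. \<open>restrict\<close> makes the coefficient vectors extensional and thus
    countable.\<close>
  define coeff where "coeff = (\<lambda>S. restrict (\<lambda>p. \<Sum>i\<in>S. y (q - Suc i) p) P)"
  have inj: "inj_on (\<lambda>S. \<Sum>i\<in>S. g (q - Suc i)) (Pow {..<q})"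
  proof (rule inj_on_subset_sums)
    fix i assume i: "Suc i < q"
    hence "q - Suc i = Suc (q - Suc (Suc i))"
      by simp
    thus "2 * g (q - Suc i) \<le> g (q - Suc (Suc i))"
      using half[of "q - Suc (Suc i)"] i by simp
  qed (simp add: pos)
  have eq: "(\<Sum>i\<in>S. g (q - Suc i)) = (\<Sum>p\<in>P. W p * coeff S p)" if "S \<in> Pow {..<q}" for S
  proof -
    have "(\<Sum>i\<in>S. g (q - Suc i)) = (\<Sum>i\<in>S. \<Sum>p\<in>P. W p * y (q - Suc i) p)"
      using that by (intro sum.cong refl g) auto
    also have "\<dots> = (\<Sum>p\<in>P. \<Sum>i\<in>S. W p * y (q - Suc i) p)"
      by (rule sum.swap)
    also have "\<dots> = (\<Sum>p\<in>P. W p * coeff S p)"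
      by (intro sum.cong refl) (simp add: coeff_def sum_distrib_left)
    finally show ?thesis .
  qed
  have "inj_on coeff (Pow {..<q})"
  proof (rule inj_onI)
    fix S T assume ST: "S \<in> Pow {..<q}" "T \<in> Pow {..<q}" "coeff S = coeff T"
    show "S = T"
      using inj_onD[OF inj _ ST(1,2)] eq[OF ST(1)] eq[OF ST(2)] ST(3) by simp
  qed
  \<comment> \<open>A sum of at most \<open>q\<close> integers between -2 and 1 takes one of
    \<open>3 * q + 1\<close> values.\<close>
  moreover have "coeff ` Pow {..<q} \<subseteq> P \<rightarrow>\<^sub>E {- 2 * int q..int q}"
  proof (intro image_subsetI)
    fix S assume S: "S \<in> Pow {..<q}"
    hence card: "card S \<le> q" "finite S"
      using card_mono[of "{..<q}" S] finite_subset[of S] by auto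
    have "(\<Sum>i\<in>S. y (q - Suc i) p) \<in> {- 2 * int q..int q}" for p
    proof -
      have "(\<Sum>i\<in>S. y (q - Suc i) p) \<le> (\<Sum>i\<in>S. 1)" "(\<Sum>i\<in>S. - 2) \<le> (\<Sum>i\<in>S. y (q - Suc i) p)"
        by (intro sum_mono conjunct1[OF y] conjunct2[OF y])+
      thus ?thesis
        using card by simp
    qed
    thus "coeff S \<in> P \<rightarrow>\<^sub>E {- 2 * int q..int q}"
      by (auto simp: coeff_def)
  qed
  ultimately have "card (Pow {..<q}) \<le> card (P \<rightarrow>\<^sub>E {- 2 * int q..int q})"
    using P by (intro card_inj_on_le[of coeff]) (auto intro: finite_PiE)
  also have "\<dots> = (3 * q + 1) ^ card P"
  proof -
    have "nat (3 * int q + 1) = Suc (3 * q)"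
      by linarith
    thus ?thesis
      using P by (simp add: card_PiE)
  qed
  finally show ?thesis
    by (simp add: card_Pow)
qed

text \<open>With \<open>q = 16 * (p + 1)^2\<close>, the base is at most
  \<open>64 * 4 ^ p = 2 ^ (6 + 2 * p)\<close>, and \<open>(6 + 2 * p) * p < q\<close>. This refutes
  the conclusion of \<open>halving_length\<close>, so no halving sequence over \<open>p\<close>
  weights has length \<open>q\<close>.\<close>

lemma halving_length_bound: "(3 * (16 * (p + 1)\<^sup>2) + 1) ^ p < (2 :: nat) ^ (16 * (p + 1)\<^sup>2)"
proof -
  have "p + 1 \<le> 2 ^ p"
    by (simp add: Suc_leI)
  hence "(p + 1)\<^sup>2 \<le> (2 ^ p)\<^sup>2"
    by (rule power_mono) simp
  moreover have "1 \<le> (p + 1)\<^sup>2"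
    by simp
  ultimately have "3 * (16 * (p + 1)\<^sup>2) + 1 \<le> 64 * (2 ^ p)\<^sup>2"
    by linarith
  also have "\<dots> = 2 ^ (6 + 2 * p)"
    by (simp add: power_add power_mult power2_eq_square mult.commute)
  finally have "(3 * (16 * (p + 1)\<^sup>2) + 1) ^ p \<le> (2 ^ (6 + 2 * p)) ^ p"
    by (rule power_mono) simp
  also have "\<dots> = 2 ^ ((6 + 2 * p) * p)"
    by (simp only: power_mult)
  also have "\<dots> < 2 ^ (16 * (p + 1)\<^sup>2)"
    by (rule power_strict_increasing) (auto simp: power2_eq_square algebra_simps)
  finally show ?thesis .
qed

text \<open>\<open>1 + x <= exp x\<close> at \<open>x = - (1 / L)\<close> bounds the power by
  \<open>1 / exp 1\<close>, and \<open>exp 1 >= 2\<close>. Hence \<open>L\<close> moves at least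
  halve a positive \<open>g\<close>.\<close>

lemma power_contraction_half:
  assumes "0 < L"
  shows "(real (L - 1) / real L) ^ L \<le> 1 / 2"
proof -
  have "real (L - 1) / real L = 1 + - (1 / real L)"
    using assms by (simp add: of_nat_diff field_simps)
  also have "\<dots> \<le> exp (- (1 / real L))"
    by (rule exp_ge_add_one_self)
  finally have "(real (L - 1) / real L) ^ L \<le> exp (- (1 / real L)) ^ L"
    by (rule power_mono) simp
  also have "\<dots> = 1 / exp 1"
    using assms by (simp add: exp_of_nat_mult[symmetric] exp_minus field_simps)
  also have "\<dots> \<le> 1 / 2"
    using exp_ge_add_one_self[of 1] by (intro divide_left_mono) auto
  finally show ?thesis .
qed

text \<open>If the bound failed for \<open>h\<close>, then \<open>g\<close> would be positive at the
  end and therefore throughout. Sampling it every \<open>L\<close> moves would give a halving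
  sequence that is too long for its \<open>n * n\<close> coefficients. The number of moves depends
  neither on \<open>W\<close> nor on \<open>h\<close>.\<close>

theorem local_search_two_approx:
  assumes sym: "\<And>u v. W u v = W v u" and nonneg: "\<And>u v. 0 \<le> W u v"
    and h: "labeling n L lab h" and L: "0 < L"
    and K: "16 * (n * n + 1)\<^sup>2 \<le> K"
    and f: "(improves n L W lab ^^ (K * L)) f0 f"
  shows "label_cost n W f \<le> 2 * label_cost n W h"
proof (rule ccontr)
  assume not: "\<not> ?thesis"
  obtain F where F: "F 0 = f0" "F (K * L) = f" "\<And>i. i < K * L \<Longrightarrow> improves n L W lab (F i) (F (Suc
      i))"
    using f by (auto simp: relpowp_fun_conv)
  define g where "g i = label_cost n W (F i) - 2 * label_cost n W h" for i
  define \<rho> where "\<rho> = real (L - 1) / real L"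
  have \<rho>: "0 \<le> \<rho>"
    by (simp add: \<rho>_def)
  have step: "g (Suc i) \<le> \<rho> * g i" if "i < K * L" for i
    using improves_progress[OF sym nonneg h L F(3)[OF that]] L
    by (simp add: g_def \<rho>_def field_simps)
  have steps: "g (i + j) \<le> \<rho> ^ j * g i" if "i + j \<le> K * L" for i j
    using that
  proof (induction j)
    case (Suc j)
    have "g (i + Suc j) \<le> \<rho> * g (i + j)"
      using step[of "i + j"] Suc.prems by simp
    also have "\<dots> \<le> \<rho> * (\<rho> ^ j * g i)"
      using Suc \<rho> by (intro mult_left_mono) auto
    finally show ?case
      by simp
  qed simp
  \<comment> \<open>A nonpositive value would persist to the end, because \<open>\<rho>\<close> is
    nonnegative.\<close>
  have pos: "0 < g i" if "i \<le> K * L" for i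
  proof (rule ccontr)
    assume "\<not> 0 < g i"
    hence "\<rho> ^ (K * L - i) * g i \<le> 0"
      using \<rho> by (intro mult_nonneg_nonpos) auto
    hence "g (K * L) \<le> 0"
      using steps[of i "K * L - i"] that by simp
    thus False
      using not F(2) by (simp add: g_def)
  qed
  have half: "2 * g (i + L) \<le> g i" if "i + L \<le> K * L" for i
  proof -
    have "\<rho> ^ L * g i \<le> 1 / 2 * g i"
      using pos[of i] that power_contraction_half[OF L] unfolding \<rho>_def
      by (intro mult_right_mono) auto
    thus ?thesis
      using steps[OF that] by simp
  qed
  define q where "q = 16 * (n * n + 1)\<^sup>2"
  define y :: "nat \<Rightarrow> nat \<times> nat \<Rightarrow> int" where
    "y t p = (case p of (u, v) \<Rightarrow> of_bool (F (t * L) u \<noteq> F (t * L) v) - 2 * of_bool (h u \<noteq> h v))"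
        for t p
  have tL: "t * L \<le> K * L" if "t \<le> q" for t
    using that K by (intro mult_right_mono) (auto simp: q_def)
  have "2 ^ q \<le> (3 * q + 1) ^ card ({..<n} \<times> {..<n})"
  proof (rule halving_length[where W = "\<lambda>(u, v). W u v" and y = y and g = "\<lambda>t. g (t * L)"])
    show "- 2 \<le> y t p \<and> y t p \<le> 1" for t p
      by (auto simp: y_def split: prod.split)
    fix t assume t: "t < q"
    show "0 < g (t * L)"
      using pos tL[of t] t by simp
    have "g (t * L) = (\<Sum>u<n. \<Sum>v<n. W u v * y t (u, v))"
      unfolding g_def label_cost_def sum_distrib_left sum_subtractf[symmetric]
      by (intro sum.cong refl) (auto simp: y_def)
    thus "g (t * L) = (\<Sum>p\<in>{..<n} \<times> {..<n}. (case p of (u, v) \<Rightarrow> W u v) * y t p)"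
      by (simp add: sum.cartesian_product split_beta)
  next
    fix t assume "Suc t < q"
    thus "2 * g (Suc t * L) \<le> g (t * L)"
      using half[of "t * L"] tL[of "Suc t"] by (simp add: add.commute)
  qed simp
  thus False
    using halving_length_bound[of "n * n"] by (simp add: q_def)
qed

section \<open>Multicuts and labelings\<close>

definition weight_matrix :: "multicut \<Rightarrow> nat \<Rightarrow> nat \<Rightarrow> real" where
  "weight_matrix I u v = (if {u, v} \<in> edges I then weight I {u, v} else 0)"

lemma weight_matrix_sym: "weight_matrix I u v = weight_matrix I v u"
  by (simp add: weight_matrix_def insert_commute)

lemma weight_matrix_nonneg: "valid_instance I \<Longrightarrow> 0 \<le> weight_matrix I u v"
  by (simp add: weight_matrix_def valid_instance_def)

lemma sum_ordered_pairs:
  fixes w :: "nat set \<Rightarrow> real"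
  assumes "F \<subseteq> all_pairs {..<n}"
  shows "(\<Sum>u<n. \<Sum>v<n. if {u, v} \<in> F then w {u, v} else 0) = 2 * (\<Sum>e\<in>F. w e)"
proof -
  let ?P = "{p \<in> {..<n} \<times> {..<n}. {fst p, snd p} \<in> F}"
  have fin: "finite F"
    using assms finite_all_pairs finite_subset by blast
  have fiber: "(\<Sum>p\<in>{p \<in> ?P. {fst p, snd p} = e}. w {fst p, snd p}) = 2 * w e" if e: "e \<in> F" for e
  proof -
    obtain a b where ab: "e = {a, b}" "a < n" "b < n" "a \<noteq> b"
      using e assms by (auto simp: all_pairs_def)
    have "(x, y) \<in> {p \<in> ?P. {fst p, snd p} = e} \<longleftrightarrow> (x, y) \<in> {(a, b), (b, a)}" for x y
      using ab(2-4) e unfolding ab(1) by (simp add: doubleton_eq_iff) (metis insert_commute)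
    hence "{p \<in> ?P. {fst p, snd p} = e} = {(a, b), (b, a)}"
      by (intro equalityI subrelI) (simp_all only:)
    thus ?thesis
      using ab by (simp add: insert_commute)
  qed
  have "(\<Sum>u<n. \<Sum>v<n. if {u, v} \<in> F then w {u, v} else 0) =
      (\<Sum>p\<in>{..<n} \<times> {..<n}. if {fst p, snd p} \<in> F then w {fst p, snd p} else 0)"
    by (simp add: sum.cartesian_product split_beta)
  also have "\<dots> = (\<Sum>p\<in>?P. w {fst p, snd p})"
    by (rule sum.inter_filter[symmetric]) simp
  also have "\<dots> = (\<Sum>e\<in>F. \<Sum>p\<in>{p \<in> ?P. {fst p, snd p} = e}. w {fst p, snd p})"
    using fin by (intro sum.group[symmetric]) auto
  also have "\<dots> = (\<Sum>e\<in>F. 2 * w e)"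
    by (intro sum.cong refl fiber)
  finally show ?thesis
    by (simp add: sum_distrib_left)
qed

definition label_cut :: "multicut \<Rightarrow> (nat \<Rightarrow> nat) \<Rightarrow> nat set set" where
  "label_cut I f = {{u, v} | u v. {u, v} \<in> edges I \<and> f u \<noteq> f v}"

lemma label_cut_iff: "{u, v} \<in> label_cut I f \<longleftrightarrow> {u, v} \<in> edges I \<and> f u \<noteq> f v"
  by (auto simp: label_cut_def doubleton_eq_iff insert_commute)

lemma cost_label_cut:
  assumes "valid_instance I"
  shows "2 * cost I (label_cut I f) = label_cost (nverts I) (weight_matrix I) f"
proof -
  have "label_cut I f \<subseteq> all_pairs {..<nverts I}"
    using assms by (auto simp: label_cut_def valid_instance_def)
  hence "2 * cost I (label_cut I f) =
      (\<Sum>u<nverts I. \<Sum>v<nverts I. if {u, v} \<in> label_cut I f then weight I {u, v} else 0)"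
    unfolding cost_def by (rule sum_ordered_pairs[symmetric])
  also have "\<dots> = label_cost (nverts I) (weight_matrix I) f"
    unfolding label_cost_def by (intro sum.cong refl) (simp add: label_cut_iff weight_matrix_def)
  finally show ?thesis .
qed

text \<open>Labels are constant along a path that avoids the cut, so the ends of a demand edge
  joined by such a path would lie in one independent set.\<close>

lemma feasible_label_cut:
  assumes I: "valid_instance I" and f: "labeling (nverts I) L lab f"
    and lab: "\<And>i. i < L \<Longrightarrow> lab i \<in> mis (dedges I) {..<nverts I}"
  shows "feasible I (label_cut I f)"
  unfolding feasible_def
proof (intro conjI allI impI notI)
  show "label_cut I f \<subseteq> edges I"
    by (auto simp: label_cut_def)
  fix s t assume st: "{s, t} \<in> dedges I" and ex: "\<exists>p. is_path (edges I - label_cut I f) s p t"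
  have const: "f (hd p) = f (last p)"
    if "p \<noteq> []" "successively (\<lambda>u v. {u, v} \<in> edges I - label_cut I f) p" for p
    using that by (induction p rule: induct_list012) (auto simp: label_cut_iff)
  have eq: "f s = f t"
    using ex const by (auto simp: is_path_def)
  have "{s, t} \<in> all_pairs (dverts I)" "dverts I \<subseteq> {..<nverts I}"
    using st I by (auto simp: valid_instance_def)
  hence "s < nverts I" "t < nverts I"
    by (auto simp: all_pairs_def doubleton_eq_iff)
  hence "f s < L" "s \<in> lab (f s)" "t \<in> lab (f s)"
    using f eq by (auto simp: labeling_def)
  thus False
    using mis_independent[OF lab] st by blast
qed

text \<open>\<open>is_path\<close> demands distinct vertices, so a path whose next vertex has
  occurred before is cut back to that occurrence.\<close>

lemma is_path_of_rtrancl: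
  assumes "(s, t) \<in> {(u, v). {u, v} \<in> E}\<^sup>*"
  shows "\<exists>p. is_path E s p t"
  using assms
proof (induction rule: rtrancl_induct)
  case base
  have "is_path E s [s] s"
    by (simp add: is_path_def)
  thus ?case
    by blast
next
  case (step u v)
  then obtain p where p: "is_path E s p u"
    by blast
  show ?case
  proof (cases "v \<in> set p")
    case True
    then obtain q r where "p = (q @ [v]) @ r"
      by (auto simp: in_set_conv_decomp)
    hence "is_path E s (q @ [v]) v"
      using p by (auto simp: is_path_def successively_append_iff hd_append split: if_splits)
    thus ?thesis
      by blast
  next
    case False
    have "is_path E s (p @ [v]) v"
      using p False step(2) by (auto simp: is_path_def successively_append_iff)
    thus ?thesis
      by blast
  qed
qed

text \<open>A component of \<open>G - F\<close> contains no demand edge, so it extends to a maximal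
  independent set, which serves as its label. Labels then change only across
  \<open>F\<close>.\<close>

lemma labeling_of_multicut:
  assumes I: "valid_instance I" and F: "feasible I F"
    and lab: "mis (dedges I) {..<nverts I} = lab ` {..<L}"
  shows "\<exists>h. labeling (nverts I) L lab h \<and> label_cost (nverts I) (weight_matrix I) h \<le> 2 * cost I F"
proof -
  let ?n = "nverts I"
  define R where "R = {(u, v). {u, v} \<in> edges I - F}"
  define comp where "comp v = {u. u < ?n \<and> (v, u) \<in> R\<^sup>*}" for v
  have sym: "sym (R\<^sup>*)"
    by (intro sym_rtrancl) (auto simp: R_def sym_def insert_commute)
  have "\<exists>i<L. comp v \<subseteq> lab i" for v
  proof -
    have "{a, b} \<notin> dedges I" if "a \<in> comp v" "b \<in> comp v" for a b
    proof
      assume ab: "{a, b} \<in> dedges I"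
      have "(a, v) \<in> R\<^sup>*"
        using that(1) sym by (auto simp: comp_def dest: symD)
      hence "(a, b) \<in> R\<^sup>*"
        using that(2) by (auto simp: comp_def intro: rtrancl_trans)
      thus False
        using is_path_of_rtrancl[of a b "edges I - F"] ab F by (auto simp: R_def feasible_def)
    qed
    moreover have "{x} \<notin> dedges I" for x
      using I by (auto simp: valid_instance_def all_pairs_def doubleton_eq_iff)
    ultimately have "\<exists>M\<in>mis (dedges I) {..<?n}. comp v \<subseteq> M"
      by (intro mis_extends) (auto simp: comp_def)
    thus ?thesis
      using lab by auto
  qed
  \<comment> \<open>The label is chosen for the component as a set, so that all its vertices receive
    the same one.\<close>
  then obtain g where g: "\<And>v. g (comp v) < L \<and> comp v \<subseteq> lab (g (comp v))"
    using that[of "\<lambda>C. SOME i. i < L \<and> C \<subseteq> lab i"] by (metis (mono_tags, lifting) someI_ex)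
  define h where "h v = g (comp v)" for v
  have "labeling ?n L lab h"
    using g by (fastforce simp: labeling_def h_def comp_def)
  moreover have "label_cost ?n (weight_matrix I) h \<le> 2 * cost I F"
  proof -
    have FE: "F \<subseteq> edges I" "edges I \<subseteq> all_pairs {..<?n}"
      using F I by (auto simp: feasible_def valid_instance_def)
    have same: "h u = h v" if "{u, v} \<in> edges I - F" for u v
    proof -
      have "(u, v) \<in> R\<^sup>*" "(v, u) \<in> R\<^sup>*"
        using that by (auto simp: R_def insert_commute)
      hence "comp u = comp v"
        by (auto simp: comp_def intro: rtrancl_trans)
      thus ?thesis
        by (simp add: h_def)
    qed
    have "label_cut I h \<subseteq> F"
      using same by (auto simp: label_cut_def)
    hence "cost I (label_cut I h) \<le> cost I F"
      unfolding cost_def using FE I finite_all_pairs[of "{..<?n}"]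
      by (intro sum_mono2) (auto simp: valid_instance_def intro: finite_subset)
    thus ?thesis
      using cost_label_cut[OF I, of h] by simp
  qed
  ultimately show ?thesis
    by blast
qed

text \<open>Both labellings are measured by twice the weight of their cuts, so the factor from
  double counting cancels and only the ratio remains.\<close>

theorem label_cut_two_approx:
  assumes I: "valid_instance I" and lab: "mis (dedges I) {..<nverts I} = lab ` {..<L}"
    and f: "\<And>h. labeling (nverts I) L lab h \<Longrightarrow>
      label_cost (nverts I) (weight_matrix I) f \<le> 2 * label_cost (nverts I) (weight_matrix I) h"
  shows "cost I (label_cut I f) \<le> 2 * opt I"
proof -
  have "opt I \<in> cost I ` {F. feasible I F}"
    unfolding opt_def using finite_feasible[OF I] feasible_all_edges[OF I] by (intro Min_in) auto
  then obtain F where F: "feasible I F" "opt I = cost I F"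
    by auto
  obtain h where "labeling (nverts I) L lab h"
    "label_cost (nverts I) (weight_matrix I) h \<le> 2 * cost I F"
    using labeling_of_multicut[OF I F(1) lab] by blast
  thus ?thesis
    using f[of h] cost_label_cut[OF I, of f] F(2) by linarith
qed

section \<open>Time-bounded program verification\<close>

text \<open>
  If every loop makes at most \<open>z\<close> iterations, a program \<open>c\<close> halts within \<open>z ^ deg c\<close> steps, so no
  running time has to be computed explicitly.
\<close>

fun deg :: "com \<Rightarrow> nat" where
  "deg (Seq c d) = max (deg c) (deg d) + 1"
| "deg (Cond b c d) = max (deg c) (deg d) + 1"
| "deg (While b c) = deg c + 3"
| "deg _ = 0"

fun nwrites :: "com \<Rightarrow> nat set" where
  "nwrites (NStore a i x) = {a}"
| "nwrites (Seq c d) = nwrites c \<union> nwrites d"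
| "nwrites (Cond b c d) = nwrites c \<union> nwrites d"
| "nwrites (While b c) = nwrites c"
| "nwrites _ = {}"

fun rwrites :: "com \<Rightarrow> nat set" where
  "rwrites (RStore a i x) = {a}"
| "rwrites (Seq c d) = rwrites c \<union> rwrites d"
| "rwrites (Cond b c d) = rwrites c \<union> rwrites d"
| "rwrites (While b c) = rwrites c"
| "rwrites _ = {}"

text \<open>A frame condition at the granularity of whole arrays, which can be read off the syntax
  of a program.\<close>

definition agree :: "nat set \<Rightarrow> nat set \<Rightarrow> state \<Rightarrow> state \<Rightarrow> bool" where
  "agree N R s s' \<longleftrightarrow> (\<forall>a. a \<notin> N \<longrightarrow> nmem s' a = nmem s a) \<and> (\<forall>a. a \<notin> R \<longrightarrow> rmem s' a = rmem s a)"

definition runs :: "nat \<Rightarrow> com \<Rightarrow> state \<Rightarrow> (state \<Rightarrow> bool) \<Rightarrow> bool" where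
  "runs z c s Q \<longleftrightarrow> (\<exists>T s'. exec c s T s' \<and> T \<le> z ^ deg c \<and> Q s')"

lemma nmem_nupdate [simp]:
  "nmem (nupdate a i x s) = (nmem s)(a := (nmem s a)(i := x))" "rmem (nupdate a i x s) = rmem s"
  by (simp_all add: nupdate_def)

lemma rmem_rupdate [simp]:
  "rmem (rupdate a i x s) = (rmem s)(a := (rmem s a)(i := x))" "nmem (rupdate a i x s) = nmem s"
  by (simp_all add: rupdate_def)

lemma agreeD:
  assumes "agree N R s s'"
  shows "a \<notin> N \<Longrightarrow> nmem s' a = nmem s a" "a \<notin> R \<Longrightarrow> rmem s' a = rmem s a"
  using assms by (simp_all add: agree_def)

lemma exec_agree: "exec c s T s' \<Longrightarrow> agree (nwrites c) (rwrites c) s s'"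
  by (induction rule: exec.induct) (auto simp: agree_def)

text \<open>The frame condition is supplied here, so a postcondition needs to describe only what the
  program writes.\<close>

lemma runs_conseq:
  assumes "runs z c s Q" "\<And>s'. Q s' \<Longrightarrow> agree (nwrites c) (rwrites c) s s' \<Longrightarrow> Q' s'"
  shows "runs z c s Q'"
  using assms exec_agree unfolding runs_def by blast

lemma runs_Skip: "Q s \<Longrightarrow> runs z Skip s Q"
  unfolding runs_def by (intro exI[of _ 1] exI[of _ s]) (simp add: exec.Skip[unfolded One_nat_def])

lemma runs_NStore: "Q (nupdate a (nval i s) (nval x s) s) \<Longrightarrow> runs z (NStore a i x) s Q"
  unfolding runs_def
  by (intro exI[of _ 1] exI[of _ "nupdate a (nval i s) (nval x s) s"]) (simp add:
      exec.NStore[unfolded One_nat_def])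

lemma runs_RStore: "Q (rupdate a (nval i s) (rval x s) s) \<Longrightarrow> runs z (RStore a i x) s Q"
  unfolding runs_def
  by (intro exI[of _ 1] exI[of _ "rupdate a (nval i s) (rval x s) s"]) (simp add:
      exec.RStore[unfolded One_nat_def])

text \<open>The additional 1 in the exponent absorbs the factor 2 that comes from adding two running
  times.\<close>

lemma runs_Seq:
  assumes z: "2 \<le> z" and c: "runs z c s (\<lambda>s'. runs z d s' Q)"
  shows "runs z (Seq c d) s Q"
proof -
  obtain T s' where T: "exec c s T s'" "T \<le> z ^ deg c" "runs z d s' Q"
    using c by (auto simp: runs_def)
  then obtain U s'' where U: "exec d s' U s''" "U \<le> z ^ deg d" "Q s''"
    by (auto simp: runs_def)
  let ?m = "max (deg c) (deg d)"
  have "z ^ deg c \<le> z ^ ?m" "z ^ deg d \<le> z ^ ?m"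
    using z by (auto intro: power_increasing)
  hence "T + U \<le> 2 * z ^ ?m"
    using T U by linarith
  also have "\<dots> \<le> z ^ (?m + 1)"
    using z by simp
  finally show ?thesis
    unfolding runs_def using exec.Seq[OF T(1) U(1)] U(3) by auto
qed

lemma runs_Cond:
  assumes z: "2 \<le> z" and "bval b s \<Longrightarrow> runs z c s Q" "\<not> bval b s \<Longrightarrow> runs z d s Q"
  shows "runs z (Cond b c d) s Q"
proof -
  let ?m = "max (deg c) (deg d)"
  have "z ^ deg c \<le> z ^ ?m" "z ^ deg d \<le> z ^ ?m"
    using z by (auto intro: power_increasing)
  moreover have "z ^ ?m + 1 \<le> 2 * z ^ ?m"
    using z by simp
  moreover have "2 * z ^ ?m \<le> z ^ (?m + 1)"
    using z by simp
  ultimately have le: "z ^ deg c + 1 \<le> z ^ (?m + 1)" "z ^ deg d + 1 \<le> z ^ (?m + 1)"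
    by linarith+
  show ?thesis
  proof (cases "bval b s")
    case True
    then obtain T s' where T: "exec c s T s'" "T \<le> z ^ deg c" "Q s'"
      using assms by (auto simp: runs_def)
    moreover have "T + 1 \<le> z ^ deg (Cond b c d)"
      using T le by simp
    ultimately show ?thesis
      unfolding runs_def using exec.CondTrue[OF True] by blast
  next
    case False
    then obtain T s' where T: "exec d s T s'" "T \<le> z ^ deg d" "Q s'"
      using assms by (auto simp: runs_def)
    moreover have "T + 1 \<le> z ^ deg (Cond b c d)"
      using T le by simp
    ultimately show ?thesis
      unfolding runs_def using exec.CondFalse[OF False] by blast
  qed
qed

abbreviation Var :: "nat \<Rightarrow> nexp" where
  "Var x \<equiv> NCell x (NConst 0)"

abbreviation Assign :: "nat \<Rightarrow> nexp \<Rightarrow> com" where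
  "Assign x \<equiv> NStore x (NConst 0)"

definition For :: "nat \<Rightarrow> nexp \<Rightarrow> com \<Rightarrow> com" where
  "For x b c = Seq (Assign x (NConst 0))
     (While (NLess (Var x) b) (Seq c (Assign x (NAdd (Var x) (NConst 1)))))"

lemma writes_For [simp]:
  "nwrites (For x b c) = insert x (nwrites c)" "rwrites (For x b c) = rwrites c"
  by (auto simp: For_def)

text \<open>The bound expression is evaluated anew in every round, so its value must be the same in
  all states that differ from the start only in written arrays. Of the exponents gained, one counts
  the rounds and two absorb the constants, as \<open>4 <= z * z\<close>.\<close>

lemma runs_For:
  assumes z: "2 \<le> z" and m: "m \<le> z" and x: "x \<notin> nwrites c"
    and bound: "\<And>s. agree (insert x (nwrites c)) (rwrites c) s0 s \<Longrightarrow> nval b s = m"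
    and init: "Inv 0 (nupdate x 0 0 s0)"
    and step: "\<And>i s. i < m \<Longrightarrow> Inv i s \<Longrightarrow> nmem s x 0 = i \<Longrightarrow>
      agree (insert x (nwrites c)) (rwrites c) s0 s \<Longrightarrow>
      runs z c s (\<lambda>s'. Inv (Suc i) (nupdate x 0 (Suc i) s'))"
    and final: "\<And>s. Inv m s \<Longrightarrow> agree (insert x (nwrites c)) (rwrites c) s0 s \<Longrightarrow> Q s"
  shows "runs z (For x b c) s0 Q"
proof -
  let ?agree = "agree (insert x (nwrites c)) (rwrites c) s0"
  let ?c = "Seq c (Assign x (NAdd (Var x) (NConst 1)))"
  have loop: "\<exists>T s'. exec (While (NLess (Var x) b) ?c) s T s' \<and> T \<le> j * (z ^ deg c + 2) + 1 \<and> Inv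
      m s' \<and> ?agree s'"
    if "Inv i s" "nmem s x 0 = i" "?agree s" "i + j = m" for i j s
    using that
  proof (induction j arbitrary: i s)
    case 0
    hence "\<not> bval (NLess (Var x) b) s"
      using bound[OF 0(3)] by simp
    from exec.WhileFalse[OF this] show ?case
      using 0 by (intro exI[of _ 1] exI[of _ s]) simp
  next
    case (Suc j)
    obtain T s' where T: "exec c s T s'" "T \<le> z ^ deg c" "Inv (Suc i) (nupdate x 0 (Suc i) s')"
      using step[of i s] Suc.prems by (auto simp: runs_def)
    have ag: "agree (nwrites c) (rwrites c) s s'"
      using T(1) by (rule exec_agree)
    hence i: "nmem s' x 0 = i"
      using agreeD(1)[OF ag x] Suc.prems by simp
    let ?s = "nupdate x 0 (Suc i) s'"
    have c: "exec ?c s (T + 1) ?s"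
      using exec.Seq[OF T(1) exec.NStore[of x "NConst 0" "NAdd (Var x) (NConst 1)" s']] i by simp
    have "?agree ?s"
      using ag Suc.prems(3) by (auto simp: agree_def)
    then obtain U s'' where U: "exec (While (NLess (Var x) b) ?c) ?s U s''"
        "U \<le> j * (z ^ deg c + 2) + 1" "Inv m s''" "?agree s''"
      using Suc.IH[of "Suc i" ?s] T(3) Suc.prems(4) by auto
    have "bval (NLess (Var x) b) s"
      using bound[OF Suc.prems(3)] Suc.prems by simp
    hence "exec (While (NLess (Var x) b) ?c) s (T + 1 + U + 1) s''"
      using c U(1) by (rule exec.WhileTrue)
    moreover have "T + 1 + U + 1 \<le> Suc j * (z ^ deg c + 2) + 1"
      using T(2) U(2) by simp
    ultimately show ?case
      using U by blast
  qed
  let ?s = "nupdate x 0 0 s0"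
  have "?agree ?s"
    by (auto simp: agree_def)
  then obtain T s' where T: "exec (While (NLess (Var x) b) ?c) ?s T s'"
      "T \<le> m * (z ^ deg c + 2) + 1" "Inv m s'" "?agree s'"
    using loop[of 0 ?s m] init by auto
  have "exec (For x b c) s0 (1 + T) s'"
    unfolding For_def using exec.Seq[OF exec.NStore[of x "NConst 0" "NConst 0" s0]] T(1) by simp
  moreover have "1 + T \<le> z ^ deg (For x b c)"
  proof -
    let ?d = "deg c"
    have "m * (z ^ ?d + 2) \<le> z * (z ^ ?d + 2)"
      using m by (rule mult_le_mono1)
    hence "1 + T \<le> z * (z ^ ?d + 2) + 2"
      using T(2) by linarith
    also have "\<dots> \<le> z * (z ^ ?d + 3)"
      using z by (simp add: algebra_simps)
    also have "\<dots> \<le> z * (4 * z ^ ?d)"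
      using z by (intro mult_le_mono2) (simp add: Suc_le_eq)
    also have "\<dots> \<le> z * ((z * z) * z ^ ?d)"
      using mult_mono[OF z z] by (intro mult_le_mono2 mult_le_mono1) simp
    also have "\<dots> = z ^ (?d + 3)"
      by (simp add: power_add power3_eq_cube)
    also have "\<dots> \<le> z ^ deg (For x b c)"
      using z by (intro power_increasing) (auto simp: For_def)
    finally show ?thesis .
  qed
  ultimately show ?thesis
    unfolding runs_def using final[OF T(3,4)] by blast
qed

section \<open>Enumerating the maximal independent sets\<close>

text \<open>
  Arrays named \<open>a...\<close> hold natural numbers, those named \<open>r...\<close> reals; the numbers below 5 and the
      real
  array 0 are fixed by the input and output conventions. The independent sets found so far are the
  first \<open>aCNT\<close> rows of \<open>aFAM\<close>, those of the next stage the first \<open>aCNT'\<close> rows of \<open>aNEW\<close>. Arrays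
      \<open>aF\<close>,
  \<open>aL\<close> and \<open>aBEST\<close> hold the current labelling, a candidate and the best candidate so far.
\<close>

abbreviation (input) "aN \<equiv> (0 :: nat)"
abbreviation (input) "aH \<equiv> (3 :: nat)"
abbreviation (input) "aROW \<equiv> (5 :: nat)"
abbreviation (input) "aFAM \<equiv> (6 :: nat)"
abbreviation (input) "aNEW \<equiv> (7 :: nat)"
abbreviation (input) "aCNT \<equiv> (8 :: nat)"
abbreviation (input) "aCNT' \<equiv> (9 :: nat)"
abbreviation (input) "aCAND \<equiv> (10 :: nat)"
abbreviation (input) "aJ \<equiv> (11 :: nat)"
abbreviation (input) "aB \<equiv> (12 :: nat)"
abbreviation (input) "aI \<equiv> (13 :: nat)"
abbreviation (input) "aV \<equiv> (14 :: nat)"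
abbreviation (input) "aU \<equiv> (15 :: nat)"
abbreviation (input) "aOK \<equiv> (16 :: nat)"
abbreviation (input) "aHIT \<equiv> (17 :: nat)"
abbreviation (input) "aR \<equiv> (18 :: nat)"
abbreviation (input) "aX \<equiv> (19 :: nat)"

definition NEq :: "nexp \<Rightarrow> nexp \<Rightarrow> bexp" where
  "NEq x y = BAnd (BNot (NLess x y)) (BNot (NLess y x))"

definition NZ :: "nexp \<Rightarrow> bexp" where
  "NZ x = NLess (NConst 0) x"

lemma bval_NEq [simp]: "bval (NEq x y) s \<longleftrightarrow> nval x s = nval y s"
  by (auto simp: NEq_def)

lemma bval_NZ [simp]: "bval (NZ x) s \<longleftrightarrow> nval x s \<noteq> 0"
  by (auto simp: NZ_def)

text \<open>There is no multiplication; array \<open>aROW\<close> is a table of the multiples of \<open>n\<close>.\<close>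

abbreviation Ix :: "nexp \<Rightarrow> nexp \<Rightarrow> nexp" where
  "Ix u v \<equiv> NAdd (NCell aROW u) v"

definition row :: "nat \<Rightarrow> (nat \<Rightarrow> nat) \<Rightarrow> nat \<Rightarrow> nat set" where
  "row n A i = {v. v < n \<and> A (i * n + v) \<noteq> 0}"

definition env :: "nat \<Rightarrow> nat \<Rightarrow> state \<Rightarrow> bool" where
  "env n m s \<longleftrightarrow> nmem s aN 0 = n \<and> (\<forall>i\<le>m. nmem s aROW i = i * n)"

lemma envD: "env n m s \<Longrightarrow> nmem s aN 0 = n" "env n m s \<Longrightarrow> i \<le> m \<Longrightarrow> nmem s aROW i = i * n"
  by (simp_all add: env_def)

lemma index_eq_iff:
  fixes i j v w n :: nat
  assumes "v < n" "w < n"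
  shows "i * n + v = j * n + w \<longleftrightarrow> i = j \<and> v = w"
proof
  assume eq: "i * n + v = j * n + w"
  have "(i * n + v) div n = i" "(j * n + w) div n = j"
    using assms by simp_all
  thus "i = j \<and> v = w"
    using eq by auto
qed simp

definition fill_rows :: "nexp \<Rightarrow> com" where
  "fill_rows b = Seq (NStore aROW (NConst 0) (NConst 0))
     (For aX b (NStore aROW (NAdd (Var aX) (NConst 1)) (NAdd (NCell aROW (Var aX)) (Var aN))))"

lemma fill_rows_writes [simp]: "nwrites (fill_rows b) = {aROW, aX}" "rwrites (fill_rows b) = {}"
  by (auto simp: fill_rows_def)

definition mult_into :: "nat \<Rightarrow> nexp \<Rightarrow> nexp \<Rightarrow> com" where
  "mult_into x b d = Seq (Assign x (NConst 0)) (For aX b (Assign x (NAdd (Var x) d)))"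

lemma mult_into_writes [simp]: "nwrites (mult_into x b d) = {x, aX}" "rwrites (mult_into x b d) =
    {}"
  by (auto simp: mult_into_def)

definition make_cand :: com where
  "make_cand = For aV (Var aN)
     (Cond (NLess (Var aB) (NConst 1))
       (NStore aCAND (Var aV) (NCell aFAM (Ix (Var aI) (Var aV))))
       (Cond (NEq (Var aV) (Var aJ))
         (NStore aCAND (Var aV) (NConst 1))
         (Cond (NZ (NCell aH (Ix (Var aV) (Var aJ))))
           (NStore aCAND (Var aV) (NConst 0))
           (NStore aCAND (Var aV) (NCell aFAM (Ix (Var aI) (Var aV)))))))"

lemma make_cand_writes [simp]: "nwrites make_cand = {aV, aCAND}" "rwrites make_cand = {}"
  by (auto simp: make_cand_def)

definition find_neighbour :: com where
  "find_neighbour = Seq (Assign aHIT (NConst 0))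
     (For aU (NAdd (Var aJ) (NConst 1))
       (Cond (BAnd (NZ (NCell aCAND (Var aU))) (NZ (NCell aH (Ix (Var aU) (Var aV)))))
         (Assign aHIT (NConst 1)) Skip))"

lemma find_neighbour_writes [simp]: "nwrites find_neighbour = {aHIT, aU}" "rwrites find_neighbour
    = {}"
  by (auto simp: find_neighbour_def)

definition check_max :: com where
  "check_max = Seq (Assign aOK (NConst 1))
     (For aV (NAdd (Var aJ) (NConst 1))
       (Seq find_neighbour
         (Cond (NZ (Var aHIT))
           (Cond (NZ (NCell aCAND (Var aV))) (Assign aOK (NConst 0)) Skip)
           (Cond (NZ (NCell aCAND (Var aV))) Skip (Assign aOK (NConst 0))))))"

lemma check_max_writes [simp]: "nwrites check_max = {aOK, aV, aHIT, aU}" "rwrites check_max = {}"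
  by (auto simp: check_max_def)

definition compare_cand :: com where
  "compare_cand = Seq (Assign aHIT (NConst 1))
     (For aV (Var aN)
       (Cond (NZ (NCell aCAND (Var aV)))
         (Cond (NZ (NCell aNEW (Ix (Var aR) (Var aV)))) Skip (Assign aHIT (NConst 0)))
         (Cond (NZ (NCell aNEW (Ix (Var aR) (Var aV)))) (Assign aHIT (NConst 0)) Skip)))"

lemma compare_cand_writes [simp]: "nwrites compare_cand = {aHIT, aV}" "rwrites compare_cand = {}"
  by (auto simp: compare_cand_def)

text \<open>Different old sets and both kinds of candidate can produce the same set. Without
  duplicates the number of labels is the number of maximal independent sets.\<close>

definition check_new :: com where
  "check_new = For aR (Var aCNT')
     (Seq compare_cand (Cond (NZ (Var aHIT)) (Assign aOK (NConst 0)) Skip))"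

lemma check_new_writes [simp]: "nwrites check_new = {aOK, aV, aHIT, aR}" "rwrites check_new = {}"
  by (auto simp: check_new_def)

definition store_cand :: com where
  "store_cand = For aV (Var aN) (NStore aNEW (Ix (Var aCNT') (Var aV)) (NCell aCAND (Var aV)))"

lemma store_cand_writes [simp]: "nwrites store_cand = {aV, aNEW}" "rwrites store_cand = {}"
  by (auto simp: store_cand_def)

definition add_cand :: com where
  "add_cand = Cond (NZ (Var aOK))
     (Seq store_cand
       (Assign aCNT' (NAdd (Var aCNT') (NConst 1))))
     Skip"

lemma add_cand_writes [simp]: "nwrites add_cand = {aV, aNEW, aCNT'}" "rwrites add_cand = {}"
  by (auto simp: add_cand_def)

definition copy_row :: com where
  "copy_row = For aV (Var aN)
     (NStore aFAM (Ix (Var aR) (Var aV)) (NCell aNEW (Ix (Var aR) (Var aV))))"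

lemma copy_row_writes [simp]: "nwrites copy_row = {aV, aFAM}" "rwrites copy_row = {}"
  by (auto simp: copy_row_def)

definition copy_family :: com where
  "copy_family = Seq (For aR (Var aCNT') copy_row)
     (Assign aCNT (Var aCNT'))"

lemma copy_family_writes [simp]: "nwrites copy_family = {aR, aV, aFAM, aCNT}" "rwrites copy_family
    = {}"
  by (auto simp: copy_family_def)

definition process_cand :: com where
  "process_cand = Seq make_cand (Seq check_max (Seq check_new add_cand))"

lemma process_cand_writes [simp]:
  "nwrites process_cand = {aV, aCAND, aOK, aHIT, aU, aR, aNEW, aCNT'}" "rwrites process_cand = {}"
  by (auto simp: process_cand_def)

text \<open>The table of row offsets is refilled because a family may double within one
  stage.\<close>

definition mis_stage :: com where
  "mis_stage = Seq (fill_rows (NAdd (Var aN) (NAdd (Var aCNT) (Var aCNT))))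
     (Seq (Assign aCNT' (NConst 0))
     (Seq (For aB (NConst 2) (For aI (Var aCNT) process_cand))
       copy_family))"

lemma mis_stage_writes [simp]:
  "nwrites mis_stage = {aROW, aX, aB, aI, aV, aCAND, aOK, aHIT, aU, aR, aNEW, aCNT', aFAM, aCNT}"
  "rwrites mis_stage = {}"
  by (auto simp: mis_stage_def)

text \<open>The initial count is 1 because row 0 of the zeroed \<open>aFAM\<close> stands for the
  empty set, the only maximal independent set of the empty graph.\<close>

definition enum_mis :: com where
  "enum_mis = Seq (Assign aCNT (NConst 1)) (For aJ (Var aN) mis_stage)"

lemma enum_mis_writes [simp]:
  "nwrites enum_mis =
    {aJ, aROW, aX, aB, aI, aV, aCAND, aOK, aHIT, aU, aR, aNEW, aCNT', aFAM, aCNT}"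
  "rwrites enum_mis = {}"
  by (auto simp: enum_mis_def)

section \<open>Correctness of the enumeration\<close>

lemma runs_fill_rows:
  assumes z: "2 \<le> z" "m \<le> z" and b: "\<And>t. agree {aROW, aX} {} s t \<Longrightarrow> nval b t = m"
    and n: "nmem s aN 0 = n"
  shows "runs z (fill_rows b) s (env n m)"
  unfolding fill_rows_def
proof (rule runs_Seq[OF z(1)], rule runs_NStore,
    rule runs_For[OF z, where Inv = "\<lambda>k t. \<forall>i\<le>k. nmem t aROW i = i * n"])
  let ?s = "nupdate aROW (nval (NConst 0) s) (nval (NConst 0) s) s"
  fix t
  assume ag: "agree (insert aX (nwrites (NStore aROW (NAdd (Var aX) (NConst 1)) (NAdd (NCell aROW
      (Var aX)) (Var aN)))))
      (rwrites (NStore aROW (NAdd (Var aX) (NConst 1)) (NAdd (NCell aROW (Var aX)) (Var aN)))) ?s t"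
  have "agree {aROW, aX} {} s t"
    using ag by (simp add: agree_def insert_commute)
  thus "nval b t = m"
    by (rule b)
  have fr: "nmem t aN 0 = n"
    using agreeD(1)[OF ag, of aN] n by simp
  show "env n m t" if "\<forall>i\<le>m. nmem t aROW i = i * n"
    using that fr by (simp add: env_def)
  show "runs z (NStore aROW (NAdd (Var aX) (NConst 1)) (NAdd (NCell aROW (Var aX)) (Var aN))) t
      (\<lambda>s'. \<forall>i\<le>Suc k. nmem (nupdate aX 0 (Suc k) s') aROW i = i * n)"
    if "\<forall>i\<le>k. nmem t aROW i = i * n" "nmem t aX 0 = k" for k
    using that fr by (intro runs_NStore) (auto simp: le_Suc_eq)
qed (auto simp: agree_def)

lemma runs_mult_into:
  assumes z: "2 \<le> z" "m \<le> z" and x: "x \<noteq> aX"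
    and b: "\<And>t. agree {x, aX} {} s t \<Longrightarrow> nval b t = m \<and> nval d t = k"
  shows "runs z (mult_into x b d) s (\<lambda>t. nmem t x 0 = m * k)"
  unfolding mult_into_def
proof (rule runs_Seq[OF z(1)], rule runs_NStore,
    rule runs_For[OF z, where Inv = "\<lambda>i t. nmem t x 0 = i * k"])
  fix t
  assume ag: "agree (insert aX (nwrites (Assign x (NAdd (Var x) d)))) (rwrites (Assign x (NAdd
      (Var x) d)))
      (nupdate x (nval (NConst 0) s) (nval (NConst 0) s) s) t"
  have "agree {x, aX} {} s t"
    using ag by (simp add: agree_def insert_commute)
  from b[OF this] show "nval b t = m"
    by simp
  show "runs z (Assign x (NAdd (Var x) d)) t (\<lambda>s'. nmem (nupdate aX 0 (Suc i) s') x 0 = Suc i * k)"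
    if "nmem t x 0 = i * k" for i
    using that x b[OF \<open>agree {x, aX} {} s t\<close>] by (intro runs_NStore) simp
qed (use x in auto)

text \<open>The two kinds of candidate from \<open>mis_Suc\<close>, selected by the loop variable
  \<open>aB\<close>.\<close>

definition cand :: "nat set set \<Rightarrow> nat \<Rightarrow> nat \<Rightarrow> nat set \<Rightarrow> nat set" where
  "cand E b j M = (if b = 0 then M else insert j {x \<in> M. {x, j} \<notin> E})"

definition adjacency :: "nat \<Rightarrow> nat set set \<Rightarrow> state \<Rightarrow> bool" where
  "adjacency n E s \<longleftrightarrow> (\<forall>u<n. \<forall>v<n. nmem s aH (u * n + v) \<noteq> 0 \<longleftrightarrow> {u, v} \<in> E)"

lemma runs_make_cand:
  assumes z: "2 \<le> z" "n \<le> z" and env: "env n m s" "n \<le> m" and adj: "adjacency n E s"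
    and j: "nmem s aJ 0 = j" "j < n" and i: "nmem s aI 0 = i" "i \<le> m" and b: "nmem s aB 0 = b"
  shows "runs z make_cand s (\<lambda>t. row n (nmem t aCAND) 0 = cand E b j (row n (nmem s aFAM) i))"
  unfolding make_cand_def
proof (rule runs_For[OF z, where Inv = "\<lambda>k t. \<forall>v<k. nmem t aCAND v \<noteq> 0 \<longleftrightarrow> v \<in> cand E b j (row n
    (nmem s aFAM) i)"],
    goal_cases)
  case (4 k t)
  have fr: "nmem t a = nmem s a" if "a \<noteq> aV" "a \<noteq> aCAND" for a
    using 4(4) that by (simp add: agree_def)
  have "nmem s aH (k * n + j) \<noteq> 0 \<longleftrightarrow> {k, j} \<in> E"
    using adj 4(1) j by (simp add: adjacency_def)
  thus ?case
    using 4(1-3) env i b j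
    by (intro runs_Cond[OF z(1)] runs_NStore)
      (auto simp: fr less_Suc_eq cand_def row_def envD[OF env(1)])
next
  case (5 t)
  have "cand E b j (row n (nmem s aFAM) i) \<subseteq> {..<n}"
    using j by (auto simp: cand_def row_def)
  thus ?case
    using 5(1) by (auto simp: row_def)
qed (use env in \<open>auto simp: agree_def env_def\<close>)

lemma row_memD: "row n A 0 = M \<Longrightarrow> v < n \<Longrightarrow> A v \<noteq> 0 \<longleftrightarrow> v \<in> M"
  by (auto simp: row_def)

lemma runs_find_neighbour:
  assumes z: "2 \<le> z" "n \<le> z" and env: "env n m s" "n \<le> m" and adj: "adjacency n E s"
    and j: "nmem s aJ 0 = j" "j < n" and v: "nmem s aV 0 = v" "v < n"
    and M: "row n (nmem s aCAND) 0 = M" "M \<subseteq> {..<Suc j}"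
  shows "runs z find_neighbour s (\<lambda>t. nmem t aHIT 0 \<noteq> 0 \<longleftrightarrow> (\<exists>u\<in>M. {u, v} \<in> E))"
  unfolding find_neighbour_def
proof (rule runs_Seq[OF z(1)], rule runs_NStore,
    rule runs_For[OF z(1), where m = "Suc j" and Inv = "\<lambda>k t. nmem t aHIT 0 \<noteq> 0 \<longleftrightarrow> (\<exists>u<k. u \<in> M \<and>
        {u, v} \<in> E)"],
    goal_cases)
  case (5 k t)
  have fr: "nmem t a = nmem s a" if "a \<noteq> aU" "a \<noteq> aHIT" for a
    using 5(4) that by (simp add: agree_def)
  have "k < n"
    using 5(1) j by simp
  moreover from this have "nmem s aH (k * n + v) \<noteq> 0 \<longleftrightarrow> {k, v} \<in> E"
    using adj v by (simp add: adjacency_def)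
  ultimately show ?case
    using 5(1-3) env v j row_memD[OF M(1) \<open>k < n\<close>]
    by (intro runs_Cond[OF z(1)] runs_NStore runs_Skip)
      (auto simp: fr less_Suc_eq envD[OF env(1)])
next
  case (6 t)
  thus ?case
    using M(2) by auto
qed (use z j in \<open>auto simp: agree_def\<close>)

lemma runs_check_max:
  assumes z: "2 \<le> z" "n \<le> z" and env: "env n m s" "n \<le> m" and adj: "adjacency n E s"
    and j: "nmem s aJ 0 = j" "j < n"
    and M: "row n (nmem s aCAND) 0 = M" "M \<subseteq> {..<Suc j}"
  shows "runs z check_max s (\<lambda>t. nmem t aOK 0 \<noteq> 0 \<longleftrightarrow> M \<in> mis E {..<Suc j})"
  unfolding check_max_def
proof (rule runs_Seq[OF z(1)], rule runs_NStore,
    rule runs_For[OF z(1), where m = "Suc j" and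
      Inv = "\<lambda>k t. nmem t aOK 0 \<noteq> 0 \<longleftrightarrow> (\<forall>v<k. v \<in> M \<longleftrightarrow> \<not> (\<exists>u\<in>M. {u, v} \<in> E))"],
    goal_cases)
  case (5 k t)
  have fr: "nmem t a = nmem s a" if "a \<notin> {aOK, aV, aHIT, aU}" for a
    using 5(4) that by (simp add: agree_def)
  have kn: "k < n"
    using 5(1) j by simp
  have "env n m t" "adjacency n E t"
    using env adj by (simp_all add: env_def adjacency_def fr)
  hence "runs z find_neighbour t (\<lambda>t. nmem t aHIT 0 \<noteq> 0 \<longleftrightarrow> (\<exists>u\<in>M. {u, k} \<in> E))"
    using kn 5(3) j M env(2) by (intro runs_find_neighbour[OF z]) (auto simp: fr)
  thus ?case
  proof (rule runs_Seq[OF z(1), OF runs_conseq])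
    fix t' assume t': "nmem t' aHIT 0 \<noteq> 0 \<longleftrightarrow> (\<exists>u\<in>M. {u, k} \<in> E)"
      and ag: "agree (nwrites find_neighbour) (rwrites find_neighbour) t t'"
    have fr': "nmem t' a = nmem t a" if "a \<notin> {aHIT, aU}" for a
      using ag that by (simp add: agree_def)
    show "runs z (Cond (NZ (Var aHIT)) (Cond (NZ (NCell aCAND (Var aV))) (Assign aOK (NConst 0))
        Skip)
        (Cond (NZ (NCell aCAND (Var aV))) Skip (Assign aOK (NConst 0)))) t'
      (\<lambda>s'. (nmem (nupdate aV 0 (Suc k) s') aOK 0 \<noteq> 0) = (\<forall>v<Suc k. (v \<in> M) = (\<not> (\<exists>u\<in>M. {u, v} \<in>
          E))))"
      using t' 5(2,3) row_memD[OF M(1) kn]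
      by (intro runs_Cond[OF z(1)] runs_NStore runs_Skip) (auto simp: fr fr' less_Suc_eq)
  qed
next
  case (6 t)
  thus ?case
    using M(2) by (auto simp: mis_def)
qed (use z j in \<open>auto simp: agree_def\<close>)

lemma runs_compare_cand:
  assumes z: "2 \<le> z" "n \<le> z" and env: "env n m s" and r: "nmem s aR 0 = r" "r \<le> m"
  shows "runs z compare_cand s (\<lambda>t. nmem t aHIT 0 \<noteq> 0 \<longleftrightarrow> row n (nmem s aCAND) 0 = row n (nmem s
      aNEW) r)"
  unfolding compare_cand_def
proof (rule runs_Seq[OF z(1)], rule runs_NStore,
    rule runs_For[OF z, where Inv = "\<lambda>k t. nmem t aHIT 0 \<noteq> 0 \<longleftrightarrow>
      (\<forall>v<k. nmem s aCAND v \<noteq> 0 \<longleftrightarrow> nmem s aNEW (r * n + v) \<noteq> 0)"], goal_cases)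
  case (4 k t)
  have fr: "nmem t a = nmem s a" if "a \<notin> {aHIT, aV}" for a
    using 4(4) that by (simp add: agree_def)
  show ?case
    using 4(1-3) r by (intro runs_Cond[OF z(1)] runs_NStore runs_Skip)
      (auto simp: fr less_Suc_eq envD[OF env])
next
  case (5 t)
  thus ?case
    by (auto simp: row_def set_eq_iff)
qed (use env in \<open>auto simp: agree_def env_def\<close>)

lemma runs_check_new:
  assumes z: "2 \<le> z" "n \<le> z" and env: "env n m s"
    and D: "nmem s aCNT' 0 = D" "D \<le> m" "D \<le> z"
  shows "runs z check_new s (\<lambda>t. nmem t aOK 0 \<noteq> 0 \<longleftrightarrow>
    nmem s aOK 0 \<noteq> 0 \<and> row n (nmem s aCAND) 0 \<notin> row n (nmem s aNEW) ` {..<D})"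
  unfolding check_new_def
proof (rule runs_For[OF z(1) D(3), where Inv = "\<lambda>k t. nmem t aOK 0 \<noteq> 0 \<longleftrightarrow>
      nmem s aOK 0 \<noteq> 0 \<and> (\<forall>r<k. row n (nmem s aCAND) 0 \<noteq> row n (nmem s aNEW) r)"], goal_cases)
  case (4 k t)
  have fr: "nmem t a = nmem s a" if "a \<notin> {aOK, aV, aHIT, aR}" for a
    using 4(4) that by (simp add: agree_def)
  have "env n m t"
    using env by (simp add: env_def fr)
  hence "runs z compare_cand t (\<lambda>t'. nmem t' aHIT 0 \<noteq> 0 \<longleftrightarrow> row n (nmem t aCAND) 0 = row n (nmem t
      aNEW) k)"
    using 4 D by (intro runs_compare_cand[OF z]) auto
  thus ?case
  proof (rule runs_Seq[OF z(1), OF runs_conseq])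
    fix t' assume t': "nmem t' aHIT 0 \<noteq> 0 \<longleftrightarrow> row n (nmem t aCAND) 0 = row n (nmem t aNEW) k"
      and ag: "agree (nwrites compare_cand) (rwrites compare_cand) t t'"
    have fr': "nmem t' a = nmem t a" if "a \<notin> {aHIT, aV}" for a
      using ag that by (simp add: agree_def)
    show "runs z (Cond (NZ (Var aHIT)) (Assign aOK (NConst 0)) Skip) t'
      (\<lambda>s'. (nmem (nupdate aR 0 (Suc k) s') aOK 0 \<noteq> 0) =
        (nmem s aOK 0 \<noteq> 0 \<and> (\<forall>r<Suc k. row n (nmem s aCAND) 0 \<noteq> row n (nmem s aNEW) r)))"
      using t' 4(2,3)
      by (intro runs_Cond[OF z(1)] runs_NStore runs_Skip) (auto simp: fr fr' less_Suc_eq)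
  qed
next
  case (5 t)
  thus ?case
    by auto
qed (use D in \<open>auto simp: agree_def\<close>)

lemma row_cong: "(\<And>v. v < n \<Longrightarrow> A (i * n + v) = B (j * n + v)) \<Longrightarrow> row n A i = row n B j"
  by (auto simp: row_def)

lemma runs_store_cand:
  assumes z: "2 \<le> z" "n \<le> z" and env: "env n m s" and D: "nmem s aCNT' 0 = D" "D \<le> m"
  shows "runs z store_cand s (\<lambda>t. row n (nmem t aNEW) D = row n (nmem s aCAND) 0 \<and>
    (\<forall>i<D. row n (nmem t aNEW) i = row n (nmem s aNEW) i))"
  unfolding store_cand_def
proof (rule runs_For[OF z, where Inv = "\<lambda>k t. (\<forall>v<k. nmem t aNEW (D * n + v) = nmem s aCAND v) \<and>
      (\<forall>i<D. \<forall>v<n. nmem t aNEW (i * n + v) = nmem s aNEW (i * n + v))"], goal_cases)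
  case (4 k t)
  have fr: "nmem t a = nmem s a" if "a \<notin> {aV, aNEW}" for a
    using 4(4) that by (simp add: agree_def)
  show ?case
    using 4(1-3) D
    by (intro runs_NStore) (auto simp: fr less_Suc_eq envD[OF env] index_eq_iff)
next
  case (5 t)
  thus ?case
    by (auto intro!: row_cong)
qed (use env in \<open>auto simp: agree_def env_def\<close>)

text \<open>Injectivity makes the stored counter equal to the number of sets, which is what bounds
  time and the number of labels.\<close>

definition family :: "nat \<Rightarrow> (nat \<Rightarrow> nat) \<Rightarrow> nat \<Rightarrow> nat set set \<Rightarrow> bool" where
  "family n A D S \<longleftrightarrow> inj_on (row n A) {..<D} \<and> row n A ` {..<D} = S"

lemma family_card: "family n A D S \<Longrightarrow> card S = D"
  unfolding family_def using card_image[of "row n A" "{..<D}"] by auto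

lemma family_cong: "(\<And>i. i < D \<Longrightarrow> row n A i = row n B i) \<Longrightarrow> family n A D S \<longleftrightarrow> family n B D S"
  unfolding family_def by (intro conj_cong inj_on_cong arg_cong2[of _ _ _ _ "(=)"] image_cong) auto

lemma family_Suc:
  assumes "family n A D S" "\<And>i. i < D \<Longrightarrow> row n B i = row n A i" "row n B D = M" "M \<notin> S"
  shows "family n B (Suc D) (insert M S)"
proof -
  have "family n B D S"
    using assms(1,2) family_cong by metis
  thus ?thesis
    using assms(3,4) by (auto simp: family_def lessThan_Suc)
qed

text \<open>The shape of the resulting family treats an addition, a duplicate and a candidate that
  is not maximal uniformly.\<close>

lemma runs_add_cand:
  assumes z: "2 \<le> z" "n \<le> z" and env: "env n m s"
    and D: "nmem s aCNT' 0 = D" "D \<le> m" and fam: "family n (nmem s aNEW) D S"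
    and M: "row n (nmem s aCAND) 0 = M" and ok: "nmem s aOK 0 \<noteq> 0 \<longleftrightarrow> M \<in> T \<and> M \<notin> S"
  shows "runs z add_cand s (\<lambda>t. family n (nmem t aNEW) (nmem t aCNT' 0) (S \<union> ({M} \<inter> T)))"
  unfolding add_cand_def
proof (rule runs_Cond[OF z(1)])
  assume "bval (NZ (Var aOK)) s"
  hence MT: "M \<in> T" "M \<notin> S"
    using ok by simp_all
  show "runs z (Seq store_cand (Assign aCNT' (NAdd (Var aCNT') (NConst 1)))) s
    (\<lambda>t. family n (nmem t aNEW) (nmem t aCNT' 0) (S \<union> ({M} \<inter> T)))"
  proof (rule runs_Seq[OF z(1), OF runs_conseq[OF runs_store_cand[OF z env D]]], rule runs_NStore,
      goal_cases)
    case (1 t)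
    have "nmem t aCNT' 0 = D"
      using 1(2) D by (simp add: agree_def)
    moreover have "family n (nmem t aNEW) (Suc D) (insert M S)"
      using 1(1) MT M by (intro family_Suc[OF fam]) auto
    moreover have "S \<union> ({M} \<inter> T) = insert M S"
      using MT by auto
    ultimately show ?case
      by simp
  qed
next
  assume "\<not> bval (NZ (Var aOK)) s"
  hence "S \<union> ({M} \<inter> T) = S"
    using ok by auto
  thus "runs z Skip s (\<lambda>t. family n (nmem t aNEW) (nmem t aCNT' 0) (S \<union> ({M} \<inter> T)))"
    using fam D by (intro runs_Skip) simp
qed

lemma runs_process_cand:
  assumes z: "2 \<le> z" "n \<le> z" and env: "env n m s" "n \<le> m" and adj: "adjacency n E s"
    and j: "nmem s aJ 0 = j" "j < n" and i: "nmem s aI 0 = i" "i \<le> m" and b: "nmem s aB 0 = b"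
    and I: "row n (nmem s aFAM) i \<subseteq> {..<j}"
    and D: "nmem s aCNT' 0 = D" "D \<le> m" "D \<le> z" and fam: "family n (nmem s aNEW) D S"
  shows "runs z process_cand s (\<lambda>t. family n (nmem t aNEW) (nmem t aCNT' 0)
    (S \<union> ({cand E b j (row n (nmem s aFAM) i)} \<inter> mis E {..<Suc j})))"
proof -
  let ?M = "cand E b j (row n (nmem s aFAM) i)"
  have M: "?M \<subseteq> {..<Suc j}"
    using I by (auto simp: cand_def subset_iff less_Suc_eq)
  show ?thesis
    unfolding process_cand_def
  proof (rule runs_Seq[OF z(1), OF runs_conseq[OF runs_make_cand[OF z env adj j i b]]])
    fix t1 assume t1: "row n (nmem t1 aCAND) 0 = ?M"
      and "agree (nwrites make_cand) (rwrites make_cand) s t1"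
    hence ag1: "nmem t1 a = nmem s a" if "a \<notin> {aV, aCAND}" for a
      using that by (simp add: agree_def)
    have env1: "env n m t1" "adjacency n E t1" "nmem t1 aJ 0 = j"
      using env adj j by (simp_all add: env_def adjacency_def ag1)
    show "runs z (Seq check_max (Seq check_new add_cand)) t1
      (\<lambda>t. family n (nmem t aNEW) (nmem t aCNT' 0) (S \<union> ({?M} \<inter> mis E {..<Suc j})))"
    proof (rule runs_Seq[OF z(1), OF runs_conseq[OF
            runs_check_max[OF z env1(1) env(2) env1(2,3) j(2) t1 M]]])
      fix t2 assume t2: "nmem t2 aOK 0 \<noteq> 0 \<longleftrightarrow> ?M \<in> mis E {..<Suc j}"
        and "agree (nwrites check_max) (rwrites check_max) t1 t2"
      hence ag2: "nmem t2 a = nmem t1 a" if "a \<notin> {aOK, aV, aHIT, aU}" for a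
        using that by (simp add: agree_def)
      have env2: "env n m t2" "nmem t2 aCNT' 0 = D"
        using env1 D by (simp_all add: env_def ag2 ag1)
      show "runs z (Seq check_new add_cand) t2
        (\<lambda>t. family n (nmem t aNEW) (nmem t aCNT' 0) (S \<union> ({?M} \<inter> mis E {..<Suc j})))"
      proof (rule runs_Seq[OF z(1), OF runs_conseq[OF runs_check_new[OF z env2 D(2,3)]]])
        fix t3 assume t3: "nmem t3 aOK 0 \<noteq> 0 \<longleftrightarrow>
            nmem t2 aOK 0 \<noteq> 0 \<and> row n (nmem t2 aCAND) 0 \<notin> row n (nmem t2 aNEW) ` {..<D}"
          and "agree (nwrites check_new) (rwrites check_new) t2 t3"
        hence ag3: "nmem t3 a = nmem t2 a" if "a \<notin> {aOK, aV, aHIT, aR}" for a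
          using that by (simp add: agree_def)
        have "row n (nmem s aNEW) ` {..<D} = S"
          using fam by (simp add: family_def)
        hence "nmem t3 aOK 0 \<noteq> 0 \<longleftrightarrow> ?M \<in> mis E {..<Suc j} \<and> ?M \<notin> S"
          using t1 t2 t3 by (simp add: ag2 ag1)
        thus "runs z add_cand t3
          (\<lambda>t. family n (nmem t aNEW) (nmem t aCNT' 0) (S \<union> ({?M} \<inter> mis E {..<Suc j})))"
          using env2 D fam t1
          by (intro runs_add_cand[OF z, where m = m and D = D]) (simp_all add: ag3 ag2 ag1 env_def)
      qed
    qed
  qed
qed

lemma runs_copy_row:
  assumes z: "2 \<le> z" "n \<le> z" and env: "env n m s" and r: "nmem s aR 0 = r" "r \<le> m"
  shows "runs z copy_row s (\<lambda>t. row n (nmem t aFAM) r = row n (nmem s aNEW) r \<and>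
    (\<forall>i<r. row n (nmem t aFAM) i = row n (nmem s aFAM) i))"
  unfolding copy_row_def
proof (rule runs_For[OF z, where Inv = "\<lambda>k t. (\<forall>v<k. nmem t aFAM (r * n + v) = nmem s aNEW (r * n
    + v)) \<and>
      (\<forall>i<r. \<forall>v<n. nmem t aFAM (i * n + v) = nmem s aFAM (i * n + v))"], goal_cases)
  case (4 k t)
  have fr: "nmem t a = nmem s a" if "a \<notin> {aV, aFAM}" for a
    using 4(4) that by (simp add: agree_def)
  show ?case
    using 4(1-3) r
    by (intro runs_NStore) (auto simp: fr less_Suc_eq envD[OF env] index_eq_iff)
next
  case (5 t)
  thus ?case
    by (auto intro!: row_cong)
qed (use env in \<open>auto simp: agree_def env_def\<close>)

lemma runs_copy_family:
  assumes z: "2 \<le> z" "n \<le> z" and env: "env n m s"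
    and D: "nmem s aCNT' 0 = D" "D \<le> m" "D \<le> z" and fam: "family n (nmem s aNEW) D S"
  shows "runs z copy_family s (\<lambda>t. family n (nmem t aFAM) (nmem t aCNT 0) S)"
  unfolding copy_family_def
proof (rule runs_Seq[OF z(1)], rule runs_For[OF z(1) D(3), where
      Inv = "\<lambda>k t. \<forall>i<k. row n (nmem t aFAM) i = row n (nmem s aNEW) i"], goal_cases)
  case (4 k t)
  have fr: "nmem t a = nmem s a" if "a \<notin> {aV, aR, aFAM}" for a
    using 4(4) that by (simp add: agree_def)
  have "env n m t"
    using env by (simp add: env_def fr)
  hence "runs z copy_row t (\<lambda>t'. row n (nmem t' aFAM) k = row n (nmem t aNEW) k \<and>
    (\<forall>i<k. row n (nmem t' aFAM) i = row n (nmem t aFAM) i))"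
    using 4 D by (intro runs_copy_row[OF z]) auto
  thus ?case
    by (rule runs_conseq) (use 4(2) in \<open>auto simp: fr less_Suc_eq\<close>)
next
  case (5 t)
  have "family n (nmem t aFAM) D S"
    using fam family_cong 5(1) by metis
  moreover have "nmem t aCNT' 0 = D"
    using 5(2) D by (simp add: agree_def)
  ultimately show ?case
    by (intro runs_NStore) simp
qed (use D in \<open>auto simp: agree_def\<close>)

text \<open>Each old set gives two candidates. This bounds the row offsets that a stage needs before
  its result is known.\<close>

lemma card_mis_Suc_le:
  assumes "\<And>x. {x} \<notin> E"
  shows "card (mis E {..<Suc j}) \<le> 2 * card (mis E {..<j})"
proof -
  let ?f = "\<lambda>I. insert j {x \<in> I. {x, j} \<notin> E}"
  have fin: "finite (mis E {..<j})"
    by (simp add: finite_mis)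
  have "mis E {..<Suc j} \<subseteq> mis E {..<j} \<union> ?f ` mis E {..<j}"
    using mis_Suc[OF assms, of j] by blast
  hence "card (mis E {..<Suc j}) \<le> card (mis E {..<j} \<union> ?f ` mis E {..<j})"
    using fin by (intro card_mono) auto
  also have "\<dots> \<le> card (mis E {..<j}) + card (?f ` mis E {..<j})"
    by (rule card_Un_le)
  also have "card (?f ` mis E {..<j}) \<le> card (mis E {..<j})"
    using fin by (rule card_image_le)
  finally show ?thesis
    by simp
qed

lemma runs_mis_stage:
  assumes z: "2 \<le> z" and n: "nmem s aN 0 = n" and adj: "adjacency n E s" and E: "\<And>x. {x} \<notin> E"
    and j: "nmem s aJ 0 = j" "j < n" and C: "nmem s aCNT 0 = C" "n + (C + C) \<le> z"
    and fam: "family n (nmem s aFAM) C (mis E {..<j})"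
  shows "runs z mis_stage s (\<lambda>t. family n (nmem t aFAM) (nmem t aCNT 0) (mis E {..<Suc j}))"
proof -
  let ?m = "n + (C + C)"
  let ?T = "mis E {..<Suc j}"
  have nz: "n \<le> z" "C \<le> z"
    using C by simp_all
  have card: "card S \<le> C + C" if "S \<subseteq> ?T" for S
  proof -
    have "card S \<le> card ?T"
      using that by (intro card_mono) (auto simp: finite_mis)
    thus ?thesis
      using card_mis_Suc_le[OF E, of j] family_card[OF fam] by simp
  qed
  \<comment> \<open>The distinct maximal sets found after the first \<open>b\<close> kinds of
    candidate.\<close>
  define seen where "seen b = {cand E b' j M | b' M. b' < b \<and> M \<in> mis E {..<j}} \<inter> ?T" for b
  have seen2: "seen 2 = ?T"
  proof
    show "?T \<subseteq> seen 2"
    proof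
      fix M assume M: "M \<in> ?T"
      hence "M \<in> mis E {..<j} \<or> M \<in> (\<lambda>I. insert j {x \<in> I. {x, j} \<notin> E}) ` mis E {..<j}"
        using mis_Suc[OF E, of j] by blast
      hence "\<exists>b' N. M = cand E b' j N \<and> b' < 2 \<and> N \<in> mis E {..<j}"
      proof
        assume "M \<in> mis E {..<j}"
        thus ?thesis
          by (intro exI[of _ 0] exI[of _ M]) (simp add: cand_def)
      next
        assume "M \<in> (\<lambda>I. insert j {x \<in> I. {x, j} \<notin> E}) ` mis E {..<j}"
        then obtain N where "N \<in> mis E {..<j}" "M = insert j {x \<in> N. {x, j} \<notin> E}"
          by blast
        thus ?thesis
          by (intro exI[of _ 1] exI[of _ N]) (simp add: cand_def)
      qed
      thus "M \<in> seen 2"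
        using M unfolding seen_def by blast
    qed
  qed (simp add: seen_def)
  have rows: "row n (nmem s aFAM) ` {..<C} = mis E {..<j}"
    using fam by (simp add: family_def)
  have inner: "runs z (For aI (Var aCNT) process_cand) t
      (\<lambda>t'. family n (nmem t' aNEW) (nmem t' aCNT' 0) (seen (Suc b)))"
    if t: "env n ?m t" "adjacency n E t" "nmem t aJ 0 = j" "nmem t aCNT 0 = C" "nmem t aFAM = nmem
        s aFAM"
      "nmem t aB 0 = b" "family n (nmem t aNEW) (nmem t aCNT' 0) (seen b)" for b t
  proof (rule runs_For[OF z nz(2), where Inv = "\<lambda>i t. family n (nmem t aNEW) (nmem t aCNT' 0)
        (seen b \<union> ((\<lambda>i. cand E b j (row n (nmem s aFAM) i)) ` {..<i} \<inter> ?T))"], goal_cases)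
    case (4 i t')
    let ?S = "seen b \<union> ((\<lambda>i. cand E b j (row n (nmem s aFAM) i)) ` {..<i} \<inter> ?T)"
    have fr: "nmem t' a = nmem t a" if "a \<notin> {aI, aV, aCAND, aOK, aHIT, aU, aR, aNEW, aCNT'}" for a
      using 4(4) that by (simp add: agree_def)
    have "?S \<subseteq> ?T"
      by (auto simp: seen_def)
    hence D: "nmem t' aCNT' 0 \<le> C + C"
      using card family_card[OF 4(2)] by metis
    have "row n (nmem s aFAM) i \<in> mis E {..<j}"
      using rows 4(1) by blast
    hence "row n (nmem s aFAM) i \<subseteq> {..<j}"
      by (simp add: mis_def)
    hence "runs z process_cand t' (\<lambda>t. family n (nmem t aNEW) (nmem t aCNT' 0)
        (?S \<union> ({cand E b j (row n (nmem t' aFAM) i)} \<inter> mis E {..<Suc j})))"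
      using t 4 D C nz j
      by (intro runs_process_cand[OF z nz(1), where m = ?m]) (simp_all add: fr env_def
          adjacency_def)
    moreover have "?S \<union> ({cand E b j (row n (nmem s aFAM) i)} \<inter> ?T) =
        seen b \<union> ((\<lambda>i. cand E b j (row n (nmem s aFAM) i)) ` {..<Suc i} \<inter> ?T)"
      by (auto simp: lessThan_Suc)
    ultimately show ?case
      by (elim runs_conseq) (simp add: fr t(5))
  next
    case (5 t')
    have "seen (Suc b) = seen b \<union> ((\<lambda>i. cand E b j (row n (nmem s aFAM) i)) ` {..<C} \<inter> ?T)"
      unfolding seen_def rows[symmetric] by (auto simp: less_Suc_eq)
    thus ?case
      using 5 by simp
  qed (use t in \<open>auto simp: agree_def\<close>)
  show ?thesis
    unfolding mis_stage_def
  proof (rule runs_Seq[OF z, OF runs_conseq[OF runs_fill_rows[OF z C(2) _ n]]])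
    show "nval (NAdd (Var aN) (NAdd (Var aCNT) (Var aCNT))) t = ?m" if "agree {aROW, aX} {} s t"
        for t
      using that n C by (simp add: agree_def)
    fix t assume env: "env n ?m t" and "agree (nwrites (fill_rows (NAdd (Var aN) (NAdd (Var aCNT)
        (Var aCNT)))))
      (rwrites (fill_rows (NAdd (Var aN) (NAdd (Var aCNT) (Var aCNT))))) s t"
    hence fr: "nmem t a = nmem s a" if "a \<notin> {aROW, aX}" for a
      using that by (simp add: agree_def)
    show "runs z (Seq (Assign aCNT' (NConst 0)) (Seq (For aB (NConst 2) (For aI (Var aCNT)
        process_cand)) copy_family)) t
        (\<lambda>t. family n (nmem t aFAM) (nmem t aCNT 0) ?T)"
    proof (rule runs_Seq[OF z], rule runs_NStore, rule runs_Seq[OF z],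
        rule runs_For[OF z z, where Inv = "\<lambda>b t. family n (nmem t aNEW) (nmem t aCNT' 0) (seen
            b)"], goal_cases)
      case (4 b t')
      have fr': "nmem t' a = nmem t a" if "a \<notin> {aB, aI, aV, aCAND, aOK, aHIT, aU, aR, aNEW,
          aCNT'}" for a
        using 4(4) that by (simp add: agree_def)
      have "runs z (For aI (Var aCNT) process_cand) t'
          (\<lambda>t'. family n (nmem t' aNEW) (nmem t' aCNT' 0) (seen (Suc b)))"
        using 4 env adj j C by (intro inner) (simp_all add: fr fr' env_def adjacency_def)
      thus ?case
        by (rule runs_conseq) simp
    next
      case (5 t')
      have fr': "nmem t' a = nmem t a" if "a \<notin> {aB, aI, aV, aCAND, aOK, aHIT, aU, aR, aNEW,
          aCNT'}" for a
        using 5(2) that by (simp add: agree_def)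
      have "nmem t' aCNT' 0 \<le> C + C"
        using card[of ?T] family_card[OF 5(1)] unfolding seen2 by simp
      thus ?case
        using 5(1) env C unfolding seen2
        by (intro runs_copy_family[OF z nz(1), where m = ?m]) (simp_all add: fr' env_def)
    qed (auto simp: seen_def family_def)
  qed
qed

theorem runs_enum_mis:
  assumes z: "2 \<le> z" and n: "nmem s aN 0 = n" "n \<le> z" and adj: "adjacency n E s" and E: "\<And>x. {x} \<notin>
      E"
    and C: "\<And>j. j \<le> n \<Longrightarrow> n + 2 * card (mis E {..<j}) \<le> z"
    and init: "nmem s aFAM = (\<lambda>_. 0)"
  shows "runs z enum_mis s (\<lambda>t. family n (nmem t aFAM) (nmem t aCNT 0) (mis E {..<n}))"
  unfolding enum_mis_def
proof (rule runs_Seq[OF z], rule runs_NStore, rule runs_For[OF z n(2), where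
      Inv = "\<lambda>j t. family n (nmem t aFAM) (nmem t aCNT 0) (mis E {..<j})"], goal_cases)
  case (4 j t)
  have fr: "nmem t a = nmem s a" if "a \<notin> {aJ, aROW, aX, aB, aI, aV, aCAND, aOK, aHIT, aU, aR,
      aNEW, aCNT', aFAM, aCNT}" for a
    using 4(4) that by (simp add: agree_def)
  have "runs z mis_stage t (\<lambda>t. family n (nmem t aFAM) (nmem t aCNT 0) (mis E {..<Suc j}))"
    using 4 n adj E C[of j] family_card[OF 4(2)]
    by (intro runs_mis_stage[OF z]) (simp_all add: fr adjacency_def)
  thus ?case
    by (rule runs_conseq) simp
qed (use n init in \<open>auto simp: agree_def family_def row_def mis_empty lessThan_Suc\<close>)

section \<open>Computing the best move\<close>

abbreviation (input) "aG \<equiv> (1 :: nat)"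
abbreviation (input) "aOUT \<equiv> (4 :: nat)"
abbreviation (input) "aF \<equiv> (20 :: nat)"
abbreviation (input) "aBEST \<equiv> (21 :: nat)"
abbreviation (input) "aL \<equiv> (22 :: nat)"
abbreviation (input) "aD \<equiv> (23 :: nat)"
abbreviation (input) "aA \<equiv> (24 :: nat)"
abbreviation (input) "aSTEP \<equiv> (25 :: nat)"
abbreviation (input) "aFOUND \<equiv> (26 :: nat)"
abbreviation (input) "aPU \<equiv> (27 :: nat)"
abbreviation (input) "aADM \<equiv> (28 :: nat)"
abbreviation (input) "aPV \<equiv> (29 :: nat)"
abbreviation (input) "aLEV \<equiv> (30 :: nat)"
abbreviation (input) "aOCC \<equiv> (31 :: nat)"
abbreviation (input) "aGAP \<equiv> (32 :: nat)"
abbreviation (input) "aITER \<equiv> (33 :: nat)"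
abbreviation (input) "aK \<equiv> (34 :: nat)"
abbreviation (input) "aTOTAL \<equiv> (35 :: nat)"
abbreviation (input) "aSQ \<equiv> (36 :: nat)"
abbreviation (input) "aKK \<equiv> (37 :: nat)"
abbreviation (input) "rW \<equiv> (0 :: nat)"
abbreviation (input) "rRES \<equiv> (1 :: nat)"
abbreviation (input) "rEX \<equiv> (2 :: nat)"
abbreviation (input) "rDEL \<equiv> (3 :: nat)"
abbreviation (input) "rCOST \<equiv> (4 :: nat)"
abbreviation (input) "rBEST \<equiv> (5 :: nat)"

abbreviation RVar :: "nat \<Rightarrow> rexp" where
  "RVar x \<equiv> RCell x (NConst 0)"

abbreviation RAssign :: "nat \<Rightarrow> rexp \<Rightarrow> com" where
  "RAssign x \<equiv> RStore x (NConst 0)"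

definition init_row :: com where
  "init_row = Seq (NStore aD (Var aU) (NConst 0)) (Seq (RStore rEX (Var aU) (ROfNat (NConst 0)))
     (For aV (Var aN)
       (Cond (NEq (NCell aF (Var aU)) (NCell aF (Var aV)))
         (RStore rRES (Ix (Var aU) (Var aV))
           (RAdd (RCell rW (Ix (Var aU) (Var aV))) (RCell rW (Ix (Var aU) (Var aV)))))
         (Seq (RStore rRES (Ix (Var aU) (Var aV)) (RCell rW (Ix (Var aU) (Var aV))))
           (RStore rEX (Var aU) (RAdd (RCell rEX (Var aU)) (RCell rW (Ix (Var aU) (Var aV)))))))))"

lemma init_row_writes [simp]: "nwrites init_row = {aD, aV}" "rwrites init_row = {rEX, rRES}"
  by (auto simp: init_row_def)

definition init_flow :: com where
  "init_flow = For aU (Var aN) init_row"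

lemma init_flow_writes [simp]: "nwrites init_flow = {aU, aD, aV}" "rwrites init_flow = {rEX, rRES}"
  by (auto simp: init_flow_def)

definition find_active :: com where
  "find_active = Seq (Assign aFOUND (NConst 0)) (For aU (Var aN)
     (Cond (BAnd (RLess (ROfNat (NConst 0)) (RCell rEX (Var aU)))
             (BAnd (NLess (NCell aD (Var aU)) (Var aN)) (NZ (NCell aFAM (Ix (Var aA) (Var aU))))))
       (Seq (Assign aFOUND (NConst 1)) (Assign aPU (Var aU))) Skip))"

lemma find_active_writes [simp]: "nwrites find_active = {aFOUND, aU, aPU}" "rwrites find_active =
    {}"
  by (auto simp: find_active_def)

definition find_admissible :: com where
  "find_admissible = Seq (Assign aADM (NConst 0)) (For aV (Var aN)
     (Cond (BAnd (RLess (ROfNat (NConst 0)) (RCell rRES (Ix (Var aPU) (Var aV))))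
             (NEq (NCell aD (Var aPU)) (NAdd (NCell aD (Var aV)) (NConst 1))))
       (Seq (Assign aADM (NConst 1)) (Assign aPV (Var aV))) Skip))"

lemma find_admissible_writes [simp]:
  "nwrites find_admissible = {aADM, aV, aPV}" "rwrites find_admissible = {}"
  by (auto simp: find_admissible_def)

definition push :: com where
  "push = Seq
     (Cond (RLess (RCell rEX (Var aPU)) (RCell rRES (Ix (Var aPU) (Var aPV))))
       (RAssign rDEL (RCell rEX (Var aPU)))
       (RAssign rDEL (RCell rRES (Ix (Var aPU) (Var aPV)))))
     (Seq (RStore rRES (Ix (Var aPU) (Var aPV)) (RSub (RCell rRES (Ix (Var aPU) (Var aPV))) (RVar
         rDEL)))
     (Seq (RStore rRES (Ix (Var aPV) (Var aPU)) (RAdd (RCell rRES (Ix (Var aPV) (Var aPU))) (RVar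
         rDEL)))
     (Seq (RStore rEX (Var aPU) (RSub (RCell rEX (Var aPU)) (RVar rDEL)))
       (RStore rEX (Var aPV) (RAdd (RCell rEX (Var aPV)) (RVar rDEL))))))"

lemma push_writes [simp]: "nwrites push = {}" "rwrites push = {rDEL, rRES, rEX}"
  by (auto simp: push_def)

definition relabel :: com where
  "relabel = NStore aD (Var aPU) (NAdd (NCell aD (Var aPU)) (NConst 1))"

lemma relabel_writes [simp]: "nwrites relabel = {aD}" "rwrites relabel = {}"
  by (auto simp: relabel_def)

definition pr_step :: com where
  "pr_step = Seq find_active (Cond (NZ (Var aFOUND))
     (Seq find_admissible (Cond (NZ (Var aADM)) push relabel)) Skip)"

lemma pr_step_writes [simp]:
  "nwrites pr_step = {aFOUND, aU, aPU, aADM, aV, aPV, aD}" "rwrites pr_step = {rDEL, rRES, rEX}"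
  by (auto simp: pr_step_def)

definition level_used :: com where
  "level_used = Seq (Assign aOCC (NConst 0))
     (For aV (Var aN) (Cond (NEq (NCell aD (Var aV)) (Var aLEV)) (Assign aOCC (NConst 1)) Skip))"

lemma level_used_writes [simp]: "nwrites level_used = {aOCC, aV}" "rwrites level_used = {}"
  by (auto simp: level_used_def)

definition find_gap :: com where
  "find_gap = For aLEV (NAdd (Var aN) (NConst 1))
     (Seq level_used (Cond (NZ (Var aOCC)) Skip (Assign aGAP (Var aLEV))))"

lemma find_gap_writes [simp]: "nwrites find_gap = {aLEV, aOCC, aV, aGAP}" "rwrites find_gap = {}"
  by (auto simp: find_gap_def)

definition apply_move :: com where
  "apply_move = For aV (Var aN) (Cond (NLess (Var aGAP) (NCell aD (Var aV)))
     (NStore aL (Var aV) (Var aA)) (NStore aL (Var aV) (NCell aF (Var aV))))"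

lemma apply_move_writes [simp]: "nwrites apply_move = {aV, aL}" "rwrites apply_move = {}"
  by (auto simp: apply_move_def)

definition best_move :: com where
  "best_move = Seq init_flow (Seq (For aSTEP (Var aK) pr_step) (Seq find_gap apply_move))"

lemma best_move_writes [simp]:
  "nwrites best_move = {aU, aD, aV, aSTEP, aFOUND, aPU, aADM, aPV, aLEV, aOCC, aGAP, aL}"
  "rwrites best_move = {rDEL, rRES, rEX}"
  by (auto simp: best_move_def)

section \<open>Correctness of the minimum cut computation\<close>

definition weights :: "nat \<Rightarrow> (nat \<Rightarrow> nat \<Rightarrow> real) \<Rightarrow> state \<Rightarrow> bool" where
  "weights n W s \<longleftrightarrow> (\<forall>u<n. \<forall>v<n. rmem s rW (u * n + v) = W u v)"

definition residual :: "nat \<Rightarrow> state \<Rightarrow> nat \<Rightarrow> nat \<Rightarrow> real" where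
  "residual n s u v = rmem s rRES (u * n + v)"

lemma runs_init_row:
  assumes z: "2 \<le> z" "n \<le> z" and env: "env n m s" and W: "weights n W s"
    and u: "nmem s aU 0 = u" "u < n" "u \<le> m"
  shows "runs z init_row s (\<lambda>t. nmem t aD = (nmem s aD)(u := 0) \<and>
    rmem t rEX = (rmem s rEX)(u := move_supply n W (nmem s aF) u) \<and>
    (\<forall>v<n. residual n t u v = move_cap W (nmem s aF) u v) \<and>
    (\<forall>i<u. \<forall>v<n. residual n t i v = residual n s i v))"
  unfolding init_row_def
proof (rule runs_Seq[OF z(1)], rule runs_NStore, rule runs_Seq[OF z(1)], rule runs_RStore,
    rule runs_For[OF z, where Inv = "\<lambda>k t. nmem t aD = (nmem s aD)(u := 0) \<and>
    rmem t rEX = (rmem s rEX)(u := (\<Sum>v<k. if nmem s aF u = nmem s aF v then 0 else W u v)) \<and>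
    (\<forall>v<k. residual n t u v = move_cap W (nmem s aF) u v) \<and>
    (\<forall>i<u. \<forall>v<n. residual n t i v = residual n s i v)"], goal_cases)
  case (4 k t)
  have fr: "nmem t a = nmem s a" if "a \<notin> {aD, aV}" for a
    using 4(4) that by (simp add: agree_def)
  have "rmem t rW = rmem s rW"
    using 4(4) by (simp add: agree_def)
  hence w: "rmem t rW (u * n + k) = W u k"
    using W u 4(1) by (simp add: weights_def)
  show ?case
    using 4(1-3) u w
    by (intro runs_Cond[OF z(1)] runs_Seq[OF z(1)] runs_RStore)
      (auto simp: fr less_Suc_eq envD[OF env] index_eq_iff residual_def move_cap_def)
next
  case (5 t)
  thus ?case
    by (simp add: move_supply_def)
qed (use env u in \<open>auto simp: agree_def env_def residual_def\<close>)

lemma runs_init_flow: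
  assumes z: "2 \<le> z" "n \<le> z" and env: "env n m s" "n \<le> m" and W: "weights n W s"
  shows "runs z init_flow s (\<lambda>t. \<forall>u<n. nmem t aD u = 0 \<and> rmem t rEX u = move_supply n W (nmem s
      aF) u \<and>
    (\<forall>v<n. residual n t u v = move_cap W (nmem s aF) u v))"
  unfolding init_flow_def
proof (rule runs_For[OF z, where Inv = "\<lambda>k t. \<forall>u<k. nmem t aD u = 0 \<and>
    rmem t rEX u = move_supply n W (nmem s aF) u \<and>
    (\<forall>v<n. residual n t u v = move_cap W (nmem s aF) u v)"], goal_cases)
  case (4 k t)
  have fr: "nmem t a = nmem s a" if "a \<notin> {aD, aV, aU}" for a
    using 4(4) that by (simp add: agree_def)
  have "rmem t rW = rmem s rW"
    using 4(4) by (simp add: agree_def)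
  hence "weights n W t"
    using W by (simp add: weights_def)
  hence "runs z init_row t (\<lambda>t'. nmem t' aD = (nmem t aD)(k := 0) \<and>
    rmem t' rEX = (rmem t rEX)(k := move_supply n W (nmem t aF) k) \<and>
    (\<forall>v<n. residual n t' k v = move_cap W (nmem t aF) k v) \<and>
    (\<forall>i<k. \<forall>v<n. residual n t' i v = residual n t i v))"
    using 4 env by (intro runs_init_row[OF z, where m = m]) (simp_all add: fr env_def)
  thus ?case
    by (rule runs_conseq) (use 4(2) in \<open>auto simp: less_Suc_eq fr residual_def\<close>)
qed (use env in \<open>auto simp: agree_def env_def\<close>)

lemma runs_find_active:
  assumes z: "2 \<le> z" "n \<le> z" and env: "env n m s" and a: "nmem s aA 0 = a" "a \<le> m"
  shows "runs z find_active s (\<lambda>t.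
    (if nmem t aFOUND 0 = 0 then \<forall>u. \<not> active n (row n (nmem s aFAM) a) (rmem s rEX) (nmem s aD) u
     else active n (row n (nmem s aFAM) a) (rmem s rEX) (nmem s aD) (nmem t aPU 0)))"
  unfolding find_active_def
proof (rule runs_Seq[OF z(1)], rule runs_NStore, rule runs_For[OF z, where Inv = "\<lambda>k t.
    (if nmem t aFOUND 0 = 0 then \<forall>u<k. \<not> active n (row n (nmem s aFAM) a) (rmem s rEX) (nmem s aD) u
     else active n (row n (nmem s aFAM) a) (rmem s rEX) (nmem s aD) (nmem t aPU 0))"], goal_cases)
  case (4 k t)
  have fr: "nmem t a = nmem s a" "rmem t = rmem s" if "a \<notin> {aFOUND, aU, aPU}" for a
    using 4(4) that by (auto simp: agree_def)
  show ?case
    using 4(1-3) a fr(2)[of 0]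
    by (intro runs_Cond[OF z(1)] runs_Seq[OF z(1)] runs_NStore runs_Skip)
      (auto simp: fr(1) less_Suc_eq envD[OF env] active_def row_def split: if_splits)
next
  case (5 t)
  thus ?case
    by (auto simp: active_def split: if_splits)
qed (use env in \<open>auto simp: agree_def env_def\<close>)

lemma runs_find_admissible:
  assumes z: "2 \<le> z" "n \<le> z" and env: "env n m s" and u: "nmem s aPU 0 = u" "u < n" "u \<le> m"
  shows "runs z find_admissible s (\<lambda>t.
    (if nmem t aADM 0 = 0 then \<forall>v. \<not> admissible n (residual n s) (nmem s aD) u v
     else admissible n (residual n s) (nmem s aD) u (nmem t aPV 0)))"
  unfolding find_admissible_def
proof (rule runs_Seq[OF z(1)], rule runs_NStore, rule runs_For[OF z, where Inv = "\<lambda>k t.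
    (if nmem t aADM 0 = 0 then \<forall>v<k. \<not> admissible n (residual n s) (nmem s aD) u v
     else admissible n (residual n s) (nmem s aD) u (nmem t aPV 0))"], goal_cases)
  case (4 k t)
  have fr: "nmem t a = nmem s a" "rmem t = rmem s" if "a \<notin> {aADM, aV, aPV}" for a
    using 4(4) that by (auto simp: agree_def)
  show ?case
    using 4(1-3) u fr(2)[of 0]
    by (intro runs_Cond[OF z(1)] runs_Seq[OF z(1)] runs_NStore runs_Skip)
      (auto simp: fr(1) less_Suc_eq envD[OF env] admissible_def residual_def split: if_splits)
next
  case (5 t)
  thus ?case
    by (auto simp: admissible_def split: if_splits)
qed (use env in \<open>auto simp: agree_def env_def\<close>)

lemma runs_push:
  assumes z: "2 \<le> z" and env: "env n m s" and u: "nmem s aPU 0 = u" "u < n" "u \<le> m"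
    and v: "nmem s aPV 0 = v" "v < n" "v \<le> m" and uv: "u \<noteq> v"
    and x: "x = min (rmem s rEX u) (residual n s u v)"
  shows "runs z push s (\<lambda>t. rmem t rEX = push_e u v x (rmem s rEX) \<and>
    (\<forall>a<n. \<forall>b<n. residual n t a b = push_r u v x (residual n s) a b))"
  unfolding push_def using u v uv x
  by (intro runs_Cond[OF z] runs_Seq[OF z] runs_RStore)
    (auto simp: envD[OF env] push_e_def push_r_def residual_def index_eq_iff min_def fun_upd_twist)

lemma residual_cong: "rmem t rRES = rmem s rRES \<Longrightarrow> residual n t = residual n s"
  by (simp add: residual_def fun_eq_iff)

lemma residual_nupdate [simp]: "residual n (nupdate a i x s) = residual n s"
  by (rule residual_cong) simp

lemma pr_potential_cong:
  assumes "\<And>u v. u < n \<Longrightarrow> v < n \<Longrightarrow> r' u v = r u v"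
  shows "pr_potential n r' e d = pr_potential n r e d"
proof -
  have "admissible n r' d u v \<longleftrightarrow> admissible n r d u v" for u v
    using assms by (auto simp: admissible_def)
  thus ?thesis
    by (simp add: pr_potential_def)
qed

text \<open>The second alternative describes idling: the loop around this step has a fixed length
  and may outlast the last active vertex.\<close>

lemma runs_pr_step:
  assumes z: "2 \<le> z" "n \<le> z" and env: "env n m s" "n \<le> m" and a: "nmem s aA 0 = a" "a \<le> m"
    and S: "S = row n (nmem s aFAM) a"
    and pf: "preflow n S e0 c (residual n s) (rmem s rEX) (nmem s aD)"
  shows "runs z pr_step s (\<lambda>t. preflow n S e0 c (residual n t) (rmem t rEX) (nmem t aD) \<and>
    (if \<exists>u. active n S (rmem s rEX) (nmem s aD) u
     then pr_potential n (residual n t) (rmem t rEX) (nmem t aD) <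
       pr_potential n (residual n s) (rmem s rEX) (nmem s aD)
     else \<forall>u. \<not> active n S (rmem t rEX) (nmem t aD) u))" (is "runs z pr_step s ?Q")
  unfolding pr_step_def
proof (rule runs_Seq[OF z(1), OF runs_conseq[OF runs_find_active[OF z env(1) a]]], fold S)
  let ?e = "rmem s rEX" and ?d = "nmem s aD" and ?r = "residual n s"
  fix t assume t: "if nmem t aFOUND 0 = 0 then \<forall>u. \<not> active n S ?e ?d u else active n S ?e ?d
      (nmem t aPU 0)"
    and ag: "agree (nwrites find_active) (rwrites find_active) s t"
  have fr: "nmem t a = nmem s a" "rmem t = rmem s" if "a \<notin> {aFOUND, aU, aPU}" for a
    using ag that by (auto simp: agree_def)
  have res: "residual n t = ?r" "rmem t rEX = ?e" "nmem t aD = ?d"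
    using fr(2)[of 0] fr(1)[of aD] by (auto intro: residual_cong)
  show "runs z (Cond (NZ (Var aFOUND)) (Seq find_admissible (Cond (NZ (Var aADM)) push relabel))
      Skip) t ?Q"
  proof (rule runs_Cond[OF z(1)])
    assume "\<not> bval (NZ (Var aFOUND)) t"
    hence "\<forall>u. \<not> active n S ?e ?d u"
      using t by simp
    thus "runs z Skip t ?Q"
      using pf by (intro runs_Skip) (simp add: res)
  next
    assume "bval (NZ (Var aFOUND)) t"
    then obtain u where u: "active n S ?e ?d u" "nmem t aPU 0 = u" "u < n"
      using t by (auto simp: active_def)
    have env': "env n m t" "u \<le> m"
      using env u(3) by (simp_all add: env_def fr)
    have ex: "\<exists>u. active n S ?e ?d u"
      using u(1) by blast
    show "runs z (Seq find_admissible (Cond (NZ (Var aADM)) push relabel)) t ?Q"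
    proof (rule runs_Seq[OF z(1), OF runs_conseq[OF runs_find_admissible[OF z env'(1) u(2,3)
        env'(2)]]], unfold res)
      fix t' assume t': "if nmem t' aADM 0 = 0 then \<forall>v. \<not> admissible n ?r ?d u v
          else admissible n ?r ?d u (nmem t' aPV 0)"
        and ag': "agree (nwrites find_admissible) (rwrites find_admissible) t t'"
      have fr': "nmem t' a = nmem t a" "rmem t' = rmem t" if "a \<notin> {aADM, aV, aPV}" for a
        using ag' that by (auto simp: agree_def)
      have res': "residual n t' = ?r" "rmem t' rEX = ?e" "nmem t' aD = ?d" "nmem t' aPU 0 = u"
        using fr'(2)[of 0] fr'(1)[of aD] fr'(1)[of aPU] fr(2)[of 0] res u(2) by (auto intro:
            residual_cong)
      have env'': "env n m t'"
        using env' by (simp add: env_def fr')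
      show "runs z (Cond (NZ (Var aADM)) push relabel) t' ?Q"
      proof (rule runs_Cond[OF z(1)])
        assume "bval (NZ (Var aADM)) t'"
        then obtain v where v: "admissible n ?r ?d u v" "nmem t' aPV 0 = v"
          using t' by simp
        have vn: "v < n" "u \<noteq> v" "v \<le> m"
          using v(1) env(2) by (auto simp: admissible_def)
        let ?x = "min (?e u) (?r u v)"
        have x: "?x = min (rmem t' rEX u) (residual n t' u v)"
          by (simp add: res')
        show "runs z push t' ?Q"
        proof (rule runs_conseq[OF runs_push[OF z(1) env'' res'(4) u(3) env'(2) v(2) vn(1,3,2)
            x]], unfold res')
          fix q assume q: "rmem q rEX = push_e u v ?x ?e \<and>
              (\<forall>a<n. \<forall>b<n. residual n q a b = push_r u v ?x ?r a b)"
            and "agree (nwrites push) (rwrites push) t' q"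
          hence d: "nmem q aD = ?d"
            using res'(3) by (simp add: agree_def)
          have "0 \<le> ?x"
            using u(1) v(1) by (simp add: active_def admissible_def)
          hence "preflow n S e0 c (push_r u v ?x ?r) (push_e u v ?x ?e) ?d"
            by (intro preflow_push[OF pf u(1) v(1)]) auto
          hence "preflow n S e0 c (residual n q) (rmem q rEX) (nmem q aD)"
            by (rule preflow_cong) (use q d in auto)
          moreover have "pr_potential n (residual n q) (rmem q rEX) (nmem q aD) =
              pr_potential n (push_r u v ?x ?r) (rmem q rEX) (nmem q aD)"
            using q by (intro pr_potential_cong) auto
          ultimately show "?Q q"
            using pr_potential_push[OF pf u(1) v(1) refl] q d ex by simp
        qed
      next
        assume "\<not> bval (NZ (Var aADM)) t'"
        hence no: "\<not> admissible n ?r ?d u v" for v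
          using t' by simp
        show "runs z relabel t' ?Q"
          unfolding relabel_def
          using preflow_relabel[OF pf u(1) no] pr_potential_relabel[OF pf u(1)] ex res'
          by (intro runs_NStore) simp
      qed
    qed
  qed
qed

lemma runs_level_used:
  assumes z: "2 \<le> z" "n \<le> z" and n: "nmem s aN 0 = n" and h: "nmem s aLEV 0 = h"
  shows "runs z level_used s (\<lambda>t. nmem t aOCC 0 \<noteq> 0 \<longleftrightarrow> (\<exists>v<n. nmem s aD v = h))"
  unfolding level_used_def
proof (rule runs_Seq[OF z(1)], rule runs_NStore,
    rule runs_For[OF z, where Inv = "\<lambda>k t. nmem t aOCC 0 \<noteq> 0 \<longleftrightarrow> (\<exists>v<k. nmem s aD v = h)"],
        goal_cases)
  case (4 k t)
  have fr: "nmem t a = nmem s a" if "a \<notin> {aOCC, aV}" for a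
    using 4(4) that by (simp add: agree_def)
  show ?case
    using 4(1-3) h by (intro runs_Cond[OF z(1)] runs_NStore runs_Skip) (auto simp: fr less_Suc_eq)
qed (use n in \<open>auto simp: agree_def\<close>)

lemma runs_find_gap:
  assumes z: "2 \<le> z" "n + 1 \<le> z" and n: "nmem s aN 0 = n"
  shows "runs z find_gap s (\<lambda>t. nmem t aGAP 0 \<le> n \<and> (\<forall>v<n. nmem s aD v \<noteq> nmem t aGAP 0))"
  unfolding find_gap_def
proof (rule runs_For[OF z, where Inv = "\<lambda>k t. (\<exists>h<k. \<forall>v<n. nmem s aD v \<noteq> h) \<longrightarrow>
    nmem t aGAP 0 \<le> n \<and> (\<forall>v<n. nmem s aD v \<noteq> nmem t aGAP 0)"], goal_cases)
  case (4 k t)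
  have fr: "nmem t a = nmem s a" if "a \<notin> {aLEV, aOCC, aV, aGAP}" for a
    using 4(4) that by (simp add: agree_def)
  have "runs z level_used t (\<lambda>t'. nmem t' aOCC 0 \<noteq> 0 \<longleftrightarrow> (\<exists>v<n. nmem t aD v = k))"
    using z n 4 by (intro runs_level_used) (auto simp: fr)
  thus ?case
  proof (rule runs_Seq[OF z(1), OF runs_conseq], goal_cases)
    case (1 t')
    have "nmem t' a = nmem t a" if "a \<notin> {aOCC, aV}" for a
      using 1(2) that by (simp add: agree_def)
    thus ?case
      using 1(1) 4(1-3)
      by (intro runs_Cond[OF z(1)] runs_NStore runs_Skip) (auto simp: fr less_Suc_eq)
  qed
next
  case (5 t)
  thus ?case
    using gap_exists[of n "nmem s aD"] by (auto simp: less_Suc_eq_le)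
qed (use n in \<open>auto simp: agree_def\<close>)

lemma runs_apply_move:
  assumes z: "2 \<le> z" "n \<le> z" and n: "nmem s aN 0 = n"
  shows "runs z apply_move s (\<lambda>t. \<forall>v<n. nmem t aL v =
    (if nmem s aGAP 0 < nmem s aD v then nmem s aA 0 else nmem s aF v))"
  unfolding apply_move_def
proof (rule runs_For[OF z, where Inv = "\<lambda>k t. \<forall>v<k. nmem t aL v =
    (if nmem s aGAP 0 < nmem s aD v then nmem s aA 0 else nmem s aF v)"], goal_cases)
  case (4 k t)
  have fr: "nmem t a = nmem s a" if "a \<notin> {aV, aL}" for a
    using 4(4) that by (simp add: agree_def)
  show ?case
    using 4(1-3) by (intro runs_Cond[OF z(1)] runs_NStore) (auto simp: fr less_Suc_eq)
qed (use n in \<open>auto simp: agree_def\<close>)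

lemma runs_best_move:
  assumes z: "2 \<le> z" "n + 1 \<le> z" and env: "env n m s" "n \<le> m" and a: "nmem s aA 0 = a" "a \<le> m"
    and S: "S = row n (nmem s aFAM) a" and K: "nmem s aK 0 = (n + 2) ^ 4" "(n + 2) ^ 4 \<le> z"
    and W: "weights n W s" "\<And>u v. 0 \<le> W u v"
  shows "runs z best_move s (\<lambda>t. \<exists>X\<subseteq>{..<n}. X \<subseteq> S \<and>
    (\<forall>v<n. nmem t aL v = (if v \<in> X then a else nmem s aF v)) \<and>
    (\<forall>Y\<subseteq>{..<n}. Y \<subseteq> S \<longrightarrow> move_cost n W (nmem s aF) X \<le> move_cost n W (nmem s aF) Y))"
    (is "runs z best_move s ?Q")
proof -
  let ?f = "nmem s aF"
  let ?e0 = "move_supply n W ?f" and ?c = "move_cap W ?f" and ?K = "(n + 2) ^ 4"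
  have nz: "n \<le> z"
    using z by simp
  show ?thesis
    unfolding best_move_def
  proof (rule runs_Seq[OF z(1), OF runs_conseq[OF runs_init_flow[OF z(1) nz env W(1)]]])
    fix t assume t: "\<forall>u<n. nmem t aD u = 0 \<and> rmem t rEX u = ?e0 u \<and> (\<forall>v<n. residual n t u v = ?c u
        v)"
      and ag: "agree (nwrites init_flow) (rwrites init_flow) s t"
    have fr: "nmem t a = nmem s a" if "a \<notin> {aU, aD, aV}" for a
      using ag that by (simp add: agree_def)
    have "preflow n S ?e0 ?c ?c ?e0 (\<lambda>_. 0)"
      using W(2) by (intro preflow_init) (auto simp: move_supply_def move_cap_def intro!:
          sum_nonneg)
    hence pf: "preflow n S ?e0 ?c (residual n t) (rmem t rEX) (nmem t aD)"
      by (rule preflow_cong) (use t in auto)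
    have pot: "pr_potential n (residual n t) (rmem t rEX) (nmem t aD) < ?K"
    proof -
      have "{(u, v). admissible n (residual n t) (nmem t aD) u v} = {(u, v). admissible n
          (residual n t) (\<lambda>_. 0) u v}"
        using t by (auto simp: admissible_def)
      moreover have "(\<Sum>v<n. n - nmem t aD v) = (\<Sum>v<n. n - (\<lambda>_. 0) v)"
        using t by (intro sum.cong) auto
      moreover have "(\<Sum>v<n. if 0 < rmem t rEX v then nmem t aD v else 0) =
          (\<Sum>v<n. if 0 < rmem t rEX v then (\<lambda>_. 0) v else 0)"
        using t by (intro sum.cong) auto
      ultimately have "pr_potential n (residual n t) (rmem t rEX) (nmem t aD) =
          pr_potential n (residual n t) (rmem t rEX) (\<lambda>_. 0)"
        unfolding pr_potential_def by simp
      thus ?thesis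
        using pr_potential_init[of n "residual n t" "rmem t rEX"] by simp
    qed
    show "runs z (Seq (For aSTEP (Var aK) pr_step) (Seq find_gap apply_move)) t ?Q"
    \<comment> \<open>Each step lowers the potential until no vertex is active. After
      \<open>?K\<close> steps the first alternative is impossible, since the potential is a natural
      number.\<close>
    proof (rule runs_Seq[OF z(1)], rule runs_For[OF z(1) K(2), where
          Inv = "\<lambda>k t. preflow n S ?e0 ?c (residual n t) (rmem t rEX) (nmem t aD) \<and>
            (pr_potential n (residual n t) (rmem t rEX) (nmem t aD) + k < ?K \<or>
             (\<forall>u. \<not> active n S (rmem t rEX) (nmem t aD) u))"], goal_cases)
      case 3
      show ?case
        using pf pot by simp
    next
      case (4 k t1)
      have fr1: "nmem t1 a = nmem t a" if "a \<notin> {aSTEP, aFOUND, aU, aPU, aADM, aV, aPV, aD}" for a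
        using 4(4) that by (simp add: agree_def)
      have "runs z pr_step t1 (\<lambda>t2. preflow n S ?e0 ?c (residual n t2) (rmem t2 rEX) (nmem t2 aD) \<and>
        (if \<exists>u. active n S (rmem t1 rEX) (nmem t1 aD) u
         then pr_potential n (residual n t2) (rmem t2 rEX) (nmem t2 aD) <
           pr_potential n (residual n t1) (rmem t1 rEX) (nmem t1 aD)
         else \<forall>u. \<not> active n S (rmem t2 rEX) (nmem t2 aD) u))"
        using 4(2) env a S by (intro runs_pr_step[OF z(1) nz, where m = m and a = a])
          (simp_all add: fr fr1 env_def)
      thus ?case
        by (rule runs_conseq) (use 4(2) in \<open>auto split: if_splits\<close>)
    next
      case (5 t1)
      have fr1: "nmem t1 a = nmem t a" if "a \<notin> {aSTEP, aFOUND, aU, aPU, aADM, aV, aPV, aD}" for a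
        using 5(2) that by (simp add: agree_def)
      have pf1: "preflow n S ?e0 ?c (residual n t1) (rmem t1 rEX) (nmem t1 aD)"
        and inactive: "\<And>u. \<not> active n S (rmem t1 rEX) (nmem t1 aD) u"
        using 5(1) by auto
      have n1: "nmem t1 aN 0 = n"
        using env by (simp add: env_def fr1 fr)
      show ?case
      proof (rule runs_Seq[OF z(1), OF runs_conseq[OF runs_find_gap[OF z n1]]])
        fix t2 assume gap: "nmem t2 aGAP 0 \<le> n \<and> (\<forall>v<n. nmem t1 aD v \<noteq> nmem t2 aGAP 0)"
          and ag2: "agree (nwrites find_gap) (rwrites find_gap) t1 t2"
        have fr2: "nmem t2 a = nmem t1 a" if "a \<notin> {aLEV, aOCC, aV, aGAP}" for a
          using ag2 that by (simp add: agree_def)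
        have n2: "nmem t2 aN 0 = n"
          using n1 by (simp add: fr2)
        \<comment> \<open>The vertices above the gap form the source side of a minimum cut. Sinks
          have label 0 and thus never belong to it.\<close>
        let ?X = "{v. v < n \<and> nmem t2 aGAP 0 < nmem t1 aD v}"
        have "?X \<subseteq> S"
          using preflowD(6)[OF pf1] by fastforce
        moreover have "move_cost n W ?f ?X \<le> move_cost n W ?f Y" if "Y \<subseteq> {..<n}" "Y \<subseteq> S" for Y
          unfolding move_cost_def using gap that by (intro gap_cut_minimal[OF pf1 inactive]) auto
        ultimately show "runs z apply_move t2 ?Q"
          by (intro runs_conseq[OF runs_apply_move[OF z(1) nz n2]] exI[of _ ?X])
            (use a in \<open>auto simp: fr2 fr1 fr\<close>)
      qed
    qed (use K in \<open>auto simp: agree_def fr\<close>)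
  qed
qed

section \<open>The algorithm\<close>

definition cost_row :: com where
  "cost_row = For aV (Var aN) (Cond (NEq (NCell aL (Var aU)) (NCell aL (Var aV))) Skip
     (RAssign rCOST (RAdd (RVar rCOST) (RCell rW (Ix (Var aU) (Var aV))))))"

lemma cost_row_writes [simp]: "nwrites cost_row = {aV}" "rwrites cost_row = {rCOST}"
  by (auto simp: cost_row_def)

definition cost_new :: com where
  "cost_new = Seq (RAssign rCOST (ROfNat (NConst 0))) (For aU (Var aN) cost_row)"

lemma cost_new_writes [simp]: "nwrites cost_new = {aV, aU}" "rwrites cost_new = {rCOST}"
  by (auto simp: cost_new_def)

definition copy_vec :: "nat \<Rightarrow> nat \<Rightarrow> com" where
  "copy_vec a b = For aV (Var aN) (NStore b (Var aV) (NCell a (Var aV)))"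

lemma copy_vec_writes [simp]: "nwrites (copy_vec a b) = {aV, b}" "rwrites (copy_vec a b) = {}"
  by (auto simp: copy_vec_def)

definition save_best :: com where
  "save_best = Seq (RAssign rBEST (RVar rCOST)) (copy_vec aL aBEST)"

lemma save_best_writes [simp]: "nwrites save_best = {aV, aBEST}" "rwrites save_best = {rBEST}"
  by (auto simp: save_best_def)

text \<open>The true cost of the candidate is recomputed, because the cut value is only an upper
  bound for it.\<close>

definition try_label :: com where
  "try_label = Seq best_move (Seq cost_new (Cond (RLess (RVar rCOST) (RVar rBEST)) save_best Skip))"

lemma try_label_writes [simp]:
  "nwrites try_label = {aU, aD, aV, aSTEP, aFOUND, aPU, aADM, aPV, aLEV, aOCC, aGAP, aL, aBEST}"
  "rwrites try_label = {rDEL, rRES, rEX, rCOST, rBEST}"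
  by (auto simp: try_label_def)

text \<open>\<open>aBEST\<close> starts as the current labelling, so a legal labelling of known cost
  is available for the first comparison.\<close>

definition improve :: com where
  "improve = Seq (copy_vec aF aL) (Seq cost_new (Seq save_best
     (Seq (For aA (Var aCNT) try_label) (copy_vec aBEST aF))))"

lemma improve_writes [simp]:
  "nwrites improve =
    {aA, aU, aD, aV, aSTEP, aFOUND, aPU, aADM, aPV, aLEV, aOCC, aGAP, aL, aBEST, aF}"
  "rwrites improve = {rDEL, rRES, rEX, rCOST, rBEST}"
  by (auto simp: improve_def)

section \<open>Correctness of the local search\<close>

lemma runs_copy_vec:
  assumes z: "2 \<le> z" "n \<le> z" and n: "nmem s aN 0 = n" and ab: "a \<noteq> b" "a \<noteq> aV" "b \<noteq> aV" "b \<noteq> aN"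
  shows "runs z (copy_vec a b) s (\<lambda>t. \<forall>v<n. nmem t b v = nmem s a v)"
  unfolding copy_vec_def
proof (rule runs_For[OF z, where Inv = "\<lambda>k t. \<forall>v<k. nmem t b v = nmem s a v"], goal_cases)
  case (4 k t)
  have "nmem t a = nmem s a"
    using 4(4) ab by (simp add: agree_def)
  thus ?case
    using 4(1-3) ab by (intro runs_NStore) (auto simp: less_Suc_eq)
qed (use n ab in \<open>auto simp: agree_def\<close>)

lemma label_cost_cong: "(\<And>v. v < n \<Longrightarrow> f v = g v) \<Longrightarrow> label_cost n W f = label_cost n W g"
  unfolding label_cost_def by (intro sum.cong refl) auto

lemma labeling_cong: "(\<And>v. v < n \<Longrightarrow> f v = g v) \<Longrightarrow> labeling n L lab f \<longleftrightarrow> labeling n L lab g"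
  by (simp add: labeling_def)

lemma runs_cost_row:
  assumes z: "2 \<le> z" "n \<le> z" and env: "env n m s" and W: "weights n W s"
    and u: "nmem s aU 0 = u" "u < n" "u \<le> m"
  shows "runs z cost_row s (\<lambda>t. rmem t rCOST 0 = rmem s rCOST 0 +
    (\<Sum>v<n. if nmem s aL u = nmem s aL v then 0 else W u v))"
  unfolding cost_row_def
proof (rule runs_For[OF z, where Inv = "\<lambda>k t. rmem t rCOST 0 = rmem s rCOST 0 +
    (\<Sum>v<k. if nmem s aL u = nmem s aL v then 0 else W u v)"], goal_cases)
  case (4 k t)
  have fr: "nmem t a = nmem s a" if "a \<noteq> aV" for a
    using 4(4) that by (simp add: agree_def)
  have "rmem t rW = rmem s rW"
    using 4(4) by (simp add: agree_def)
  hence w: "rmem t rW (u * n + k) = W u k"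
    using W u 4(1) by (simp add: weights_def)
  show ?case
    using 4(1-3) u w by (intro runs_Cond[OF z(1)] runs_RStore runs_Skip) (auto simp: fr envD[OF
        env])
qed (use env in \<open>auto simp: agree_def env_def\<close>)

lemma runs_cost_new:
  assumes z: "2 \<le> z" "n \<le> z" and env: "env n m s" "n \<le> m" and W: "weights n W s"
  shows "runs z cost_new s (\<lambda>t. rmem t rCOST 0 = label_cost n W (nmem s aL))"
  unfolding cost_new_def
proof (rule runs_Seq[OF z(1)], rule runs_RStore, rule runs_For[OF z, where Inv = "\<lambda>k t. rmem t
    rCOST 0 =
    (\<Sum>u<k. \<Sum>v<n. if nmem s aL u = nmem s aL v then 0 else W u v)"], goal_cases)
  case (4 k t)
  have fr: "nmem t a = nmem s a" if "a \<notin> {aV, aU}" for a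
    using 4(4) that by (simp add: agree_def)
  have "rmem t rW = rmem s rW"
    using 4(4) by (simp add: agree_def)
  hence "runs z cost_row t (\<lambda>t'. rmem t' rCOST 0 = rmem t rCOST 0 +
    (\<Sum>v<n. if nmem t aL k = nmem t aL v then 0 else W k v))"
    using 4 env W by (intro runs_cost_row[OF z, where m = m]) (simp_all add: fr env_def weights_def)
  thus ?case
    by (rule runs_conseq) (use 4(2) in \<open>simp add: fr\<close>)
next
  case (5 t)
  thus ?case
    by (simp add: label_cost_def)
qed (use env in \<open>auto simp: agree_def env_def\<close>)

lemma runs_save_best:
  assumes z: "2 \<le> z" "n \<le> z" and n: "nmem s aN 0 = n"
  shows "runs z save_best s (\<lambda>t. (\<forall>v<n. nmem t aBEST v = nmem s aL v) \<and> rmem t rBEST 0 = rmem s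
      rCOST 0)"
  unfolding save_best_def
  by (rule runs_Seq[OF z(1)], rule runs_RStore, rule runs_conseq[OF runs_copy_vec[OF z]])
    (use n in \<open>auto simp: agree_def\<close>)

lemma runs_try_label:
  assumes z: "2 \<le> z" "n + 1 \<le> z" and env: "env n m s" "n \<le> m" and a: "nmem s aA 0 = a" "a \<le> m" "a
      < L"
    and lab: "lab = row n (nmem s aFAM)" and K: "nmem s aK 0 = (n + 2) ^ 4" "(n + 2) ^ 4 \<le> z"
    and W: "weights n W s" "\<And>u v. 0 \<le> W u v" "\<And>u v. W u v = W v u"
    and f: "labeling n L lab (nmem s aF)"
    and best: "labeling n L lab (nmem s aBEST)" "rmem s rBEST 0 = label_cost n W (nmem s aBEST)"
  shows "runs z try_label s (\<lambda>t. labeling n L lab (nmem t aBEST) \<and>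
    rmem t rBEST 0 = label_cost n W (nmem t aBEST) \<and> rmem t rBEST 0 \<le> rmem s rBEST 0 \<and>
    (\<forall>Y\<subseteq>{..<n}. Y \<subseteq> lab a \<longrightarrow> rmem t rBEST 0 \<le> move_cost n W (nmem s aF) Y))"
    (is "runs z try_label s ?Q")
proof -
  have nz: "n \<le> z"
    using z by simp
  show ?thesis
    unfolding try_label_def
  proof (rule runs_Seq[OF z(1), OF runs_conseq[OF runs_best_move[OF z env a(1,2) refl K W(1,2)]]])
    fix t assume t: "\<exists>X\<subseteq>{..<n}. X \<subseteq> row n (nmem s aFAM) a \<and>
        (\<forall>v<n. nmem t aL v = (if v \<in> X then a else nmem s aF v)) \<and>
        (\<forall>Y\<subseteq>{..<n}. Y \<subseteq> row n (nmem s aFAM) a \<longrightarrow> move_cost n W (nmem s aF) X \<le> move_cost n W (nmem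
            s aF) Y)"
      and ag: "agree (nwrites best_move) (rwrites best_move) s t"
    obtain X where X: "X \<subseteq> {..<n}" "X \<subseteq> lab a" "\<And>v. v < n \<Longrightarrow> nmem t aL v = (if v \<in> X then a else
        nmem s aF v)"
      "\<And>Y. Y \<subseteq> {..<n} \<Longrightarrow> Y \<subseteq> lab a \<Longrightarrow> move_cost n W (nmem s aF) X \<le> move_cost n W (nmem s aF) Y"
      using t unfolding lab by blast
    have fr: "nmem t a = nmem s a" if "a \<notin> {aU, aD, aV, aSTEP, aFOUND, aPU, aADM, aPV, aLEV, aOCC,
        aGAP, aL}" for a
      using ag that by (simp add: agree_def)
    have frr: "rmem t a = rmem s a" if "a \<notin> {rDEL, rRES, rEX}" for a
      using ag that by (simp add: agree_def)
    have "label_cost n W (nmem t aL) = label_cost n W (\<lambda>v. if v \<in> X then a else nmem s aF v)"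
      by (rule label_cost_cong) (rule X(3))
    also have "\<dots> \<le> move_cost n W (nmem s aF) X"
      by (rule label_cost_move_le[OF W(3,2) X(1)])
    finally have cost: "label_cost n W (nmem t aL) \<le> move_cost n W (nmem s aF) Y"
      if "Y \<subseteq> {..<n}" "Y \<subseteq> lab a" for Y
      using X(4)[OF that] by linarith
    have labL: "labeling n L lab (nmem t aL)"
      using f X(2,3) a(3) by (auto simp: labeling_def)
    have env1: "env n m t" "weights n W t"
      using env W(1) by (simp_all add: env_def weights_def fr frr)
    show "runs z (Seq cost_new (Cond (RLess (RVar rCOST) (RVar rBEST)) save_best Skip)) t ?Q"
    proof (rule runs_Seq[OF z(1), OF runs_conseq[OF runs_cost_new[OF z(1) nz env1(1) env(2)
        env1(2)]]])
      fix t1 assume t1: "rmem t1 rCOST 0 = label_cost n W (nmem t aL)"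
        and ag1: "agree (nwrites cost_new) (rwrites cost_new) t t1"
      have fr1: "nmem t1 a = nmem t a" if "a \<notin> {aU, aV}" for a
        using ag1 that by (simp add: agree_def)
      have frr1: "rmem t1 a = rmem t a" if "a \<noteq> rCOST" for a
        using ag1 that by (simp add: agree_def)
      have n1: "nmem t1 aN 0 = n"
        using env by (simp add: env_def fr fr1)
      show "runs z (Cond (RLess (RVar rCOST) (RVar rBEST)) save_best Skip) t1 ?Q"
      proof (rule runs_Cond[OF z(1)])
        assume less: "bval (RLess (RVar rCOST) (RVar rBEST)) t1"
        show "runs z save_best t1 ?Q"
        proof (rule runs_conseq[OF runs_save_best[OF z(1) nz n1]], goal_cases)
          case (1 t2)
          have "label_cost n W (nmem t2 aBEST) = label_cost n W (nmem t aL)"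
            using 1(1) by (intro label_cost_cong) (simp add: fr1)
          moreover have "labeling n L lab (nmem t2 aBEST)"
            using labL 1(1) labeling_cong[of n "nmem t2 aBEST" "nmem t aL"] by (simp add: fr1)
          ultimately show ?case
            using 1(1) t1 cost less by (simp add: frr frr1)
        qed
      next
        assume "\<not> bval (RLess (RVar rCOST) (RVar rBEST)) t1"
        hence "rmem s rBEST 0 \<le> label_cost n W (nmem t aL)"
          using t1 by (simp add: frr frr1)
        thus "runs z Skip t1 ?Q"
          using best cost by (intro runs_Skip) (auto simp: fr fr1 frr frr1 intro: order.trans)
      qed
    qed
  qed
qed

lemma runs_improve:
  assumes z: "2 \<le> z" "n + 1 \<le> z" and env: "env n m s" "n \<le> m"
    and L: "nmem s aCNT 0 = L" "L \<le> m" "L \<le> z"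
    and lab: "lab = row n (nmem s aFAM)" and K: "nmem s aK 0 = (n + 2) ^ 4" "(n + 2) ^ 4 \<le> z"
    and W: "weights n W s" "\<And>u v. 0 \<le> W u v" "\<And>u v. W u v = W v u"
    and f: "labeling n L lab (nmem s aF)"
  shows "runs z improve s (\<lambda>t. labeling n L lab (nmem t aF) \<and> improves n L W lab (nmem s aF) (nmem
      t aF))"
    (is "runs z improve s ?Q")
proof -
  have nz: "n \<le> z"
    using z by simp
  have n: "nmem s aN 0 = n"
    using env by (simp add: env_def)
  show ?thesis
    unfolding improve_def
  proof (rule runs_Seq[OF z(1), OF runs_conseq[OF runs_copy_vec[OF z(1) nz n]]])
    fix t assume t: "\<forall>v<n. nmem t aL v = nmem s aF v"
      and ag: "agree (nwrites (copy_vec aF aL)) (rwrites (copy_vec aF aL)) s t"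
    have fr: "nmem t a = nmem s a" "rmem t = rmem s" if "a \<notin> {aV, aL}" for a
      using ag that by (auto simp: agree_def)
    have env1: "env n m t" "weights n W t"
      using env W(1) fr(2)[of 0] by (simp_all add: env_def weights_def fr(1))
    show "runs z (Seq cost_new (Seq save_best (Seq (For aA (Var aCNT) try_label) (copy_vec aBEST
        aF)))) t ?Q"
    proof (rule runs_Seq[OF z(1), OF runs_conseq[OF runs_cost_new[OF z(1) nz env1(1) env(2)
        env1(2)]]])
      fix t1 assume t1: "rmem t1 rCOST 0 = label_cost n W (nmem t aL)"
        and ag1: "agree (nwrites cost_new) (rwrites cost_new) t t1"
      have fr1: "nmem t1 a = nmem t a" if "a \<notin> {aU, aV}" for a
        using ag1 that by (simp add: agree_def)
      have frr1: "rmem t1 a = rmem t a" if "a \<noteq> rCOST" for a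
        using ag1 that by (simp add: agree_def)
      have n1: "nmem t1 aN 0 = n"
        using n by (simp add: fr fr1)
      show "runs z (Seq save_best (Seq (For aA (Var aCNT) try_label) (copy_vec aBEST aF))) t1 ?Q"
      proof (rule runs_Seq[OF z(1), OF runs_conseq[OF runs_save_best[OF z(1) nz n1]]])
        fix t2 assume t2: "(\<forall>v<n. nmem t2 aBEST v = nmem t1 aL v) \<and> rmem t2 rBEST 0 = rmem t1
            rCOST 0"
          and ag2: "agree (nwrites save_best) (rwrites save_best) t1 t2"
        have fr2: "nmem t2 a = nmem t1 a" if "a \<notin> {aV, aBEST}" for a
          using ag2 that by (simp add: agree_def)
        have frr2: "rmem t2 a = rmem t1 a" if "a \<noteq> rBEST" for a
          using ag2 that by (simp add: agree_def)
        have W2: "rmem t2 rW = rmem s rW"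
          using fr(2)[of 0] by (simp add: frr2 frr1)
        have best: "labeling n L lab (nmem t2 aBEST)" "rmem t2 rBEST 0 = label_cost n W (nmem t2
            aBEST)"
        proof -
          have eq: "nmem t2 aBEST v = nmem s aF v" "nmem t aL v = nmem s aF v" if "v < n" for v
            using t t2 that by (simp_all add: fr1)
          show "labeling n L lab (nmem t2 aBEST)"
            using f labeling_cong[of n "nmem t2 aBEST" "nmem s aF"] eq(1) by blast
          show "rmem t2 rBEST 0 = label_cost n W (nmem t2 aBEST)"
            using t1 t2 eq label_cost_cong[of n "nmem t2 aBEST" "nmem t aL"] by simp
        qed
        show "runs z (Seq (For aA (Var aCNT) try_label) (copy_vec aBEST aF)) t2 ?Q"
        proof (rule runs_Seq[OF z(1)], rule runs_For[OF z(1) L(3), where Inv = "\<lambda>a t.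
              labeling n L lab (nmem t aBEST) \<and> rmem t rBEST 0 = label_cost n W (nmem t aBEST) \<and>
              (\<forall>b<a. \<forall>Y\<subseteq>{..<n}. Y \<subseteq> lab b \<longrightarrow> rmem t rBEST 0 \<le> move_cost n W (nmem s aF) Y)"],
            goal_cases)
          case (4 a t3)
          have fr3: "nmem t3 a = nmem t2 a"
            if "a \<notin> {aA, aU, aD, aV, aSTEP, aFOUND, aPU, aADM, aPV, aLEV, aOCC, aGAP, aL, aBEST}"
                for a
            using 4(4) that by (simp add: agree_def)
          have "rmem t3 rW = rmem s rW"
            using 4(4) W2 by (simp add: agree_def)
          hence "weights n W t3"
            using W(1) by (simp add: weights_def)
          hence "runs z try_label t3 (\<lambda>t. labeling n L lab (nmem t aBEST) \<and>
            rmem t rBEST 0 = label_cost n W (nmem t aBEST) \<and> rmem t rBEST 0 \<le> rmem t3 rBEST 0 \<and>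
            (\<forall>Y\<subseteq>{..<n}. Y \<subseteq> lab a \<longrightarrow> rmem t rBEST 0 \<le> move_cost n W (nmem t3 aF) Y))"
            using 4 env L lab K W(2,3) f
            by (intro runs_try_label[OF z, where m = m]) (simp_all add: fr fr1 fr2 fr3 env_def)
          thus ?case
          proof (rule runs_conseq, goal_cases)
            case (1 q)
            have le: "rmem q rBEST 0 \<le> rmem t3 rBEST 0"
              using 1(1) by blast
            have "rmem q rBEST 0 \<le> move_cost n W (nmem s aF) Y"
              if "b < Suc a" "Y \<subseteq> {..<n}" "Y \<subseteq> lab b" for b Y
            proof (cases "b = a")
              case True
              have "nmem t3 aF = nmem s aF"
                by (simp add: fr fr1 fr2 fr3)
              thus ?thesis
                using 1(1) that True by metis
            next
              case False
              hence "b < a"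
                using that(1) by simp
              hence "rmem t3 rBEST 0 \<le> move_cost n W (nmem s aF) Y"
                using 4(2) that(2,3) by blast
              thus ?thesis
                using le by linarith
            qed
            thus ?case
              using 1(1) by simp
          qed
        next
          case (5 t3)
          have fr3: "nmem t3 a = nmem t2 a"
            if "a \<notin> {aA, aU, aD, aV, aSTEP, aFOUND, aPU, aADM, aPV, aLEV, aOCC, aGAP, aL, aBEST}"
                for a
            using 5(2) that by (simp add: agree_def)
          have n3: "nmem t3 aN 0 = n"
            using n by (simp add: fr fr1 fr2 fr3)
          show ?case
          proof (rule runs_conseq[OF runs_copy_vec[OF z(1) nz n3]])
            fix q :: state assume q: "\<forall>v<n. nmem q aF v = nmem t3 aBEST v"
            have "labeling n L lab (nmem q aF)"
              using 5(1) labeling_cong[of n "nmem q aF" "nmem t3 aBEST"] q by blast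
            moreover have "label_cost n W (nmem q aF) = rmem t3 rBEST 0"
              using 5(1) label_cost_cong[of n "nmem q aF" "nmem t3 aBEST"] q by simp
            ultimately show "?Q q"
              using 5(1) unfolding improves_def by metis
          qed auto
        qed (use best L in \<open>auto simp: agree_def fr fr1 fr2\<close>)
      qed
    qed
  qed auto
qed

definition label_vertex :: com where
  "label_vertex = For aI (Var aCNT)
     (Cond (NZ (NCell aFAM (Ix (Var aI) (Var aV)))) (NStore aF (Var aV) (Var aI)) Skip)"

lemma label_vertex_writes [simp]: "nwrites label_vertex = {aI, aF}" "rwrites label_vertex = {}"
  by (auto simp: label_vertex_def)

definition init_labels :: com where
  "init_labels = For aV (Var aN) label_vertex"

lemma init_labels_writes [simp]: "nwrites init_labels = {aV, aI, aF}" "rwrites init_labels = {}"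
  by (auto simp: init_labels_def)

definition write_row :: com where
  "write_row = For aV (Var aN)
     (Cond (BAnd (NZ (NCell aG (Ix (Var aU) (Var aV)))) (BNot (NEq (NCell aF (Var aU)) (NCell aF
         (Var aV)))))
       (NStore aOUT (Ix (Var aU) (Var aV)) (NConst 1))
       (NStore aOUT (Ix (Var aU) (Var aV)) (NConst 0)))"

lemma write_row_writes [simp]: "nwrites write_row = {aV, aOUT}" "rwrites write_row = {}"
  by (auto simp: write_row_def)

definition write_output :: com where
  "write_output = For aU (Var aN) write_row"

lemma write_output_writes [simp]: "nwrites write_output = {aU, aV, aOUT}" "rwrites write_output =
    {}"
  by (auto simp: write_output_def)

text \<open>\<open>(n + 2) ^ 4\<close> steps exceed the initial preflow potential, and
  \<open>(n + 2) ^ 8\<close> moves per label are at least the \<open>16 * (n * n + 1)^2\<close>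
  required by the halving argument. Products are formed by repeated addition.\<close>

definition set_bounds :: com where
  "set_bounds = Seq (mult_into aSQ (NAdd (Var aN) (NConst 2)) (NAdd (Var aN) (NConst 2)))
     (Seq (mult_into aK (Var aSQ) (Var aSQ))
     (Seq (mult_into aKK (Var aK) (Var aK))
       (mult_into aTOTAL (Var aKK) (Var aCNT))))"

lemma set_bounds_writes [simp]: "nwrites set_bounds = {aX, aSQ, aK, aKK, aTOTAL}" "rwrites
    set_bounds = {}"
  by (auto simp: set_bounds_def)

definition algorithm :: com where
  "algorithm = Seq enum_mis (Seq (fill_rows (NAdd (Var aN) (Var aCNT))) (Seq init_labels
     (Seq set_bounds (Seq (For aITER (Var aTOTAL) improve) write_output))))"

lemma runs_label_vertex:
  assumes z: "2 \<le> z" and env: "env n m s" and L: "nmem s aCNT 0 = L" "L \<le> m" "L \<le> z"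
    and v: "nmem s aV 0 = v" "v < n"
  shows "runs z label_vertex s (\<lambda>t. (\<forall>u. u \<noteq> v \<longrightarrow> nmem t aF u = nmem s aF u) \<and>
    ((\<exists>i<L. v \<in> row n (nmem s aFAM) i) \<longrightarrow> nmem t aF v < L \<and> v \<in> row n (nmem s aFAM) (nmem t aF v)))"
  unfolding label_vertex_def
proof (rule runs_For[OF z L(3), where Inv = "\<lambda>k t. (\<forall>u. u \<noteq> v \<longrightarrow> nmem t aF u = nmem s aF u) \<and>
    ((\<exists>i<k. v \<in> row n (nmem s aFAM) i) \<longrightarrow> nmem t aF v < L \<and> v \<in> row n (nmem s aFAM) (nmem t aF
        v))"], goal_cases)
  case (4 k t)
  have fr: "nmem t a = nmem s a" if "a \<notin> {aI, aF}" for a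
    using 4(4) that by (simp add: agree_def)
  have "v \<in> row n (nmem s aFAM) k \<longleftrightarrow> nmem s aFAM (k * n + v) \<noteq> 0"
    using v by (simp add: row_def)
  thus ?case
    using 4(1-3) v L
    by (intro runs_Cond[OF z(1)] runs_NStore runs_Skip) (auto simp: fr less_Suc_eq envD[OF env])
qed (use L in \<open>auto simp: agree_def\<close>)

lemma runs_init_labels:
  assumes z: "2 \<le> z" "n \<le> z" and env: "env n m s" and L: "nmem s aCNT 0 = L" "L \<le> m" "L \<le> z"
    and lab: "lab = row n (nmem s aFAM)" and ex: "\<And>v. v < n \<Longrightarrow> \<exists>i<L. v \<in> lab i"
  shows "runs z init_labels s (\<lambda>t. labeling n L lab (nmem t aF))"
  unfolding init_labels_def
proof (rule runs_For[OF z, where Inv = "\<lambda>k t. \<forall>v<k. nmem t aF v < L \<and> v \<in> lab (nmem t aF v)"],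
    goal_cases)
  case (4 k t)
  have fr: "nmem t a = nmem s a" if "a \<notin> {aV, aI, aF}" for a
    using 4(4) that by (simp add: agree_def)
  have "runs z label_vertex t (\<lambda>t'. (\<forall>u. u \<noteq> k \<longrightarrow> nmem t' aF u = nmem t aF u) \<and>
    ((\<exists>i<L. k \<in> row n (nmem t aFAM) i) \<longrightarrow> nmem t' aF k < L \<and> k \<in> row n (nmem t aFAM) (nmem t' aF
        k)))"
    using 4 env L by (intro runs_label_vertex[OF z(1), where m = m]) (simp_all add: fr env_def)
  thus ?case
    by (rule runs_conseq) (use 4(2) ex[OF 4(1)] in \<open>auto simp: fr lab less_Suc_eq\<close>)
qed (use env in \<open>auto simp: agree_def env_def labeling_def\<close>)

lemma runs_set_bounds:
  assumes z: "2 \<le> z" "(n + 2) ^ 8 \<le> z" and n: "nmem s aN 0 = n" and L: "nmem s aCNT 0 = L"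
  shows "runs z set_bounds s (\<lambda>t. nmem t aK 0 = (n + 2) ^ 4 \<and> nmem t aTOTAL 0 = (n + 2) ^ 8 * L)"
proof -
  have le: "(n + 2) ^ i \<le> z" if "i \<le> 8" for i
    using order.trans[OF power_increasing[OF that, of "n + 2"] z(2)] by simp
  have eq: "(n + 2) * (n + 2) = (n + 2) ^ 2" "(n + 2) ^ 2 * (n + 2) ^ 2 = (n + 2) ^ 4"
    "(n + 2) ^ 4 * (n + 2) ^ 4 = (n + 2) ^ 8"
  proof -
    have "x * x = x ^ 2" "x ^ 2 * x ^ 2 = x ^ 4" "x ^ 4 * x ^ 4 = x ^ 8" for x :: nat
      by (rule power2_eq_square[symmetric]) (simp_all flip: power_add)
    thus "(n + 2) * (n + 2) = (n + 2) ^ 2" "(n + 2) ^ 2 * (n + 2) ^ 2 = (n + 2) ^ 4"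
      "(n + 2) ^ 4 * (n + 2) ^ 4 = (n + 2) ^ 8"
      by blast+
  qed
  have le1: "n + 2 \<le> z"
    using le[of 1] by simp
  show ?thesis
    unfolding set_bounds_def
  proof (rule runs_Seq[OF z(1), OF runs_conseq[OF runs_mult_into[OF z(1) le1, where k = "n +
      2"]]], goal_cases)
    case (2 t)
    thus ?case
      using n by (simp add: agree_def)
  next
    case (3 t1)
    have t1: "nmem t1 aSQ 0 = (n + 2) ^ 2" "nmem t1 aN 0 = n" "nmem t1 aCNT 0 = L"
      using 3(1) 3(2) n L unfolding eq(1) by (simp_all add: agree_def)
    show ?case
    proof (rule runs_Seq[OF z(1), OF runs_conseq[OF runs_mult_into[OF z(1) le[of 2], where k = "(n
        + 2) ^ 2"]]], goal_cases)
      case (3 t)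
      thus ?case
        using t1 by (simp add: agree_def)
    next
      case (4 t2)
      have t2: "nmem t2 aK 0 = (n + 2) ^ 4" "nmem t2 aCNT 0 = L"
        using 4 t1 unfolding eq(2) by (simp_all add: agree_def)
      show ?case
      proof (rule runs_Seq[OF z(1), OF runs_conseq[OF runs_mult_into[OF z(1) le[of 4], where k =
          "(n + 2) ^ 4"]]], goal_cases)
        case (3 t)
        thus ?case
          using t2 by (simp add: agree_def)
      next
        case (4 t3)
        have t3: "nmem t3 aKK 0 = (n + 2) ^ 8" "nmem t3 aK 0 = (n + 2) ^ 4" "nmem t3 aCNT 0 = L"
          using 4 t2 unfolding eq(3) by (simp_all add: agree_def)
        show ?case
          by (rule runs_conseq[OF runs_mult_into[OF z, where k = L]]) (use t3 in \<open>auto simp: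
              agree_def\<close>)
      qed auto
    qed auto
  qed auto
qed

lemma runs_write_row:
  assumes z: "2 \<le> z" "n \<le> z" and env: "env n m s" and u: "nmem s aU 0 = u" "u < n" "u \<le> m"
  shows "runs z write_row s (\<lambda>t.
    (\<forall>v<n. nmem t aOUT (u * n + v) \<noteq> 0 \<longleftrightarrow> nmem s aG (u * n + v) \<noteq> 0 \<and> nmem s aF u \<noteq> nmem s aF v) \<and>
    (\<forall>i<u. \<forall>v<n. nmem t aOUT (i * n + v) = nmem s aOUT (i * n + v)))"
  unfolding write_row_def
proof (rule runs_For[OF z, where Inv = "\<lambda>k t.
    (\<forall>v<k. nmem t aOUT (u * n + v) \<noteq> 0 \<longleftrightarrow> nmem s aG (u * n + v) \<noteq> 0 \<and> nmem s aF u \<noteq> nmem s aF v) \<and>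
    (\<forall>i<u. \<forall>v<n. nmem t aOUT (i * n + v) = nmem s aOUT (i * n + v))"], goal_cases)
  case (4 k t)
  have fr: "nmem t a = nmem s a" if "a \<notin> {aV, aOUT}" for a
    using 4(4) that by (simp add: agree_def)
  show ?case
    using 4(1-3) u
    by (intro runs_Cond[OF z(1)] runs_NStore) (auto simp: fr less_Suc_eq envD[OF env] index_eq_iff)
qed (use env in \<open>auto simp: agree_def env_def\<close>)

lemma runs_write_output:
  assumes z: "2 \<le> z" "n \<le> z" and env: "env n m s" "n \<le> m"
  shows "runs z write_output s (\<lambda>t. \<forall>u<n. \<forall>v<n.
    nmem t aOUT (u * n + v) \<noteq> 0 \<longleftrightarrow> nmem s aG (u * n + v) \<noteq> 0 \<and> nmem s aF u \<noteq> nmem s aF v)"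
  unfolding write_output_def
proof (rule runs_For[OF z, where Inv = "\<lambda>k t. \<forall>u<k. \<forall>v<n.
    nmem t aOUT (u * n + v) \<noteq> 0 \<longleftrightarrow> nmem s aG (u * n + v) \<noteq> 0 \<and> nmem s aF u \<noteq> nmem s aF v"],
        goal_cases)
  case (4 k t)
  have fr: "nmem t a = nmem s a" if "a \<notin> {aU, aV, aOUT}" for a
    using 4(4) that by (simp add: agree_def)
  have "runs z write_row t (\<lambda>t'.
    (\<forall>v<n. nmem t' aOUT (k * n + v) \<noteq> 0 \<longleftrightarrow> nmem t aG (k * n + v) \<noteq> 0 \<and> nmem t aF k \<noteq> nmem t aF v) \<and>
    (\<forall>i<k. \<forall>v<n. nmem t' aOUT (i * n + v) = nmem t aOUT (i * n + v)))"
    using 4 env by (intro runs_write_row[OF z, where m = m]) (simp_all add: fr env_def)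
  thus ?case
    by (rule runs_conseq) (use 4(2) in \<open>auto simp: fr less_Suc_eq\<close>)
qed (use env in \<open>auto simp: agree_def env_def\<close>)

lemma runs_search:
  assumes z: "2 \<le> z" "n + 1 \<le> z" and env: "env n m s" "n \<le> m"
    and L: "nmem s aCNT 0 = L" "L \<le> m" "L \<le> z"
    and lab: "lab = row n (nmem s aFAM)" and K: "nmem s aK 0 = (n + 2) ^ 4" "(n + 2) ^ 4 \<le> z"
    and N: "nmem s aTOTAL 0 = N" "N \<le> z"
    and W: "weights n W s" "\<And>u v. 0 \<le> W u v" "\<And>u v. W u v = W v u"
    and f: "labeling n L lab (nmem s aF)"
  shows "runs z (For aITER (Var aTOTAL) improve) s (\<lambda>t. labeling n L lab (nmem t aF) \<and>
    (improves n L W lab ^^ N) (nmem s aF) (nmem t aF))"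
proof (rule runs_For[OF z(1) N(2), where Inv = "\<lambda>k t. labeling n L lab (nmem t aF) \<and>
    (improves n L W lab ^^ k) (nmem s aF) (nmem t aF)"], goal_cases)
  case (4 k t)
  have fr: "nmem t a = nmem s a"
    if "a \<notin> {aITER, aA, aU, aD, aV, aSTEP, aFOUND, aPU, aADM, aPV, aLEV, aOCC, aGAP, aL, aBEST,
        aF}" for a
    using 4(4) that by (simp add: agree_def)
  have "rmem t rW = rmem s rW"
    using 4(4) by (simp add: agree_def)
  hence "runs z improve t (\<lambda>t'. labeling n L lab (nmem t' aF) \<and> improves n L W lab (nmem t aF)
      (nmem t' aF))"
    using 4(2) env L lab K W
    by (intro runs_improve[OF z, where m = m]) (simp_all add: fr env_def weights_def)
  thus ?case
    by (rule runs_conseq) (use 4(2) in auto)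
qed (use N f in \<open>auto simp: agree_def\<close>)

lemma row_major_index: "u < n \<Longrightarrow> v < n \<Longrightarrow> row_major n A (u * n + v) = A u v"
proof -
  assume uv: "u < n" "v < n"
  have "u * n + v < (u + 1) * n"
    using uv by simp
  also have "\<dots> \<le> n * n"
    using uv by (intro mult_le_mono1) simp
  finally show ?thesis
    using uv by (simp add: row_major_def)
qed

text \<open>One number bounds all loops: it covers the \<open>(n + 2) ^ 8 * L\<close> moves as well
  as the \<open>n + 2 * B\<close> row offsets, which is why \<open>B\<close> is asked to bound every
  stage of the enumeration.\<close>

theorem runs_algorithm:
  assumes I: "valid_instance I" and B: "\<And>j. j \<le> nverts I \<Longrightarrow> card (mis (dedges I) {..<j}) \<le> B"
  shows "runs ((nverts I + 2) ^ 8 * (2 * B + 2)) algorithm (input_state I)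
    (\<lambda>t. feasible I (output_edges I t) \<and> cost I (output_edges I t) \<le> 2 * opt I)"
    (is "runs ?z algorithm ?s ?Q")
proof -
  define n where "n = nverts I"
  define E where "E = dedges I"
  define W where "W = weight_matrix I"
  define z where "z = (n + 2) ^ 8 * (2 * B + 2)"
  define L where "L = card (mis E {..<n})"
  have LB: "L \<le> B"
    using B[of n] by (simp add: L_def E_def n_def)
  have E: "{x} \<notin> E" for x
    using I by (auto simp: E_def valid_instance_def all_pairs_def doubleton_eq_iff)
  have big: "(n + 2) ^ 8 * x \<le> z" if "x \<le> 2 * B + 2" for x
    unfolding z_def using that by (rule mult_le_mono2)
  have z8: "(n + 2) ^ 8 \<le> z"
    using big[of 1] by simp
  have pow: "(n + 2) ^ i \<le> z" if "i \<le> 8" for i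
    using order.trans[OF power_increasing[OF that, of "n + 2"] z8] by simp
  have n2: "n + 2 \<le> z"
    using pow[of 1] by simp
  hence z: "2 \<le> z" "n + 1 \<le> z" "n \<le> z"
    by simp_all
  have nB: "n + 2 * x \<le> z" if "x \<le> B" for x
  proof -
    have "n + 2 * x \<le> (n + 2) * (2 * B + 2)"
      using that by (simp add: algebra_simps)
    also have "\<dots> \<le> (n + 2) ^ 8 * (2 * B + 2)"
      using power_increasing[of 1 8 "n + 2"] by (intro mult_le_mono1) simp
    finally show ?thesis
      by (simp add: z_def)
  qed
  have Lz: "n + L \<le> z" "L \<le> z"
    using nB[OF LB] by simp_all
  have init: "nmem ?s aN 0 = n" "nmem ?s aFAM = (\<lambda>_. 0)" "adjacency n E ?s" "weights n W ?s"
    and graph: "\<And>u v. u < n \<Longrightarrow> v < n \<Longrightarrow> nmem ?s aG (u * n + v) \<noteq> 0 \<longleftrightarrow> {u, v} \<in> edges I"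
    by (auto simp: input_state_def n_def E_def W_def adjacency_def weights_def Let_def
        row_major_index weight_matrix_def)
  have cover: "\<exists>M\<in>mis E {..<n}. v \<in> M" if "v < n" for v
    using mis_extends[of "{..<n}" "{v}" E] that E by auto
  hence "0 < n \<Longrightarrow> 0 < L"
    by (auto simp: L_def card_gt_0_iff finite_mis)
  moreover have "n = 0 \<Longrightarrow> 0 < L"
    by (simp add: L_def mis_empty)
  ultimately have L0: "0 < L"
    by auto
  have enum: "runs z enum_mis ?s (\<lambda>t. family n (nmem t aFAM) (nmem t aCNT 0) (mis E {..<n}))"
    using nB B by (intro runs_enum_mis[OF z(1) init(1) z(3) init(3) E _ init(2)]) (simp_all add:
        n_def E_def)
  have "runs z algorithm ?s ?Q"
    unfolding algorithm_def
  proof (rule runs_Seq[OF z(1), OF runs_conseq[OF enum]])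
    fix t1 assume fam: "family n (nmem t1 aFAM) (nmem t1 aCNT 0) (mis E {..<n})"
      and "agree (nwrites enum_mis) (rwrites enum_mis) ?s t1"
    hence fr1: "nmem t1 a = nmem ?s a"
      "rmem t1 = rmem ?s" if "a \<notin> {aJ, aROW, aX, aB, aI, aV, aCAND, aOK, aHIT, aU, aR, aNEW,
          aCNT', aFAM, aCNT}" for a
      using that by (auto simp: agree_def)
    define lab where "lab = row n (nmem t1 aFAM)"
    have CNT: "nmem t1 aCNT 0 = L"
      using family_card[OF fam] by (simp add: L_def)
    have lab: "mis E {..<n} = lab ` {..<L}"
      using fam CNT by (simp add: family_def lab_def)
    have n1: "nmem t1 aN 0 = n"
      using init(1) by (simp add: fr1)
    let ?fill = "fill_rows (NAdd (Var aN) (Var aCNT))"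
    have "runs z ?fill t1 (env n (n + L))"
      using n1 CNT by (intro runs_fill_rows[OF z(1) Lz(1)]) (auto simp: agree_def)
    thus "runs z (Seq ?fill (Seq init_labels (Seq set_bounds
        (Seq (For aITER (Var aTOTAL) improve) write_output)))) t1 ?Q"
    proof (rule runs_Seq[OF z(1), OF runs_conseq])
      fix t2 assume env2: "env n (n + L) t2" and "agree (nwrites ?fill) (rwrites ?fill) t1 t2"
      hence fr2: "nmem t2 a = nmem t1 a" "rmem t2 = rmem t1" if "a \<notin> {aROW, aX}" for a
        using that by (auto simp: agree_def)
      have "runs z init_labels t2 (\<lambda>t. labeling n L lab (nmem t aF))"
      proof (rule runs_init_labels[OF z(1,3) env2])
        show "\<exists>i<L. v \<in> lab i" if "v < n" for v
          using cover[OF that] lab by auto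
      qed (use CNT Lz in \<open>simp_all add: fr2 lab_def\<close>)
      thus "runs z (Seq init_labels (Seq set_bounds
          (Seq (For aITER (Var aTOTAL) improve) write_output))) t2 ?Q"
      proof (rule runs_Seq[OF z(1), OF runs_conseq])
        fix t3 assume f3: "labeling n L lab (nmem t3 aF)"
          and "agree (nwrites init_labels) (rwrites init_labels) t2 t3"
        hence fr3: "nmem t3 a = nmem t2 a" "rmem t3 = rmem t2" if "a \<notin> {aV, aI, aF}" for a
          using that by (auto simp: agree_def)
        have "runs z set_bounds t3 (\<lambda>t. nmem t aK 0 = (n + 2) ^ 4 \<and> nmem t aTOTAL 0 = (n + 2) ^ 8
            * L)"
          using n1 CNT by (intro runs_set_bounds[OF z(1) z8]) (simp_all add: fr3 fr2)
        thus "runs z (Seq set_bounds (Seq (For aITER (Var aTOTAL) improve) write_output)) t3 ?Q"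
        proof (rule runs_Seq[OF z(1), OF runs_conseq])
          fix t4 assume t4: "nmem t4 aK 0 = (n + 2) ^ 4 \<and> nmem t4 aTOTAL 0 = (n + 2) ^ 8 * L"
            and "agree (nwrites set_bounds) (rwrites set_bounds) t3 t4"
          hence fr4: "nmem t4 a = nmem t3 a" "rmem t4 = rmem t3" if "a \<notin> {aX, aSQ, aK, aKK,
              aTOTAL}" for a
            using that by (auto simp: agree_def)
          have rm: "rmem t4 = rmem ?s"
            using fr1(2)[of 0] fr2(2)[of 0] fr3(2)[of 0] fr4(2)[of 0] by simp
          have env4: "env n (n + L) t4"
            using env2 by (simp add: env_def fr4 fr3)
          have "runs z (For aITER (Var aTOTAL) improve) t4 (\<lambda>t. labeling n L lab (nmem t aF) \<and>
              (improves n L W lab ^^ ((n + 2) ^ 8 * L)) (nmem t4 aF) (nmem t aF))"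
          proof (rule runs_search[OF z(1,2) env4])
            show "weights n W t4"
              using init(4) rm by (simp add: weights_def)
            show "(n + 2) ^ 8 * L \<le> z"
              using LB by (intro big) simp
            show "(n + 2) ^ 4 \<le> z"
              by (rule pow) simp
            show "0 \<le> W u v" "W u v = W v u" for u v
              unfolding W_def using weight_matrix_nonneg[OF I] weight_matrix_sym by auto
          qed (use t4 f3 CNT Lz in \<open>simp_all add: fr4 fr3 fr2 lab_def\<close>)
          thus "runs z (Seq (For aITER (Var aTOTAL) improve) write_output) t4 ?Q"
          proof (rule runs_Seq[OF z(1), OF runs_conseq])
            fix t5 assume t5: "labeling n L lab (nmem t5 aF) \<and>
                (improves n L W lab ^^ ((n + 2) ^ 8 * L)) (nmem t4 aF) (nmem t5 aF)"
              and "agree (nwrites (For aITER (Var aTOTAL) improve)) (rwrites (For aITER (Var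
                  aTOTAL) improve)) t4 t5"
            hence fr5: "nmem t5 a = nmem t4 a"
              if "a \<notin> {aITER, aA, aU, aD, aV, aSTEP, aFOUND, aPU, aADM, aPV, aLEV, aOCC, aGAP, aL,
                  aBEST, aF}" for a
              using that by (auto simp: agree_def)
            let ?f = "nmem t5 aF"
            have env5: "env n (n + L) t5"
              using env4 by (simp add: env_def fr5)
            have two: "label_cost n W ?f \<le> 2 * label_cost n W h" if h: "labeling n L lab h" for h
            proof (rule local_search_two_approx[OF _ _ h L0])
              show "(improves n L W lab ^^ ((n + 2) ^ 8 * L)) (nmem t4 aF) ?f"
                using t5 by simp
              show "W u v = W v u" "0 \<le> W u v" for u v
                unfolding W_def using weight_matrix_nonneg[OF I] weight_matrix_sym by auto
              have "16 * (n * n + 1)\<^sup>2 \<le> (n + 2) ^ 4 * ((n + 2)\<^sup>2)\<^sup>2"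
                using power_mono[of 2 "n + 2" 4]
                by (intro mult_mono power_mono) (auto simp: power2_eq_square)
              also have "\<dots> = (n + 2) ^ 8"
                by (simp only: power_mult[symmetric] power_add[symmetric]) simp
              finally show "16 * (n * n + 1)\<^sup>2 \<le> (n + 2) ^ 8" .
            qed
            show "runs z write_output t5 ?Q"
            proof (rule runs_conseq[OF runs_write_output[OF z(1,3) env5]])
              fix t6 :: state assume t6: "\<forall>u<n. \<forall>v<n. nmem t6 aOUT (u * n + v) \<noteq> 0 \<longleftrightarrow>
                  nmem t5 aG (u * n + v) \<noteq> 0 \<and> ?f u \<noteq> ?f v"
              have G: "nmem t5 aG = nmem ?s aG"
                by (simp add: fr5 fr4 fr3 fr2 fr1)
              have vert: "u < n" "v < n" if "{u, v} \<in> edges I" for u v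
              proof -
                have "{u, v} \<in> all_pairs {..<n}"
                  using that I by (auto simp: valid_instance_def n_def)
                thus "u < n" "v < n"
                  by (auto simp: all_pairs_def doubleton_eq_iff)
              qed
              have out: "nmem t6 aOUT (u * n + v) \<noteq> 0 \<longleftrightarrow> {u, v} \<in> edges I \<and> ?f u \<noteq> ?f v"
                if "u < n" "v < n" for u v
                using t6 graph[OF that] that unfolding G by blast
              have "output_edges I t6 = label_cut I ?f"
                unfolding output_edges_def label_cut_def n_def[symmetric]
                using out vert by (intro Collect_cong ex_cong1) blast
              moreover have "feasible I (label_cut I ?f)"
                using t5 lab unfolding n_def E_def by (intro feasible_label_cut[OF I]) auto
              moreover have "cost I (label_cut I ?f) \<le> 2 * opt I"
                using lab two unfolding n_def E_def W_def by (rule label_cut_two_approx[OF I])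
              ultimately show "?Q t6"
                by simp
            qed simp
          qed
        qed
      qed
    qed
  qed
  thus ?thesis
    by (simp add: z_def n_def)
qed

theorem theorem1:
  shows "\<exists>P. approx_algorithm 2 P \<and>
    (\<exists>a b c :: nat. \<forall>I t.
       valid_instance I \<and> t > 1 \<and> tK2_free t (dedges I) \<longrightarrow>
       running_time P I \<le> a * (nverts I + card (dverts I) ^ (b * t)) ^ c + a)"
proof (intro exI conjI)
  show "approx_algorithm 2 algorithm"
    unfolding approx_algorithm_def
  proof (intro allI impI)
    fix I assume I: "valid_instance I"
    \<comment> \<open>Correctness concerns every \<open>H\<close>, so the bound is merely finite:
      the sum over all stages.\<close>
    have "card (mis (dedges I) {..<j}) \<le> (\<Sum>j\<le>nverts I. card (mis (dedges I) {..<j}))" if "j \<le>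
        nverts I" for j
      using that by (intro member_le_sum) auto
    from runs_algorithm[OF I this]
    show "\<exists>T s. exec algorithm (input_state I) T s \<and> feasible I (output_edges I s) \<and>
        cost I (output_edges I s) \<le> 2 * opt I"
      unfolding runs_def by blast
  qed
  \<comment> \<open>Degree 8 comes from \<open>(n + 2) ^ 8\<close> and degree 1 from the number of
    labels; the time bound raises this to the power \<open>deg algorithm\<close>.\<close>
  let ?c = "9 * deg algorithm"
  show "\<forall>I t. valid_instance I \<and> t > 1 \<and> tK2_free t (dedges I) \<longrightarrow>
      running_time algorithm I \<le> 6 ^ ?c * (nverts I + card (dverts I) ^ (3 * t)) ^ ?c + 6 ^ ?c"
  proof (intro allI impI, elim conjE)
    fix I and t :: nat
    assume I: "valid_instance I" and t: "t > 1" and free: "tK2_free t (dedges I)"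
    let ?n = "nverts I" and ?k = "card (dverts I)" and ?E = "dedges I"
    let ?y = "?n + ?k ^ (3 * t)"
    have fin: "finite (dverts I)"
      using I finite_subset[of "dverts I" "{..<?n}"] by (simp add: valid_instance_def)
    have edge: "\<exists>u v. e = {u, v} \<and> u \<in> dverts I \<and> v \<in> dverts I \<and> u \<noteq> v" if "e \<in> ?E" for e
      using that I by (auto simp: valid_instance_def all_pairs_def)
    have E2: "card e = 2" if "e \<in> ?E" for e
      using edge[OF that] by auto
    \<comment> \<open>The summand 1 covers \<open>k = 0\<close>, where the power vanishes but one
      maximal independent set exists.\<close>
    have count: "card (mis ?E {..<j}) \<le> ?k ^ (3 * t) + 1" for j
    proof -
      let ?D = "{..<j} \<inter> dverts I"
      have 1: "card (mis ?E {..<j}) \<le> card (mis ?E ?D)"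
        using edge by (intro card_mis_isolated) fastforce+
      show ?thesis
      \<comment> \<open>For \<open>k <= 1\<close> there are no demand edges. Otherwise
        \<open>k^2 + 1 <= k^3\<close>, which is the origin of the 3 in the exponent.\<close>
      proof (cases "?k \<le> 1")
        case True
        have "{u, v} \<notin> ?E" for u v
        proof
          assume "{u, v} \<in> ?E"
          then obtain x y where "x \<in> dverts I" "y \<in> dverts I" "x \<noteq> y"
            using edge by blast
          hence "card {x, y} \<le> ?k" "card {x, y} = 2"
            using card_mono[OF fin, of "{x, y}"] by auto
          thus False
            using True by simp
        qed
        thus ?thesis
          using 1 by (simp add: mis_no_edges)
      next
        case False
        hence k: "2 \<le> ?k"
          by simp
        have "card (mis ?E ?D) \<le> ((card ?D)\<^sup>2 + 1) ^ (t - 1)"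
          using t E2 free tK2_free_restrict[OF free, of ?D]
          by (intro card_mis_tK2_free) auto
        also have "\<dots> \<le> (?k\<^sup>2 + 1) ^ (t - 1)"
          using fin by (intro power_mono add_mono card_mono) auto
        also have "\<dots> \<le> (?k ^ 3) ^ (t - 1)"
        proof (rule power_mono)
          have "?k\<^sup>2 + 1 \<le> 2 * ?k\<^sup>2"
            using k by simp
          also have "\<dots> \<le> ?k * ?k\<^sup>2"
            using k by (rule mult_le_mono1)
          finally show "?k\<^sup>2 + 1 \<le> ?k ^ 3"
            by (simp add: power3_eq_cube power2_eq_square)
        qed simp
        also have "\<dots> \<le> ?k ^ (3 * t)"
          unfolding power_mult[symmetric] using k by (intro power_increasing) auto
        finally show ?thesis
          using 1 by simp
      qed
    qed
    obtain T s where T: "exec algorithm (input_state I) T s"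
        "T \<le> ((?n + 2) ^ 8 * (2 * (?k ^ (3 * t) + 1) + 2)) ^ deg algorithm"
      using runs_algorithm[OF I count] unfolding runs_def by blast
    have "(?n + 2) ^ 8 * (2 * (?k ^ (3 * t) + 1) + 2) \<le> (2 * ?y + 4) ^ 8 * (2 * ?y + 4)"
      by (intro mult_mono power_mono) auto
    also have "\<dots> = (2 * ?y + 4) ^ 9"
      by (simp only: power_Suc2[symmetric]) simp
    finally have "((?n + 2) ^ 8 * (2 * (?k ^ (3 * t) + 1) + 2)) ^ deg algorithm \<le> ((2 * ?y + 4) ^
        9) ^ deg algorithm"
      by (rule power_mono) simp
    also have "\<dots> = (2 * ?y + 4) ^ ?c"
      by (simp only: power_mult)
    \<comment> \<open>\<open>2 * y + 4 <= 6 * y\<close> needs a positive \<open>y\<close>; the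
      additive constant covers \<open>y = 0\<close>.\<close>
    also have "\<dots> \<le> 6 ^ ?c * ?y ^ ?c + 6 ^ ?c"
    proof (cases "?y = 0")
      case True
      have "(4 :: nat) ^ ?c \<le> 6 ^ ?c"
        by (rule power_mono) auto
      thus ?thesis
        unfolding True by simp
    next
      case False
      have "2 * y + 4 \<le> 6 * y" if "y \<noteq> 0" for y :: nat
        using that by simp
      hence "(2 * ?y + 4) ^ ?c \<le> (6 * ?y) ^ ?c"
        using False by (intro power_mono) blast+
      thus ?thesis
        by (simp only: power_mult_distrib)
    qed
    finally show "running_time algorithm I \<le> 6 ^ ?c * ?y ^ ?c + 6 ^ ?c"
      using T(2) running_time_eq[OF T(1)] by simp
  qed
qed

end
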